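(* Let $m>0$, $a\in\mathbb{R}$ with $|a|<m$, $\sigma\in\mathbb{R}\setminus\{0\}$, $k\in\mathbb{Z}$, and let $u=e^{-i\sigma t-ik\phi}u_0(r,\theta)$ be a mode solution of the scalar wave equation on the Kerr exterior which is smooth across the future event horizon, i.e. such that for some $\delta\in(0,r_+-r_-)$ the function $u_*=e^{-i\sigma\Phi(r)-ik\Psi(r)}u_0$ extends from $r>r_+$ to $r>r_+-\delta$ so that $e^{-ik\phi_*}u_*(r,\theta)$ is smooth on $(r_+-\delta,\infty)\times S^2_{\phi_*,\theta}$ and $e^{-i\sigma t_*-ik\phi_*}u_*$ solves the wave equation there. Set $$\alpha=-2i\sigma'\frac{r_+^2+a^2}{\mu'(r_+)},\qquad \sigma'=\sigma+k\frac{a}{r_+^2+a^2}.$$ Then the distribution $$\tilde u=(x_* )_+^{\alpha}\,e^{-ik\phi_*'}\,u_*(r,\theta)$$ on the region $\{r>r_+-\delta\}$ of the Kruskal-type extension of Kerr (an open neighborhood of the closed domain of outer communications, containing in particular a full neighborhood of the bifurcate sphere $\{x_*=x_{**}=0\}$) coincides with $u$ in the domain of outer communications $\{x_*>0,\ x_{**}>0\}$, is supported in $\{x_*\ge0\}$ (so it is the extension of $u$ by $0$ across the past event horizon $\{x_*=0\}$), is conormal to $\{x_*=0\}$, and solves the wave equation $\Box\tilde u=0$ in the sense of distributions there.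
   Context: Kerr exterior: $\mathbb{R}_t\times(r_+,\infty)_r\times S^2_{\phi,\theta}$ with $\mu(r)=r^2-2mr+a^2$, $r_\pm=m\pm\sqrt{m^2-a^2}$ and metric $$g=\rho^2\Big(\frac{dr^2}{\mu}+d\theta^2\Big)+\frac{\sin^2\theta}{\rho^2}\big(a\,dt-(r^2+a^2)d\phi\big)^2-\frac{\mu}{\rho^2}\big(dt-a\sin^2\theta\,d\phi\big)^2,\quad \rho^2=r^2+a^2\cos^2\theta .$$ $\Box$ is its scalar wave operator. A mode solution is a solution $e^{-i\sigma t-ik\phi}u_0(r,\theta)$ of $\Box u=0$ with $e^{-ik\phi}u_0$ smooth on $(r_+,\infty)\times S^2$. Functions: $\Phi'(r)=-\frac{r^2+a^2}{\mu(r)}$, $\Psi'(r)=-\frac{a}{\mu(r)}$ on $(r_+,\infty)$, written as $$\Phi=-\frac{r_+^2+a^2}{\mu'(r_+)}\log(r-r_+)+\tilde\Phi,\qquad \Psi=-\frac{a}{\mu'(r_+)}\log(r-r_+)+\tilde\Psi,$$ where $\tilde\Phi,\tilde\Psi$ extend smoothly to $(r_-,\infty)$. Coordinates: $t_*=t-\Phi(r)$, $\phi_*=\phi-\Psi(r)$ (these, with $r,\theta$, extend the metric smoothly across the future event horizon $r=r_+$), $t_{**}=t+\Phi(r)$, and $\phi_*'=\phi_*-\frac{a}{r_+^2+a^2}t_*$. With $\kappa=\frac{\mu'(r_+)}{2(r_+^2+a^2)}$ put, in the exterior, $x_*=e^{\kappa t_*}$ and $x_{**}=e^{-\kappa t_{**}}$,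 so that $$x_*x_{**}=e^{-2\kappa\tilde\Phi(r)}(r-r_+).$$ The Kruskal-type extension is $\mathbb{R}^2_{(x_*,x_{**})}\times S^2_{\phi_*',\theta}$, where $x_*,x_{**}$ may now have any sign, $r>r_-$ is the smooth function determined by the last displayed identity, and the Kerr metric extends smoothly to it. In it, $\{x_{**}=0\}$ is the (continuation of the) future event horizon and $\{x_*=0\}$ the (continuation of the) past event horizon. $(x_* )_+^{\alpha}$ is the locally integrable function equal to $x_*^\alpha$ for $x_*>0$ and $0$ for $x_*\le0$ ($\alpha$ is purely imaginary). A distribution is conormal to $\{x_*=0\}$ if its regularity, in some fixed Sobolev space locally, is preserved under iterated application of smooth vector fields tangent to $\{x_*=0\}$. *)

theory Defs
  imports "HOL-Analysis.Analysis"
begin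

section \<open>Smooth functions and partial derivatives\<close>

primrec Ck_on :: "nat \<Rightarrow> 'a::real_normed_vector set \<Rightarrow> ('a \<Rightarrow> 'b::real_normed_vector) \<Rightarrow> bool" where
  "Ck_on 0 S f \<longleftrightarrow> continuous_on S f"
| "Ck_on (Suc n) S f \<longleftrightarrow> (\<forall>x\<in>S. f differentiable (at x)) \<and>
     (\<forall>v. Ck_on n S (\<lambda>x. frechet_derivative f (at x) v))"

text \<open>Only meaningful for open \<open>S\<close>.\<close>

definition smooth_on :: "'a::real_normed_vector set \<Rightarrow> ('a \<Rightarrow> 'b::real_normed_vector) \<Rightarrow> bool" where
  "smooth_on S f \<longleftrightarrow> (\<forall>n. Ck_on n S f)"

definition partial :: "'n \<Rightarrow> (real^'n \<Rightarrow> 'b::real_normed_vector) \<Rightarrow> real^'n \<Rightarrow> 'b" where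
  "partial i f x = frechet_derivative f (at x) (axis i 1)"


section \<open>Distributions on open subsets of Euclidean space\<close>

definition test_function :: "(real^'n) set \<Rightarrow> (real^'n \<Rightarrow> complex) \<Rightarrow> bool" where
  "test_function U \<psi> \<longleftrightarrow> smooth_on UNIV \<psi> \<and>
     compact (closure {x. \<psi> x \<noteq> 0}) \<and> closure {x. \<psi> x \<noteq> 0} \<subseteq> U"

text \<open>A distribution on \<open>U\<close> is represented by a functional that is only ever evaluated on
  the test functions of \<open>U\<close>. All distributions below arise from locally integrable
  functions by differentiation and by multiplication with functions smooth on \<open>U\<close>.\<close>

type_synonym 'n distr = "(real^'n \<Rightarrow> complex) \<Rightarrow> complex"

definition locally_integrable_on :: "(real^'n) set \<Rightarrow> (real^'n \<Rightarrow> complex) \<Rightarrow> bool" where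
  "locally_integrable_on U f \<longleftrightarrow> (\<forall>K. compact K \<and> K \<subseteq> U \<longrightarrow> set_integrable lborel K f)"

definition distr_of :: "(real^'n \<Rightarrow> complex) \<Rightarrow> 'n distr" where
  "distr_of f = (\<lambda>\<psi>. \<integral>x. f x * \<psi> x \<partial>lborel)"

definition distr_partial :: "'n::finite \<Rightarrow> 'n distr \<Rightarrow> 'n distr" where
  "distr_partial i T = (\<lambda>\<psi>. - T (partial i \<psi>))"

definition distr_mult :: "(real^'n \<Rightarrow> complex) \<Rightarrow> 'n distr \<Rightarrow> 'n distr" where
  "distr_mult f T = (\<lambda>\<psi>. T (\<lambda>x. f x * \<psi> x))"

definition distr_sum :: "('n::finite \<Rightarrow> 'n distr) \<Rightarrow> 'n distr" where
  "distr_sum T = (\<lambda>\<psi>. \<Sum>i\<in>UNIV. T i \<psi>)"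

definition distr_zero_on :: "(real^'n) set \<Rightarrow> 'n distr \<Rightarrow> bool" where
  "distr_zero_on U T \<longleftrightarrow> (\<forall>\<psi>. test_function U \<psi> \<longrightarrow> T \<psi> = 0)"

definition distr_support :: "(real^'n) set \<Rightarrow> 'n distr \<Rightarrow> (real^'n) set" where
  "distr_support U T = {x \<in> U. \<not> (\<exists>W. open W \<and> x \<in> W \<and> W \<subseteq> U \<and> distr_zero_on W T)}"

text \<open>\<open>T \<in> H\<^sup>s\<close> locally: the Fourier transform \<open>\<xi> \<mapsto> T (c e\<^sub>\<xi>)\<close>,
  \<open>e\<^sub>\<xi> x = exp (-\<i> \<xi> \<bullet> x)\<close>, of each localization \<open>c T\<close> lies in
  \<open>L\<^sup>2\<close> with weight \<open>(1 + |\<xi>|\<^sup>2)\<^sup>s\<close>.\<close>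

definition in_sobolev_loc :: "real \<Rightarrow> (real^'n) set \<Rightarrow> 'n distr \<Rightarrow> bool" where
  "in_sobolev_loc s U T \<longleftrightarrow> (\<forall>c. test_function U c \<longrightarrow>
     integrable lborel (\<lambda>\<xi>. (1 + (norm \<xi>)\<^sup>2) powr s *
       (cmod (T (\<lambda>x. c x * exp (- \<i> * complex_of_real (\<xi> \<bullet> x)))))\<^sup>2))"

definition vector_field_deriv :: "(real^'n \<Rightarrow> real^'n) \<Rightarrow> 'n distr \<Rightarrow> 'n distr" where
  "vector_field_deriv V T =
     distr_sum (\<lambda>i. distr_mult (\<lambda>x. complex_of_real (V x $ i)) (distr_partial i T))"

text \<open>Smooth vector fields on \<open>U\<close> tangent to \<open>{x. x $ i = 0}\<close>.\<close>

definition tangent_field :: "(real^'n) set \<Rightarrow> 'n \<Rightarrow> (real^'n \<Rightarrow> real^'n) \<Rightarrow> bool" where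
  "tangent_field U i V \<longleftrightarrow> smooth_on U V \<and> (\<forall>x\<in>U. x $ i = 0 \<longrightarrow> V x $ i = 0)"

text \<open>Conormality on \<open>U\<close> to the coordinate hyperplane \<open>{x. x $ i = 0}\<close>, relative
  to the Sobolev space \<open>H\<^sup>s\<close>.\<close>

definition conormal_rel :: "real \<Rightarrow> (real^'n) set \<Rightarrow> 'n \<Rightarrow> 'n distr \<Rightarrow> bool" where
  "conormal_rel s U i T \<longleftrightarrow> (\<forall>Vs. (\<forall>V\<in>set Vs. tangent_field U i V) \<longrightarrow>
     in_sobolev_loc s U (foldr vector_field_deriv Vs T))"


section \<open>The scalar wave operator of a metric on an open subset of Euclidean space\<close>

definition vol_density :: "(real^'n \<Rightarrow> real^'n^'n) \<Rightarrow> real^'n \<Rightarrow> real" where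
  "vol_density g x = sqrt \<bar>det (g x)\<bar>"

definition wave_op :: "(real^'n \<Rightarrow> real^'n^'n) \<Rightarrow> (real^'n \<Rightarrow> complex) \<Rightarrow> real^'n \<Rightarrow> complex" where
  "wave_op g u x = complex_of_real (1 / vol_density g x) *
     (\<Sum>i\<in>UNIV. partial i (\<lambda>y. \<Sum>j\<in>UNIV.
        complex_of_real (vol_density g y * matrix_inv (g y) $ i $ j) * partial j u y) x)"

definition distr_wave_op :: "(real^'n \<Rightarrow> real^'n^'n) \<Rightarrow> 'n distr \<Rightarrow> 'n distr" where
  "distr_wave_op g T = distr_mult (\<lambda>x. complex_of_real (1 / vol_density g x))
     (distr_sum (\<lambda>i. distr_partial i (distr_sum (\<lambda>j.
        distr_mult (\<lambda>y. complex_of_real (vol_density g y * matrix_inv (g y) $ i $ j))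
          (distr_partial j T)))))"


section \<open>The Kerr metric\<close>

definition mu :: "real \<Rightarrow> real \<Rightarrow> real \<Rightarrow> real" where
  "mu m a r = r\<^sup>2 - 2 * m * r + a\<^sup>2"

definition mu_deriv :: "real \<Rightarrow> real \<Rightarrow> real" where
  "mu_deriv m r = 2 * r - 2 * m"

definition r_plus :: "real \<Rightarrow> real \<Rightarrow> real" where
  "r_plus m a = m + sqrt (m\<^sup>2 - a\<^sup>2)"

definition r_minus :: "real \<Rightarrow> real \<Rightarrow> real" where
  "r_minus m a = m - sqrt (m\<^sup>2 - a\<^sup>2)"

text \<open>Boyer--Lindquist coordinates are \<open>q = (t, r, \<phi>, \<theta>)\<close>; the metric is evaluated on
  two tangent vectors \<open>v\<close>, \<open>w\<close> at \<open>q\<close>.\<close>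

definition kerr_metric :: "real \<Rightarrow> real \<Rightarrow> real^4 \<Rightarrow> real^4 \<Rightarrow> real^4 \<Rightarrow> real" where
  "kerr_metric m a q v w =
    (let r = q $ 2; \<theta> = q $ 4; \<rho>2 = r\<^sup>2 + a\<^sup>2 * (cos \<theta>)\<^sup>2 in
      \<rho>2 * (v $ 2 * w $ 2 / mu m a r + v $ 4 * w $ 4)
      + (sin \<theta>)\<^sup>2 / \<rho>2 * (a * v $ 1 - (r\<^sup>2 + a\<^sup>2) * v $ 3) * (a * w $ 1 - (r\<^sup>2 + a\<^sup>2) * w $ 3)
      - mu m a r / \<rho>2 * (v $ 1 - a * (sin \<theta>)\<^sup>2 * v $ 3) * (w $ 1 - a * (sin \<theta>)\<^sup>2 * w $ 3))"

text \<open>The sphere is covered by its two stereographic charts, with values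
  \<open>z = tan (\<theta>/2) e\<^sup>i\<^sup>\<phi>\<close> (\<open>north = True\<close>, \<open>\<theta> \<noteq> \<pi>\<close>) and \<open>z = cot (\<theta>/2) e\<^sup>i\<^sup>\<phi>\<close>
  (\<open>north = False\<close>, \<open>\<theta> \<noteq> 0\<close>). A function \<open>e\<^sup>-\<^sup>i\<^sup>k\<^sup>\<phi> f(\<theta>)\<close> on the sphere takes the
  value \<open>f(\<theta>)\<close> at the poles (\<open>Arg 0 = 0\<close>); its smoothness forces this value to be \<open>0\<close>
  if \<open>k \<noteq> 0\<close>.\<close>

definition sphere_theta :: "bool \<Rightarrow> complex \<Rightarrow> real" where
  "sphere_theta north z = (if north then 2 * arctan (cmod z) else pi - 2 * arctan (cmod z))"

text \<open>A product of \<open>\<real>\<^sup>2\<close> (or an open subset of it) with the sphere is covered by two charts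
  with values in \<open>\<real>\<^sup>4\<close>; the last two coordinates are \<open>Re z\<close> and \<open>Im z\<close>.\<close>

definition chart_z :: "real^4 \<Rightarrow> complex" where
  "chart_z X = Complex (X $ 3) (X $ 4)"

definition angular :: "bool \<Rightarrow> real^4 \<Rightarrow> real^4" where
  "angular north X = vector [X $ 1, X $ 2, Arg (chart_z X), sphere_theta north (chart_z X)]"

text \<open>The Kerr metric in a chart from which Boyer--Lindquist coordinates are computed by \<open>C\<close>:
  the pullback of \<^const>\<open>kerr_metric\<close> by \<open>C\<close>, extended by continuity to the horizons
  (\<open>\<mu> = 0\<close>), to the axis (\<open>z = 0\<close>) and to the branch cut of \<^const>\<open>Arg\<close>.\<close>

definition kerr_in_chart :: "real \<Rightarrow> real \<Rightarrow> (real^4 \<Rightarrow> real^4) \<Rightarrow> real^4 \<Rightarrow> real^4^4" where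
  "kerr_in_chart m a C X =
     Lim (at X within {Y. mu m a (C Y $ 2) \<noteq> 0 \<and> chart_z Y \<notin> \<real>\<^sub>\<le>\<^sub>0})
       (\<lambda>Y. \<chi> i j. kerr_metric m a (C Y)
          (frechet_derivative C (at Y) (axis i 1)) (frechet_derivative C (at Y) (axis j 1)))"


section \<open>Coordinates regular at the horizons\<close>

text \<open>The functions \<open>\<Phi>\<close>, \<open>\<Psi>\<close> in terms of their regular parts \<open>Pt\<close>, which are smooth on
  \<open>(r\<^sub>-, \<infinity>)\<close>. Writing the logarithm with \<open>|r - r\<^sub>+|\<close> continues \<open>\<Phi>\<close>, \<open>\<Psi>\<close> to
  \<open>(r\<^sub>-, r\<^sub>+)\<close>.\<close>

definition Phi_of :: "real \<Rightarrow> real \<Rightarrow> (real \<Rightarrow> real) \<Rightarrow> real \<Rightarrow> real" where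
  "Phi_of m a Pt r =
     - ((r_plus m a)\<^sup>2 + a\<^sup>2) / mu_deriv m (r_plus m a) * ln \<bar>r - r_plus m a\<bar> + Pt r"

definition Psi_of :: "real \<Rightarrow> real \<Rightarrow> (real \<Rightarrow> real) \<Rightarrow> real \<Rightarrow> real" where
  "Psi_of m a Pt r = - a / mu_deriv m (r_plus m a) * ln \<bar>r - r_plus m a\<bar> + Pt r"

text \<open>The extension of the regular parts from \<open>(r\<^sub>+, \<infinity>)\<close> to \<open>(r\<^sub>-, \<infinity>)\<close> is the one for which
  the formulas for \<open>\<Phi>'\<close>, \<open>\<Psi>'\<close> persist on \<open>(r\<^sub>-, r\<^sub>+)\<close>; the additive constants are arbitrary.\<close>

definition regular_parts :: "real \<Rightarrow> real \<Rightarrow> (real \<Rightarrow> real) \<Rightarrow> (real \<Rightarrow> real) \<Rightarrow> bool" where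
  "regular_parts m a \<Phi>t \<Psi>t \<longleftrightarrow>
     smooth_on {r_minus m a<..} \<Phi>t \<and> smooth_on {r_minus m a<..} \<Psi>t \<and>
     (\<forall>r. r > r_minus m a \<and> r \<noteq> r_plus m a \<longrightarrow>
        (Phi_of m a \<Phi>t has_real_derivative - (r\<^sup>2 + a\<^sup>2) / mu m a r) (at r) \<and>
        (Psi_of m a \<Psi>t has_real_derivative - a / mu m a r) (at r))"

text \<open>Boyer--Lindquist coordinates as functions of \<open>(t\<^sub>*, r, \<phi>\<^sub>*, \<theta>)\<close>.\<close>

definition bl_of_ingoing ::
  "real \<Rightarrow> real \<Rightarrow> (real \<Rightarrow> real) \<Rightarrow> (real \<Rightarrow> real) \<Rightarrow> real^4 \<Rightarrow> real^4" where
  "bl_of_ingoing m a \<Phi>t \<Psi>t Y =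
     vector [Y $ 1 + Phi_of m a \<Phi>t (Y $ 2), Y $ 2, Y $ 3 + Psi_of m a \<Psi>t (Y $ 2), Y $ 4]"

definition surface_gravity :: "real \<Rightarrow> real \<Rightarrow> real" where
  "surface_gravity m a = mu_deriv m (r_plus m a) / (2 * ((r_plus m a)\<^sup>2 + a\<^sup>2))"

text \<open>The product \<open>x\<^sub>* x\<^sub>*\<^sub>*\<close> as a function of \<open>r > r\<^sub>-\<close>, and its inverse.\<close>

definition kruskal_prod :: "real \<Rightarrow> real \<Rightarrow> (real \<Rightarrow> real) \<Rightarrow> real \<Rightarrow> real" where
  "kruskal_prod m a \<Phi>t r = exp (- 2 * surface_gravity m a * \<Phi>t r) * (r - r_plus m a)"

definition kruskal_r :: "real \<Rightarrow> real \<Rightarrow> (real \<Rightarrow> real) \<Rightarrow> real \<Rightarrow> real" where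
  "kruskal_r m a \<Phi>t p = (THE r. r > r_minus m a \<and> kruskal_prod m a \<Phi>t r = p)"

text \<open>The region \<open>r > r\<^sub>+ - \<delta>\<close> of the Kruskal-type extension, in either chart. (The whole plane
  is the image of \<open>r > r\<^sub>-\<close> only for \<open>a \<noteq> 0\<close>, as \<^const>\<open>kruskal_prod\<close> is bounded below
  for \<open>a = 0\<close>.)\<close>

definition kruskal_region :: "real \<Rightarrow> real \<Rightarrow> (real \<Rightarrow> real) \<Rightarrow> real \<Rightarrow> (real^4) set" where
  "kruskal_region m a \<Phi>t \<delta> =
     {X. \<exists>r. r > r_plus m a - \<delta> \<and> kruskal_prod m a \<Phi>t r = X $ 1 * X $ 2}"

text \<open>Boyer--Lindquist coordinates as functions of \<open>(x\<^sub>*, x\<^sub>*\<^sub>*, \<phi>\<^sub>*', \<theta>)\<close> off the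
  horizons. The absolute values continue \<open>t\<^sub>* = \<kappa>\<^sup>-\<^sup>1 log x\<^sub>*\<close>,
  \<open>t\<^sub>*\<^sub>* = - \<kappa>\<^sup>-\<^sup>1 log x\<^sub>*\<^sub>*\<close> from the exterior to the other three quadrants, where \<open>t\<^sub>* + \<Phi>(r) =
  (t\<^sub>* + t\<^sub>*\<^sub>*)/2\<close> remains true.\<close>

definition bl_of_kruskal ::
  "real \<Rightarrow> real \<Rightarrow> (real \<Rightarrow> real) \<Rightarrow> (real \<Rightarrow> real) \<Rightarrow> real^4 \<Rightarrow> real^4" where
  "bl_of_kruskal m a \<Phi>t \<Psi>t Y =
    (let ts = ln \<bar>Y $ 1\<bar> / surface_gravity m a;
         tss = - ln \<bar>Y $ 2\<bar> / surface_gravity m a;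
         r = kruskal_r m a \<Phi>t (Y $ 1 * Y $ 2)
     in vector [(ts + tss) / 2, r, Y $ 3 + a / ((r_plus m a)\<^sup>2 + a\<^sup>2) * ts + Psi_of m a \<Psi>t r, Y $ 4])"


section \<open>Mode solutions\<close>

text \<open>The function \<open>e\<^sup>-\<^sup>i\<^sup>\<sigma>\<^sup>t\<^sup>-\<^sup>i\<^sup>k\<^sup>\<phi> f(r,\<theta>)\<close> of \<open>q = (t, r, \<phi>, \<theta>)\<close>, also used for
  \<open>q = (t\<^sub>*, r, \<phi>\<^sub>*, \<theta>)\<close>.\<close>

definition mode_fun :: "real \<Rightarrow> int \<Rightarrow> (real \<Rightarrow> real \<Rightarrow> complex) \<Rightarrow> real^4 \<Rightarrow> complex" where
  "mode_fun \<sigma> k f q =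
     exp (- \<i> * complex_of_real \<sigma> * complex_of_real (q $ 1)
          - \<i> * of_int k * complex_of_real (q $ 3)) * f (q $ 2) (q $ 4)"

text \<open>Smoothness of \<open>e\<^sup>-\<^sup>i\<^sup>k\<^sup>\<phi> f(r,\<theta>)\<close> on \<open>(r\<^sub>0, \<infinity>) \<times> S\<^sup>2\<close>.\<close>

definition smooth_on_shells :: "real \<Rightarrow> int \<Rightarrow> (real \<Rightarrow> real \<Rightarrow> complex) \<Rightarrow> bool" where
  "smooth_on_shells r0 k f \<longleftrightarrow> (\<forall>north. smooth_on ({r0<..} \<times> UNIV)
     (\<lambda>(r, z). exp (- \<i> * of_int k * complex_of_real (Arg z)) * f r (sphere_theta north z)))"

definition mode_solution ::
  "real \<Rightarrow> real \<Rightarrow> real \<Rightarrow> int \<Rightarrow> (real \<Rightarrow> real \<Rightarrow> complex) \<Rightarrow> bool" where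
  "mode_solution m a \<sigma> k u0 \<longleftrightarrow> smooth_on_shells (r_plus m a) k u0 \<and>
     (\<forall>north X. X $ 2 > r_plus m a \<longrightarrow>
        wave_op (kerr_in_chart m a (angular north)) (mode_fun \<sigma> k u0 \<circ> angular north) X = 0)"

text \<open>\<open>us\<close> is an extension of \<open>u\<^sub>* = e\<^sup>-\<^sup>i\<^sup>\<sigma>\<^sup>\<Phi>\<^sup>-\<^sup>i\<^sup>k\<^sup>\<Psi> u\<^sub>0\<close> as in the definition of
  smoothness across the future event horizon.\<close>

definition future_horizon_extension ::
  "real \<Rightarrow> real \<Rightarrow> (real \<Rightarrow> real) \<Rightarrow> (real \<Rightarrow> real) \<Rightarrow> real \<Rightarrow> int \<Rightarrow> real \<Rightarrow>
   (real \<Rightarrow> real \<Rightarrow> complex) \<Rightarrow> (real \<Rightarrow> real \<Rightarrow> complex) \<Rightarrow> bool" where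
  "future_horizon_extension m a \<Phi>t \<Psi>t \<sigma> k \<delta> u0 us \<longleftrightarrow>
     (\<forall>r \<theta>. r > r_plus m a \<and> 0 \<le> \<theta> \<and> \<theta> \<le> pi \<longrightarrow>
        us r \<theta> = exp (- \<i> * complex_of_real \<sigma> * complex_of_real (Phi_of m a \<Phi>t r)
                       - \<i> * of_int k * complex_of_real (Psi_of m a \<Psi>t r)) * u0 r \<theta>) \<and>
     smooth_on_shells (r_plus m a - \<delta>) k us \<and>
     (\<forall>north X. X $ 2 > r_plus m a - \<delta> \<longrightarrow>
        wave_op (kerr_in_chart m a (bl_of_ingoing m a \<Phi>t \<Psi>t \<circ> angular north))
          (mode_fun \<sigma> k us \<circ> angular north) X = 0)"

definition plus_power :: "complex \<Rightarrow> real \<Rightarrow> complex" where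
  "plus_power \<alpha> x = (if x > 0 then complex_of_real x powr \<alpha> else 0)"

definition sigma' :: "real \<Rightarrow> real \<Rightarrow> real \<Rightarrow> int \<Rightarrow> real" where
  "sigma' m a \<sigma> k = \<sigma> + of_int k * (a / ((r_plus m a)\<^sup>2 + a\<^sup>2))"

definition horizon_exponent :: "real \<Rightarrow> real \<Rightarrow> real \<Rightarrow> int \<Rightarrow> complex" where
  "horizon_exponent m a \<sigma> k = - 2 * \<i> * complex_of_real
     (sigma' m a \<sigma> k * (((r_plus m a)\<^sup>2 + a\<^sup>2) / mu_deriv m (r_plus m a)))"

text \<open>\<open>(x\<^sub>*)\<^sub>+\<^sup>\<alpha> e\<^sup>-\<^sup>i\<^sup>k\<^sup>\<phi> us(r,\<theta>)\<close> with \<open>\<phi> = \<phi>\<^sub>*'\<close>, as a function of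
  \<open>(x\<^sub>*, x\<^sub>*\<^sub>*, \<phi>\<^sub>*', \<theta>)\<close>.\<close>

definition kruskal_mode ::
  "real \<Rightarrow> real \<Rightarrow> (real \<Rightarrow> real) \<Rightarrow> real \<Rightarrow> int \<Rightarrow> (real \<Rightarrow> real \<Rightarrow> complex) \<Rightarrow> real^4 \<Rightarrow> complex" where
  "kruskal_mode m a \<Phi>t \<sigma> k us Y =
     plus_power (horizon_exponent m a \<sigma> k) (Y $ 1) *
     exp (- \<i> * of_int k * complex_of_real (Y $ 3)) *
     us (kruskal_r m a \<Phi>t (Y $ 1 * Y $ 2)) (Y $ 4)"

end

(*
  By stationarity of the mode and invariance under rotations, u~ = (x_* )_+^alpha v with v =
  e^{-ik phi_*'} u_* a smooth function of x_* x_** and the point of the sphere, and (x_* )_+^alpha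
  is bounded because alpha is purely imaginary. In Kruskal coordinates the coefficient of
  d_{x_*}^2 in the wave operator is O(x_*^2), those of d_{x_*} d_omega are O(x_* ), and that of
  d_{x_*} d_{x_**} depends only on x_* x_** and the point of the sphere, as does v, so that its
  x_**-derivative and d_{x_**} u~ are O(x_* ). Hence the commutator of the operator with a cutoff
  chi(x_* / eps), applied to u~, is bounded uniformly in eps and tends to 0 pointwise as eps -> 0,
  so the equation in x_* > 0 has no contribution on {x_* = 0}.

  Fields V tangent to {x_* = 0} preserve the functions (x_* )_+^alpha f with f in the algebra
  generated by the smooth functions and the quotients G/x_* of smooth G vanishing at x_* = 0;
  these are bounded, so localized they are integrable, have bounded Fourier transform, and hence
  lie in H^s for s < -2.
*)
theory Submission
  imports Defs "HOL-Probability.Sinc_Integral"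
begin

section \<open>Calculus of smooth functions\<close>

text \<open>The wave operator sees the metric only through its inverse and its density. A closed
  formula for the inverse is smooth across both horizons and the bifurcate sphere, and inverting it
  gives the limit by which \<open>kerr_in_chart\<close> defines the metric there. The set x_1 > 0
  contains the part x_2 \<le> 0 beyond the future horizon; hence the equation on it is obtained not
  from the exterior but from the equation in ingoing coordinates, valid on both sides of r = r_+.
  The transfer is an explicit computation: the fluxes of the mode are found and differentiated in
  both coordinate systems, and the two divergences are compared as polynomials, with inverses and
  the relations for p(r) = x_1 x_2 as side conditions. The angle \<phi> is singular on the axis; its
  derivative is replaced by the rotation field of the stereographic charts, which acts as -ik up to
  the poles. At x_1 = 0 the power x_1^\<alpha> has in general no limit, so the passage across the
  past horizon rests on bounds alone, and each derivative of the cutoff has to be paid for by a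
  power of x_1.\<close>

lemma frechet_derivative_eqI: "(f has_derivative f') (at x) \<Longrightarrow> frechet_derivative f (at x) = f'"
  by (metis frechet_derivative_at)

text \<open>Passing from \<open>frechet_derivative\<close> to a given derivative needs congruence
  one order lower. It is a hypothesis because \<open>Ck_on_cong\<close> is itself proved by this
  rule, with its induction hypothesis in that place.\<close>

lemma Ck_on_SucI:
  fixes f :: "'a::real_normed_vector \<Rightarrow> 'b::real_normed_vector"
  assumes "\<And>x. x \<in> S \<Longrightarrow> (f has_derivative f' x) (at x)"
    and "\<And>v. Ck_on n S (\<lambda>x. f' x v)"
    and cong: "\<And>g h :: 'a \<Rightarrow> 'b. (\<And>x. x \<in> S \<Longrightarrow> g x = h x) \<Longrightarrow> Ck_on n S g \<Longrightarrow> Ck_on n S h"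
  shows "Ck_on (Suc n) S f"
proof -
  have "Ck_on n S (\<lambda>x. frechet_derivative f (at x) v)" for v
    by (rule cong[of "\<lambda>x. f' x v"]) (simp_all add: frechet_derivative_eqI[OF assms(1)] assms(2))
  then show ?thesis
    using assms(1) by (auto intro: differentiableI)
qed

lemma Ck_on_cong:
  assumes "open S" "\<And>x. x \<in> S \<Longrightarrow> f x = g x" "Ck_on n S f"
  shows "Ck_on n S g"
  using assms
proof (induction n arbitrary: f g)
  case 0
  then show ?case by (metis Ck_on.simps(1) continuous_on_cong)
next
  case (Suc n)
  have D: "(g has_derivative frechet_derivative f (at x)) (at x)" if "x \<in> S" for x
    using Suc.prems that frechet_derivative_works
    by (intro has_derivative_transform_within_open[of f _ x UNIV S g]) auto
  show ?case
    by (rule Ck_on_SucI[OF D]) (use Suc in auto)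
qed

lemma Ck_on_Suc_has_derivative:
  assumes "open S" "\<And>x. x \<in> S \<Longrightarrow> (f has_derivative f' x) (at x)" "\<And>v. Ck_on n S (\<lambda>x. f' x v)"
  shows "Ck_on (Suc n) S f"
  by (rule Ck_on_SucI[OF assms(2,3)]) (use Ck_on_cong[OF assms(1)] in auto)

lemma Ck_on_D:
  "Ck_on (Suc n) S f \<Longrightarrow> x \<in> S \<Longrightarrow> (f has_derivative frechet_derivative f (at x)) (at x)"
  using frechet_derivative_works by auto

lemma Ck_on_Suc_imp: "Ck_on (Suc n) S f \<Longrightarrow> Ck_on n S f"
proof (induction n arbitrary: f)
  case 0
  then show ?case
    by (auto intro!: continuous_at_imp_continuous_on differentiable_imp_continuous_within)
next
  case (Suc n)
  then show ?case by (metis Ck_on.simps(2))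
qed

lemma Ck_on_mono: "Ck_on n S f \<Longrightarrow> k \<le> n \<Longrightarrow> Ck_on k S f"
  by (induction n) (auto simp del: Ck_on.simps(2) dest: Ck_on_Suc_imp simp: le_Suc_eq)

lemma Ck_on_continuous: "Ck_on n S f \<Longrightarrow> continuous_on S f"
  using Ck_on_mono[of n S f 0] by simp

lemma Ck_on_subset: "Ck_on n S f \<Longrightarrow> T \<subseteq> S \<Longrightarrow> Ck_on n T f"
  by (induction n arbitrary: f) (auto intro: continuous_on_subset)

lemma Ck_on_UNION:
  assumes "\<And>T. T \<in> \<T> \<Longrightarrow> open T" "\<And>T. T \<in> \<T> \<Longrightarrow> Ck_on n T f"
  shows "Ck_on n (\<Union>\<T>) f"
  using assms(2)
proof (induction n arbitrary: f)
  case 0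
  then show ?case using assms(1) by (auto intro: continuous_on_open_Union)
qed auto

lemma Ck_on_Un:
  assumes "open S" "open T" "Ck_on n S f" "Ck_on n T f"
  shows "Ck_on n (S \<union> T) f"
  using Ck_on_UNION[of "{S, T}" n f] assms by auto

lemma Ck_on_const: "Ck_on n S (\<lambda>x. c)"
  by (induction n arbitrary: c) auto

lemma Ck_on_bounded_linear:
  assumes "bounded_linear L" "Ck_on n S f" "open S"
  shows "Ck_on n S (\<lambda>x. L (f x))"
  using assms(2)
proof (induction n arbitrary: f)
  case 0
  then show ?case
    using bounded_linear.continuous_on[OF assms(1)] by simp
next
  case (Suc n)
  have 1: "Ck_on n S (\<lambda>x. L (frechet_derivative f (at x) v))" for v
    by (rule Suc.IH) (use Suc.prems in simp)
  show ?case
    by (rule Ck_on_Suc_has_derivative[OF assms(3) bounded_linear.has_derivative[OF assms(1) Ck_on_D[OF Suc.prems]]])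
       (assumption | rule 1)+
qed

lemma Ck_on_linear: "bounded_linear L \<Longrightarrow> Ck_on n S L"
proof (induction n)
  case 0
  then show ?case by (auto intro: linear_continuous_on)
next
  case (Suc n)
  then show ?case
    by (auto simp: Ck_on_const frechet_derivative_eqI[OF bounded_linear_imp_has_derivative]
        intro: bounded_linear_imp_differentiable)
qed

lemma Ck_on_add:
  assumes "open S" "Ck_on n S f" "Ck_on n S g"
  shows "Ck_on n S (\<lambda>x. f x + g x)"
  using assms(2,3)
proof (induction n arbitrary: f g)
  case 0
  then show ?case by (auto intro: continuous_intros)
next
  case (Suc n)
  have 1: "Ck_on n S (\<lambda>x. frechet_derivative f (at x) v + frechet_derivative g (at x) v)" for v
    by (rule Suc.IH) (use Suc.prems in simp_all)
  show ?case
    by (rule Ck_on_Suc_has_derivative[OF assms(1) has_derivative_add[OF Ck_on_D[OF Suc.prems(1)] Ck_on_D[OF Suc.prems(2)]]])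
       (assumption | rule 1)+
qed

lemma (in bounded_bilinear) Ck_on:
  assumes "open S" "Ck_on n S f" "Ck_on n S g"
  shows "Ck_on n S (\<lambda>x. prod (f x) (g x))"
  using assms(2,3)
proof (induction n arbitrary: f g)
  case 0
  then show ?case using continuous_on by simp
next
  case (Suc n)
  have 1: "Ck_on n S (\<lambda>x. prod (f x) (frechet_derivative g (at x) v))" for v
    by (rule Suc.IH) (use Suc.prems Ck_on_Suc_imp in \<open>blast, simp\<close>)
  have 2: "Ck_on n S (\<lambda>x. prod (frechet_derivative f (at x) v) (g x))" for v
    by (rule Suc.IH) (use Suc.prems Ck_on_Suc_imp in \<open>simp, blast\<close>)
  show ?case
    by (rule Ck_on_Suc_has_derivative[OF assms(1) FDERIV[OF Ck_on_D[OF Suc.prems(1)] Ck_on_D[OF Suc.prems(2)]]])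
       (assumption | rule Ck_on_add[OF assms(1) 1 2])+
qed

text \<open>In the chain rule the direction \<open>f' x v\<close> of the derivative of
  \<open>g\<close> varies with \<open>x\<close>. Expanding it in the basis of the Euclidean codomain
  leaves derivatives of \<open>g\<close> in fixed directions, to which the induction hypothesis
  applies because \<open>g\<close> is kept arbitrary.\<close>

lemma Ck_on_compose:
  fixes f :: "'a::real_normed_vector \<Rightarrow> 'b::euclidean_space"
  assumes "open S" "open T" "f ` S \<subseteq> T" "Ck_on n S f" "Ck_on n T g"
  shows "Ck_on n S (\<lambda>x. g (f x))"
  using assms(4,5)
proof (induction n arbitrary: g)
  case 0
  then show ?case
    using assms(3) by (auto intro: continuous_on_compose2)
next
  case (Suc n)
  define g' where "g' y = frechet_derivative g (at y)" for y
  define f' where "f' y = frechet_derivative f (at y)" for y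
  have g': "(g has_derivative g' y) (at y)" if "y \<in> T" for y
    unfolding g'_def using Ck_on_D[OF Suc.prems(2) that] .
  have f': "(f has_derivative f' x) (at x)" if "x \<in> S" for x
    unfolding f'_def using Ck_on_D[OF Suc.prems(1) that] .
  have D: "((\<lambda>x. g (f x)) has_derivative (\<lambda>v. \<Sum>b\<in>Basis. (f' x v \<bullet> b) *\<^sub>R g' (f x) b)) (at x)"
    if "x \<in> S" for x
  proof -
    have fx: "f x \<in> T" using that assms(3) by auto
    interpret bounded_linear "g' (f x)" by (rule has_derivative_bounded_linear[OF g'[OF fx]])
    have "(\<Sum>b\<in>Basis. (f' x v \<bullet> b) *\<^sub>R g' (f x) b) = g' (f x) (f' x v)" for v
    proof -
      have "g' (f x) (f' x v) = g' (f x) (\<Sum>b\<in>Basis. (f' x v \<bullet> b) *\<^sub>R b)"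
        by (simp add: euclidean_representation)
      then show ?thesis by (simp add: sum scale)
    qed
    then show ?thesis
      using has_derivative_compose[OF f'[OF that] g'[OF fx]] by simp
  qed
  have *: "Ck_on n S (\<lambda>x. \<Sum>b\<in>B. (f' x v \<bullet> b) *\<^sub>R g' (f x) b)" if "finite B" for B v
    using that
  proof (induction B rule: finite_induct)
    case (insert b B)
    have 1: "Ck_on n S (\<lambda>x. f' x v \<bullet> b)"
      using Suc.prems(1) unfolding f'_def
      by (intro Ck_on_bounded_linear[OF bounded_linear_inner_left]) (auto simp: assms(1))
    have 2: "Ck_on n S (\<lambda>x. g' (f x) b)"
      by (rule Suc.IH) (use Suc.prems Ck_on_Suc_imp[of n S f] in \<open>auto simp: g'_def\<close>)
    show ?case
      unfolding sum.insert[OF insert.hyps]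
      by (intro Ck_on_add[OF assms(1)] bounded_bilinear.Ck_on[OF bounded_bilinear_scaleR assms(1)] 1 2 insert.IH)
  qed (simp add: Ck_on_const)
  show ?case
    by (rule Ck_on_Suc_has_derivative[OF assms(1) D *]) auto
qed

lemma Ck_on_mult:
  fixes f g :: "'a::real_normed_vector \<Rightarrow> 'b::real_normed_algebra"
  assumes "open S" "Ck_on n S f" "Ck_on n S g"
  shows "Ck_on n S (\<lambda>x. f x * g x)"
  by (rule bounded_bilinear.Ck_on[OF bounded_bilinear_mult assms])

lemma Ck_on_minus: "open S \<Longrightarrow> Ck_on n S f \<Longrightarrow> Ck_on n S (\<lambda>x. - f x)"
  by (rule Ck_on_bounded_linear[OF bounded_linear_minus[OF bounded_linear_ident]])

lemma Ck_on_inverse: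
  fixes f :: "'a::real_normed_vector \<Rightarrow> 'b::real_normed_field"
  assumes "open S" "Ck_on n S f" "\<And>x. x \<in> S \<Longrightarrow> f x \<noteq> 0"
  shows "Ck_on n S (\<lambda>x. inverse (f x))"
  using assms(2)
proof (induction n)
  case 0
  then show ?case using assms(3) by (auto intro: continuous_intros)
next
  case (Suc n)
  have D: "((\<lambda>x. inverse (f x)) has_derivative (\<lambda>h. - (inverse (f x) * frechet_derivative f (at x) h * inverse (f x)))) (at x)"
    if "x \<in> S" for x
    using Deriv.has_derivative_inverse[OF assms(3)[OF that] Ck_on_D[OF Suc.prems that]] .
  have i: "Ck_on n S (\<lambda>x. inverse (f x))"
    using Suc.IH Ck_on_Suc_imp[OF Suc.prems] by blast
  have f': "Ck_on n S (\<lambda>x. frechet_derivative f (at x) v)" for v using Suc.prems by auto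
  show ?case
    by (rule Ck_on_Suc_has_derivative[OF assms(1) D]) (assumption | intro Ck_on_minus Ck_on_mult assms(1) i f')+
qed

lemma Ck_on_exp:
  fixes f :: "'a::real_normed_vector \<Rightarrow> 'b::{banach,real_normed_field}"
  assumes "open S" "Ck_on n S f"
  shows "Ck_on n S (\<lambda>x. exp (f x))"
  using assms(2)
proof (induction n)
  case 0
  then show ?case by (auto intro: continuous_intros)
next
  case (Suc n)
  have D: "((\<lambda>x. exp (f x)) has_derivative (\<lambda>h. exp (f x) * frechet_derivative f (at x) h)) (at x)"
    if "x \<in> S" for x
    using has_derivative_compose[OF Ck_on_D[OF Suc.prems that]
        DERIV_exp[of "f x", unfolded has_field_derivative_def]] .
  have i: "Ck_on n S (\<lambda>x. exp (f x))"
    using Suc.IH Ck_on_Suc_imp[OF Suc.prems] by blast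
  have f': "Ck_on n S (\<lambda>x. frechet_derivative f (at x) v)" for v using Suc.prems by auto
  show ?case
    by (rule Ck_on_Suc_has_derivative[OF assms(1) D]) (assumption | intro Ck_on_mult assms(1) i f')+
qed

lemma Ck_on_ln:
  fixes f :: "'a::real_normed_vector \<Rightarrow> real"
  assumes "open S" "Ck_on n S f" "\<And>x. x \<in> S \<Longrightarrow> f x > 0"
  shows "Ck_on n S (\<lambda>x. ln (f x))"
proof (cases n)
  case 0
  then show ?thesis
    using assms(2) by (auto intro!: continuous_on_ln dest: assms(3))
next
  case (Suc k)
  have D: "((\<lambda>x. ln (f x)) has_derivative (\<lambda>h. frechet_derivative f (at x) h * inverse (f x))) (at x)"
    if "x \<in> S" for x
    using has_derivative_ln[OF assms(3)[OF that] Ck_on_D[OF assms(2)[unfolded Suc] that]]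
    by (simp add: field_simps)
  have f: "Ck_on k S f" using assms(2) Suc Ck_on_Suc_imp by blast
  have f': "Ck_on k S (\<lambda>x. frechet_derivative f (at x) v)" for v
    using assms(2) unfolding Suc by simp
  have i: "Ck_on k S (\<lambda>x. inverse (f x))"
    by (rule Ck_on_inverse[OF assms(1) f]) (metis assms(3) less_irrefl)
  show ?thesis unfolding Suc
    by (rule Ck_on_Suc_has_derivative[OF assms(1) D])
       (assumption | rule Ck_on_mult[OF assms(1) f' i])+
qed

lemma smooth_on_cong:
  "open S \<Longrightarrow> (\<And>x. x \<in> S \<Longrightarrow> f x = g x) \<Longrightarrow> smooth_on S f \<Longrightarrow> smooth_on S g"
  unfolding smooth_on_def using Ck_on_cong[of S f g] by blast

lemma smooth_on_subset: "smooth_on S f \<Longrightarrow> T \<subseteq> S \<Longrightarrow> smooth_on T f"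
  unfolding smooth_on_def using Ck_on_subset by blast

lemma smooth_on_continuous: "smooth_on S f \<Longrightarrow> continuous_on S f"
  unfolding smooth_on_def using Ck_on_continuous by blast

lemma smooth_on_has_derivative:
  "smooth_on S f \<Longrightarrow> x \<in> S \<Longrightarrow> (f has_derivative frechet_derivative f (at x)) (at x)"
  unfolding smooth_on_def using Ck_on_D by blast

lemma smooth_on_differentiable: "smooth_on S f \<Longrightarrow> x \<in> S \<Longrightarrow> f differentiable (at x)"
  using smooth_on_has_derivative differentiableI by blast

lemma smooth_on_frechet_derivative: "smooth_on S f \<Longrightarrow> smooth_on S (\<lambda>x. frechet_derivative f (at x) v)"
  unfolding smooth_on_def by (metis Ck_on.simps(2))

lemma smooth_on_partial: "smooth_on S f \<Longrightarrow> smooth_on S (partial i f)"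
  unfolding partial_def[abs_def] by (rule smooth_on_frechet_derivative)

lemma smooth_on_const: "smooth_on S (\<lambda>x. c)"
  by (simp add: smooth_on_def Ck_on_const)

lemma smooth_on_linear: "bounded_linear L \<Longrightarrow> smooth_on S L"
  by (simp add: smooth_on_def Ck_on_linear)

lemma smooth_on_bounded_linear:
  "bounded_linear L \<Longrightarrow> open S \<Longrightarrow> smooth_on S f \<Longrightarrow> smooth_on S (\<lambda>x. L (f x))"
  unfolding smooth_on_def by (blast dest: Ck_on_bounded_linear)

lemma smooth_on_add: "open S \<Longrightarrow> smooth_on S f \<Longrightarrow> smooth_on S g \<Longrightarrow> smooth_on S (\<lambda>x. f x + g x)"
  by (simp add: smooth_on_def Ck_on_add)

lemma smooth_on_minus: "open S \<Longrightarrow> smooth_on S f \<Longrightarrow> smooth_on S (\<lambda>x. - f x)"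
  using smooth_on_bounded_linear[OF bounded_linear_minus[OF bounded_linear_ident]] .

lemma smooth_on_diff: "open S \<Longrightarrow> smooth_on S f \<Longrightarrow> smooth_on S g \<Longrightarrow> smooth_on S (\<lambda>x. f x - g x)"
  using smooth_on_add[OF _ _ smooth_on_minus, of S f g] by simp

lemma smooth_on_mult:
  fixes f g :: "'a::real_normed_vector \<Rightarrow> 'b::real_normed_algebra"
  shows "open S \<Longrightarrow> smooth_on S f \<Longrightarrow> smooth_on S g \<Longrightarrow> smooth_on S (\<lambda>x. f x * g x)"
  by (simp add: smooth_on_def Ck_on_mult)

lemma smooth_on_sum:
  assumes "open S" "\<And>i. i \<in> I \<Longrightarrow> smooth_on S (f i)"
  shows "smooth_on S (\<lambda>x. \<Sum>i\<in>I. f i x)"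
  using assms(2) by (induction I rule: infinite_finite_induct) (simp_all add: smooth_on_const smooth_on_add assms(1))

lemma smooth_on_power:
  fixes f :: "'a::real_normed_vector \<Rightarrow> 'b::real_normed_field"
  shows "open S \<Longrightarrow> smooth_on S f \<Longrightarrow> smooth_on S (\<lambda>x. f x ^ n)"
  by (induction n) (simp_all add: smooth_on_const smooth_on_mult)

lemma smooth_on_of_real:
  fixes f :: "'a::real_normed_vector \<Rightarrow> real"
  shows "open S \<Longrightarrow> smooth_on S f \<Longrightarrow> smooth_on S (\<lambda>x. complex_of_real (f x))"
  by (rule smooth_on_bounded_linear[OF bounded_linear_of_real])

lemma smooth_on_vec_nth: "smooth_on S (\<lambda>x::real^'n. x $ i)"
  by (rule smooth_on_linear[OF bounded_linear_vec_nth])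

lemma smooth_on_compose:
  fixes f :: "'a::real_normed_vector \<Rightarrow> 'b::euclidean_space"
  assumes "open S" "open T" "\<And>x. x \<in> S \<Longrightarrow> f x \<in> T" "smooth_on S f" "smooth_on T g"
  shows "smooth_on S (\<lambda>x. g (f x))"
proof -
  have "f ` S \<subseteq> T" using assms(3) by blast
  from Ck_on_compose[OF assms(1,2) this] show ?thesis
    using assms(4,5) unfolding smooth_on_def by blast
qed

lemma smooth_on_inverse:
  fixes f :: "'a::real_normed_vector \<Rightarrow> 'b::real_normed_field"
  shows "open S \<Longrightarrow> smooth_on S f \<Longrightarrow> (\<And>x. x \<in> S \<Longrightarrow> f x \<noteq> 0) \<Longrightarrow> smooth_on S (\<lambda>x. inverse (f x))"
  by (simp add: smooth_on_def Ck_on_inverse)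

lemma smooth_on_divide:
  fixes f :: "'a::real_normed_vector \<Rightarrow> 'b::real_normed_field"
  shows "open S \<Longrightarrow> smooth_on S f \<Longrightarrow> smooth_on S g \<Longrightarrow> (\<And>x. x \<in> S \<Longrightarrow> g x \<noteq> 0) \<Longrightarrow>
    smooth_on S (\<lambda>x. f x / g x)"
  by (simp add: divide_inverse smooth_on_mult smooth_on_inverse)

lemma smooth_on_exp:
  fixes f :: "'a::real_normed_vector \<Rightarrow> 'b::{banach,real_normed_field}"
  shows "open S \<Longrightarrow> smooth_on S f \<Longrightarrow> smooth_on S (\<lambda>x. exp (f x))"
  by (simp add: smooth_on_def Ck_on_exp)

lemma smooth_on_ln:
  fixes f :: "'a::real_normed_vector \<Rightarrow> real"
  shows "open S \<Longrightarrow> smooth_on S f \<Longrightarrow> (\<And>x. x \<in> S \<Longrightarrow> f x > 0) \<Longrightarrow> smooth_on S (\<lambda>x. ln (f x))"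
  by (simp add: smooth_on_def Ck_on_ln)

lemma smooth_on_Pair:
  assumes "open S" "smooth_on S f" "smooth_on S g"
  shows "smooth_on S (\<lambda>x. (f x, g x))"
proof -
  have "smooth_on S (\<lambda>x. (f x, 0) + (0, g x))"
    by (rule smooth_on_add[OF assms(1)
        smooth_on_bounded_linear[OF bounded_linear_Pair[OF bounded_linear_ident bounded_linear_zero] assms(1,2)]
        smooth_on_bounded_linear[OF bounded_linear_Pair[OF bounded_linear_zero bounded_linear_ident] assms(1,3)]])
  then show ?thesis by simp
qed

section \<open>Partial derivatives and integration by parts\<close>

lemma partial_eqI: "(f has_derivative f') (at x) \<Longrightarrow> f' (axis i 1) = D \<Longrightarrow> partial i f x = D"
  by (simp add: partial_def frechet_derivative_eqI)

lemma partial_cong: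
  assumes "open S" "x \<in> S" "\<And>y. y \<in> S \<Longrightarrow> f y = g y"
  shows "partial i f x = partial i g x"
proof -
  have "(f has_derivative f') (at x) \<longleftrightarrow> (g has_derivative f') (at x)" for f'
    using has_derivative_transform_within_open[OF _ assms(1,2), of f f' UNIV g]
      has_derivative_transform_within_open[OF _ assms(1,2), of g f' UNIV f] assms(3) by auto
  then show ?thesis
    unfolding partial_def frechet_derivative_def by simp
qed

lemma differentiable_has_derivative:
  "f differentiable (at x) \<Longrightarrow> (f has_derivative frechet_derivative f (at x)) (at x)"
  by (simp add: frechet_derivative_works)

lemma partial_mult:
  fixes f g :: "real^'n \<Rightarrow> complex"
  assumes "f differentiable (at x)" "g differentiable (at x)"
  shows "partial i (\<lambda>x. f x * g x) x = partial i f x * g x + f x * partial i g x"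
  by (rule partial_eqI[OF has_derivative_mult[OF assms[THEN differentiable_has_derivative]]])
     (simp add: partial_def)

lemma partial_sum:
  assumes "\<And>j. j \<in> J \<Longrightarrow> f j differentiable (at x)"
  shows "partial i (\<lambda>x. \<Sum>j\<in>J. f j x) x = (\<Sum>j\<in>J. partial i (f j) x)"
  by (rule partial_eqI[OF has_derivative_sum[OF assms[THEN differentiable_has_derivative]]])
     (simp_all add: partial_def)

lemma partial_eq_0:
  assumes "open S" "x \<in> S" "\<And>y. y \<in> S \<Longrightarrow> f y = 0"
  shows "partial i f x = 0"
  using partial_cong[OF assms(1,2), of f "\<lambda>_. 0"] assms(3) by (simp add: partial_def)

lemma integrable_compact_support:
  fixes f :: "real^'n \<Rightarrow> complex"
  assumes "continuous_on UNIV f" "compact K" "\<And>x. x \<notin> K \<Longrightarrow> f x = 0"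
  shows "integrable lborel f"
proof -
  have "integrable lborel (\<lambda>x. indicator K x *\<^sub>R f x)"
    by (rule borel_integrable_compact[OF assms(2)]) (use assms(1) continuous_on_subset in blast)
  moreover have "(\<lambda>x. indicator K x *\<^sub>R f x) = f"
    using assms(3) by (auto simp: fun_eq_iff indicator_def)
  ultimately show ?thesis by simp
qed

text \<open>The difference quotients have vanishing integral by translation invariance.\<close>

lemma integral_partial_eq_0:
  fixes f :: "real^'n \<Rightarrow> complex"
  assumes f: "Ck_on 1 UNIV f" and K: "compact K" and f0: "\<And>x. x \<notin> K \<Longrightarrow> f x = 0"
  shows "(\<integral>x. partial i f x \<partial>lborel) = 0"
proof -
  define e :: "real^'n" where "e = axis i 1"
  have e [simp]: "norm e = 1" by (simp add: e_def)
  then have "e \<noteq> 0" by (metis norm_zero zero_neq_one)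
  have df: "(f has_derivative frechet_derivative f (at x)) (at x)" for x
    using f by (auto intro: differentiable_has_derivative)
  have c': "continuous_on UNIV (partial i f)"
    using f by (simp add: partial_def[abs_def])
  have c: "continuous_on UNIV f" using Ck_on_continuous[OF f] .
  have p0: "partial i f x = 0" if "x \<notin> K" for x
    by (rule partial_eq_0[of "- K"]) (use that f0 K in \<open>auto simp: compact_imp_closed\<close>)
  obtain R where R: "\<And>x. x \<in> K \<Longrightarrow> norm x \<le> R"
    using compact_imp_bounded[OF K] bounded_iff by blast
  have "bounded (partial i f ` K)"
    by (intro compact_imp_bounded compact_continuous_image[OF _ K]) (use c' continuous_on_subset in blast)
  then obtain M0 where M0: "\<And>x. x \<in> K \<Longrightarrow> norm (partial i f x) \<le> M0"
    by (auto simp: bounded_iff)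
  define M where "M = \<bar>M0\<bar>"
  have M: "norm (partial i f x) \<le> M" for x
    using M0[of x] p0[of x] by (cases "x \<in> K") (auto simp: M_def)
  define h where "h n = inverse (real (Suc n))" for n
  have h: "0 < h n" "h n \<le> 1" for n by (auto simp: h_def inverse_eq_divide)
  have h0: "h \<longlonglongrightarrow> 0" unfolding h_def by (rule LIMSEQ_inverse_real_of_nat)
  define g where "g n x = (f (h n *\<^sub>R e + x) - f x) /\<^sub>R h n" for n x
  have intf: "integrable lborel f" by (rule integrable_compact_support[OF c K f0])
  have intg: "(\<integral>x. g n x \<partial>lborel) = 0" for n
  proof -
    have 1: "(\<integral>x. f (h n *\<^sub>R e + x) \<partial>lborel) = (\<integral>x. f x \<partial>lborel)"
      using integral_distr[of "(+) (h n *\<^sub>R e)" lborel borel f] intf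
      by (simp add: lborel_distr_plus borel_measurable_integrable)
    have 2: "integrable lborel (\<lambda>x. f (h n *\<^sub>R e + x))"
      using integrable_distr[of "(+) (h n *\<^sub>R e)" lborel borel f] intf
      by (simp add: lborel_distr_plus)
    show ?thesis
      unfolding g_def using 1 2 intf by simp
  qed
  \<comment> \<open>\<open>h n \<le> 1\<close> keeps all difference quotients supported in one ball,
    where the mean value inequality bounds them by a bound for the derivative.\<close>
  have bound: "norm (g n x) \<le> indicator (cball 0 (R + 1)) x * M" for n x
  proof (cases "x \<in> cball 0 (R + 1)")
    case True
    have d: "((\<lambda>t. f (t *\<^sub>R e + x)) has_derivative (\<lambda>s. frechet_derivative f (at (t *\<^sub>R e + x)) (s *\<^sub>R e))) (at t)" for t
      by (rule has_derivative_compose[OF _ df]) (auto intro!: derivative_eq_intros)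
    have "\<exists>t\<in>{0<..<h n}. norm (f (h n *\<^sub>R e + x) - f (0 *\<^sub>R e + x))
        \<le> norm (frechet_derivative f (at (t *\<^sub>R e + x)) ((h n - 0) *\<^sub>R e))"
      by (rule mvt_general[OF h(1) _ d])
         (use has_derivative_continuous_on[OF has_derivative_at_withinI[OF d]] in blast)
    then obtain t where "norm (f (h n *\<^sub>R e + x) - f x) \<le> norm (frechet_derivative f (at (t *\<^sub>R e + x)) (h n *\<^sub>R e))"
      by auto
    also have "\<dots> = h n * norm (partial i f (t *\<^sub>R e + x))"
      using linear_scale[OF has_derivative_linear[OF df]] h[of n] by (simp add: partial_def e_def)
    also have "\<dots> \<le> h n * M" using M h[of n] by simp
    finally have "norm (f (h n *\<^sub>R e + x) - f x) \<le> h n * M" .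
    moreover have "norm (g n x) = norm (f (h n *\<^sub>R e + x) - f x) / h n"
      using h[of n] by (simp add: g_def divide_inverse mult.commute)
    ultimately show ?thesis using True h[of n] by (simp add: pos_divide_le_eq mult.commute)
  next
    case False
    have "x \<notin> K" using R[of x] False by auto
    moreover have "h n *\<^sub>R e + x \<notin> K"
    proof
      assume "h n *\<^sub>R e + x \<in> K"
      from R[OF this] have "norm (h n *\<^sub>R e + x) \<le> R" .
      moreover have "norm x \<le> norm (h n *\<^sub>R e + x) + norm (h n *\<^sub>R e)"
        by (metis add_diff_cancel_left' norm_triangle_ineq4)
      ultimately show False using False h[of n] by simp
    qed
    ultimately show ?thesis using False f0 by (simp add: g_def)
  qed
  have lim: "(\<lambda>n. g n x) \<longlonglongrightarrow> partial i f x" for x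
  proof -
    have "(\<lambda>k. norm (f (x + k) - f x - frechet_derivative f (at x) k) / norm k) \<midarrow>0\<rightarrow> 0"
      using df[of x] unfolding has_derivative_at by blast
    moreover have "filterlim (\<lambda>n. h n *\<^sub>R e) (at 0) sequentially"
      using less_imp_neq[OF h(1)] tendsto_scaleR[OF h0 tendsto_const[of e]] \<open>e \<noteq> 0\<close>
      by (auto simp: filterlim_at intro!: always_eventually)
    ultimately have "(\<lambda>n. norm (f (x + h n *\<^sub>R e) - f x - frechet_derivative f (at x) (h n *\<^sub>R e)) / norm (h n *\<^sub>R e)) \<longlonglongrightarrow> 0"
      by (rule filterlim_compose)
    moreover have "norm (f (x + h n *\<^sub>R e) - f x - frechet_derivative f (at x) (h n *\<^sub>R e)) / norm (h n *\<^sub>R e)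
      = norm (g n x - partial i f x)" for n
    proof -
      have "frechet_derivative f (at x) (h n *\<^sub>R e) = h n *\<^sub>R partial i f x"
        using linear_scale[OF has_derivative_linear[OF df]] by (simp add: partial_def e_def)
      moreover have "g n x - partial i f x = (f (x + h n *\<^sub>R e) - f x - h n *\<^sub>R partial i f x) /\<^sub>R h n"
        using h[of n] by (simp add: g_def add.commute scaleR_diff_right)
      ultimately show ?thesis using h[of n] by (simp add: divide_inverse mult.commute)
    qed
    ultimately show ?thesis by (simp add: Lim_null[of _ "partial i f x"] tendsto_norm_zero_iff)
  qed
  have "(\<lambda>n. \<integral>x. g n x \<partial>lborel) \<longlonglongrightarrow> (\<integral>x. partial i f x \<partial>lborel)"
  proof (rule integral_dominated_convergence[where w = "\<lambda>x. indicator (cball 0 (R + 1)) x * M"])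
    show "partial i f \<in> borel_measurable lborel"
      using borel_measurable_continuous_onI[OF c'] by simp
    show "g n \<in> borel_measurable lborel" for n
    proof -
      have "continuous_on UNIV (\<lambda>x. f (h n *\<^sub>R e + x))"
        by (rule continuous_on_compose2[OF c]) (auto intro: continuous_intros)
      then have "continuous_on UNIV (g n)"
        unfolding g_def by (intro continuous_intros c)
      then show ?thesis using borel_measurable_continuous_onI by simp
    qed
    show "integrable lborel (\<lambda>x. indicator (cball 0 (R + 1)) x * M)"
      by (intro integrable_mult_left integrable_real_indicator) (use emeasure_bounded_finite[OF bounded_cball] in \<open>auto simp: less_top\<close>)
  qed (use bound lim in auto)
  then show ?thesis using intg by (simp add: LIMSEQ_const_iff)
qed


section \<open>Test functions\<close>

abbreviation tsupport :: "(real^'n \<Rightarrow> complex) \<Rightarrow> (real^'n) set" where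
  "tsupport \<psi> \<equiv> closure {x. \<psi> x \<noteq> 0}"

lemma test_functionD:
  assumes "test_function U \<psi>"
  shows "smooth_on UNIV \<psi>" "compact (tsupport \<psi>)" "tsupport \<psi> \<subseteq> U" "\<And>x. x \<notin> tsupport \<psi> \<Longrightarrow> \<psi> x = 0"
  using assms closure_subset[of "{x. \<psi> x \<noteq> 0}"] by (auto simp: test_function_def)

lemma test_functionI:
  assumes "smooth_on UNIV \<psi>" "compact K" "K \<subseteq> U" "\<And>x. x \<notin> K \<Longrightarrow> \<psi> x = 0"
  shows "test_function U \<psi>"
proof -
  have "tsupport \<psi> \<subseteq> K"
    using assms(2,4) by (intro closure_minimal) (auto simp: compact_imp_closed)
  moreover have "compact (tsupport \<psi>)"
    using compact_Int_closed[OF assms(2) closed_closure, of "{x. \<psi> x \<noteq> 0}"] \<open>tsupport \<psi> \<subseteq> K\<close>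
    by (simp add: Int_absorb1)
  ultimately show ?thesis using assms(1,3) by (auto simp: test_function_def)
qed

text \<open>Nothing is known of \<open>f\<close> outside \<open>U\<close>; but \<open>U\<close> and
  the complement of the support of \<open>\<psi>\<close> form an open cover of the whole space, and
  the product is 0 on the second set.\<close>

lemma Ck_on_mult_test:
  assumes "open U" "Ck_on n U f" "test_function U \<psi>"
  shows "Ck_on n UNIV (\<lambda>x. f x * \<psi> x)"
proof -
  note \<psi> = test_functionD[OF assms(3)]
  have 1: "Ck_on n U (\<lambda>x. f x * \<psi> x)"
    using \<psi>(1) Ck_on_subset[of n UNIV \<psi> U] by (intro Ck_on_mult assms(1,2)) (simp add: smooth_on_def)
  have 2: "Ck_on n (- tsupport \<psi>) (\<lambda>x. f x * \<psi> x)"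
  proof (rule Ck_on_cong[OF _ _ Ck_on_const])
    show "0 = f x * \<psi> x" if "x \<in> - tsupport \<psi>" for x
      using \<psi>(4)[of x] that by (metis ComplD mult_zero_right)
  qed (rule open_Compl[OF closed_closure])
  have "U \<union> - tsupport \<psi> = UNIV" using \<psi>(3) by blast
  with Ck_on_Un[OF assms(1) open_Compl[OF closed_closure] 1 2] show ?thesis by simp
qed

lemma test_function_mult:
  assumes "open U" "smooth_on U f" "test_function U \<psi>"
  shows "test_function U (\<lambda>x. f x * \<psi> x)"
proof (rule test_functionI[OF _ test_functionD(2,3)[OF assms(3)]])
  show "smooth_on UNIV (\<lambda>x. f x * \<psi> x)"
    using assms Ck_on_mult_test by (metis smooth_on_def)
  show "f x * \<psi> x = 0" if "x \<notin> tsupport \<psi>" for x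
    using test_functionD(4)[OF assms(3) that] by (metis mult_zero_right)
qed

lemma test_function_partial:
  assumes "test_function U \<psi>"
  shows "test_function U (partial i \<psi>)"
proof (rule test_functionI[OF _ test_functionD(2,3)[OF assms]])
  show "smooth_on UNIV (partial i \<psi>)"
    by (rule smooth_on_partial[OF test_functionD(1)[OF assms]])
  show "partial i \<psi> x = 0" if "x \<notin> tsupport \<psi>" for x
  proof (rule partial_eq_0[OF open_Compl[OF closed_closure]])
    show "x \<in> - tsupport \<psi>" using that by (metis ComplI)
  qed (metis ComplD test_functionD(4)[OF assms])
qed

lemma test_function_subset: "test_function U \<psi> \<Longrightarrow> U \<subseteq> W \<Longrightarrow> test_function W \<psi>"
  by (auto simp: test_function_def)

lemma integrable_mult_test:
  fixes f :: "real^'n \<Rightarrow> complex"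
  assumes "open U" "continuous_on U f" "test_function U \<psi>"
  shows "integrable lborel (\<lambda>x. f x * \<psi> x)"
proof (rule integrable_compact_support[OF _ test_functionD(2)[OF assms(3)]])
  show "continuous_on UNIV (\<lambda>x. f x * \<psi> x)"
    using Ck_on_mult_test[of U 0 f] assms by (metis Ck_on.simps(1))
  show "f x * \<psi> x = 0" if "x \<notin> tsupport \<psi>" for x
    using test_functionD(4)[OF assms(3) that] by (metis mult_zero_right)
qed

lemma integral_by_parts_test:
  fixes f :: "real^'n \<Rightarrow> complex"
  assumes "open U" "Ck_on 1 U f" "test_function U \<psi>"
  shows "(\<integral>x. f x * partial i \<psi> x \<partial>lborel) = - (\<integral>x. partial i f x * \<psi> x \<partial>lborel)"
proof -
  note \<psi> = test_functionD[OF assms(3)]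
  have f': "continuous_on U (partial i f)"
    using assms(2) by (simp add: partial_def[abs_def])
  \<comment> \<open>The integral runs over the whole space, so the product rule is needed at every
    point; outside \<open>U\<close>, where \<open>f\<close> need not be differentiable, all terms
    vanish because \<open>\<psi>\<close> is 0 nearby.\<close>
  have eq: "partial i (\<lambda>x. f x * \<psi> x) x = partial i f x * \<psi> x + f x * partial i \<psi> x" for x
  proof (cases "x \<in> U")
    case True
    then show ?thesis
      using assms(2) smooth_on_differentiable[OF \<psi>(1)] by (intro partial_mult) auto
  next
    case False
    then have x: "x \<notin> tsupport \<psi>" using \<psi>(3) by blast
    then have x': "x \<in> - tsupport \<psi>" by (metis ComplI)
    have 0: "\<psi> y = 0" if "y \<in> - tsupport \<psi>" for y
      using \<psi>(4)[of y] that by (metis ComplD)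
    have 1: "f y * \<psi> y = 0" if "y \<in> - tsupport \<psi>" for y
      using 0[OF that] by simp
    have 2: "partial i (\<lambda>x. f x * \<psi> x) x = 0"
      by (rule partial_eq_0[OF open_Compl[OF closed_closure] x' 1])
    have 3: "partial i \<psi> x = 0"
      by (rule partial_eq_0[OF open_Compl[OF closed_closure] x' 0])
    show ?thesis
      unfolding 2 3 \<psi>(4)[OF x] by simp
  qed
  have "(\<integral>x. partial i f x * \<psi> x + f x * partial i \<psi> x \<partial>lborel) = 0"
    unfolding eq[symmetric]
  proof (rule integral_partial_eq_0[OF Ck_on_mult_test[OF assms] \<psi>(2)])
    show "f x * \<psi> x = 0" if "x \<notin> tsupport \<psi>" for x
      unfolding \<psi>(4)[OF that] by simp
  qed
  then show ?thesis
    using integrable_mult_test[OF assms(1) f' assms(3)]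
      integrable_mult_test[OF assms(1) Ck_on_continuous[OF assms(2)] test_function_partial[OF assms(3)]]
    by (simp add: add_eq_0_iff)
qed

section \<open>A cutoff near the boundary of the half-line\<close>

text \<open>For x > 0 this is \<chi>(x/\<epsilon>) with \<chi>(t) the cube of the positive part of 1
  - 1/t. The cube gives two continuous derivatives, as many as a second-order operator takes;
  dependence on x/\<epsilon> alone makes x times the first and x^2 times the second derivative
  bounded uniformly in \<epsilon>. For x \<le> 0 the numerator is 0, and so is the quotient, at x =
  0 by convention.\<close>

definition cutoff :: "real \<Rightarrow> real \<Rightarrow> real" where
  "cutoff \<epsilon> x = max 0 (x - \<epsilon>) ^ 3 / x ^ 3"

definition cutoff' :: "real \<Rightarrow> real \<Rightarrow> real" where
  "cutoff' \<epsilon> x = 3 * \<epsilon> * max 0 (x - \<epsilon>) ^ 2 / x ^ 4"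

definition cutoff'' :: "real \<Rightarrow> real \<Rightarrow> real" where
  "cutoff'' \<epsilon> x = 6 * \<epsilon> * max 0 (x - \<epsilon>) / x ^ 4 - 12 * \<epsilon> * max 0 (x - \<epsilon>) ^ 2 / x ^ 5"

text \<open>An exponent of at least two removes the kink at \<open>c\<close>, where the difference
  quotient is dominated by a positive power of the step.\<close>

lemma DERIV_max_power:
  "((\<lambda>x::real. max 0 (x - c) ^ Suc (Suc n)) has_real_derivative real (Suc (Suc n)) * max 0 (x - c) ^ Suc n) (at x)"
proof -
  consider "x < c" | "x > c" | "x = c" by linarith
  then show ?thesis
  proof cases
    case 1
    have "((\<lambda>x. 0) has_real_derivative 0) (at x)" by simp
    then have "((\<lambda>x::real. max 0 (x - c) ^ Suc (Suc n)) has_real_derivative 0) (at x)"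
      by (rule has_field_derivative_transform_within_open[of _ _ _ "{..<c}"]) (use 1 in auto)
    then show ?thesis using 1 by simp
  next
    case 2
    have "((\<lambda>x. (x - c) ^ Suc (Suc n)) has_real_derivative real (Suc (Suc n)) * (x - c) ^ Suc n) (at x)"
      by (rule derivative_eq_intros refl)+ simp
    then have "((\<lambda>x::real. max 0 (x - c) ^ Suc (Suc n)) has_real_derivative real (Suc (Suc n)) * (x - c) ^ Suc n) (at x)"
      by (rule has_field_derivative_transform_within_open[of _ _ _ "{c<..}"]) (use 2 in auto)
    then show ?thesis using 2 by simp
  next
    case 3
    have "((\<lambda>h. max 0 h ^ Suc (Suc n) / h) \<longlongrightarrow> 0) (at (0::real))"
    proof (rule Lim_null_comparison)
      show "\<forall>\<^sub>F h in at (0::real). norm (max 0 h ^ Suc (Suc n) / h) \<le> \<bar>h\<bar> ^ Suc n"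
      proof (rule always_eventually, rule allI)
        fix h :: real
        have "max 0 h ^ Suc (Suc n) / h = (if h > 0 then \<bar>h\<bar> ^ Suc n else 0)" by (auto simp: max_def)
        then show "norm (max 0 h ^ Suc (Suc n) / h) \<le> \<bar>h\<bar> ^ Suc n"
          by (simp add: abs_mult del: power_Suc)
      qed
      show "((\<lambda>h::real. \<bar>h\<bar> ^ Suc n) \<longlongrightarrow> 0) (at 0)"
        by (auto intro!: tendsto_eq_intros)
    qed
    then show ?thesis using 3 by (simp add: DERIV_def)
  qed
qed

lemma cutoff_eq_0: "0 < \<epsilon> \<Longrightarrow> x \<le> \<epsilon> \<Longrightarrow> cutoff \<epsilon> x = 0" "0 < \<epsilon> \<Longrightarrow> x \<le> \<epsilon> \<Longrightarrow> cutoff' \<epsilon> x = 0"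
  "0 < \<epsilon> \<Longrightarrow> x \<le> \<epsilon> \<Longrightarrow> cutoff'' \<epsilon> x = 0"
  by (auto simp: cutoff_def cutoff'_def cutoff''_def)

lemma DERIV_cutoff:
  assumes "\<epsilon> > 0"
  shows "(cutoff \<epsilon> has_real_derivative cutoff' \<epsilon> x) (at x)"
proof (cases "x > 0")
  case True
  have "((\<lambda>x. max 0 (x - \<epsilon>) ^ Suc (Suc 1) / x ^ 3) has_real_derivative
      (real (Suc (Suc 1)) * max 0 (x - \<epsilon>) ^ Suc 1 * x ^ 3 - max 0 (x - \<epsilon>) ^ Suc (Suc 1) * (3 * x ^ 2)) / (x ^ 3 * x ^ 3)) (at x)"
    by (rule DERIV_divide[OF DERIV_max_power]) (use True in \<open>auto intro!: derivative_eq_intros\<close>)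
  moreover have "(real (Suc (Suc 1)) * max 0 (x - \<epsilon>) ^ Suc 1 * x ^ 3 - max 0 (x - \<epsilon>) ^ Suc (Suc 1) * (3 * x ^ 2)) / (x ^ 3 * x ^ 3)
     = cutoff' \<epsilon> x"
    using True by (cases "x > \<epsilon>") (auto simp: cutoff'_def field_simps eval_nat_numeral)
  ultimately show ?thesis by (simp add: cutoff_def[abs_def] eval_nat_numeral)
next
  case False
  have "((\<lambda>x. 0) has_real_derivative 0) (at x)" by simp
  then have "(cutoff \<epsilon> has_real_derivative 0) (at x)"
    by (rule has_field_derivative_transform_within_open[of _ _ _ "{..<\<epsilon>}"]) (use assms False cutoff_eq_0 in auto)
  then show ?thesis using cutoff_eq_0 assms False by simp
qed

lemma DERIV_cutoff':
  assumes "\<epsilon> > 0"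
  shows "(cutoff' \<epsilon> has_real_derivative cutoff'' \<epsilon> x) (at x)"
proof (cases "x > 0")
  case True
  have "((\<lambda>x. 3 * \<epsilon> * (max 0 (x - \<epsilon>) ^ Suc (Suc 0) / x ^ 4)) has_real_derivative
      3 * \<epsilon> * ((real (Suc (Suc 0)) * max 0 (x - \<epsilon>) ^ Suc 0 * x ^ 4 - max 0 (x - \<epsilon>) ^ Suc (Suc 0) * (4 * x ^ 3)) / (x ^ 4 * x ^ 4))) (at x)"
    by (rule DERIV_cmult[OF DERIV_divide[OF DERIV_max_power]]) (use True in \<open>auto intro!: derivative_eq_intros\<close>)
  moreover have "3 * \<epsilon> * ((real (Suc (Suc 0)) * max 0 (x - \<epsilon>) ^ Suc 0 * x ^ 4 - max 0 (x - \<epsilon>) ^ Suc (Suc 0) * (4 * x ^ 3)) / (x ^ 4 * x ^ 4))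
     = cutoff'' \<epsilon> x"
    using True by (simp add: cutoff''_def field_simps eval_nat_numeral)
  ultimately show ?thesis by (simp add: cutoff'_def[abs_def] eval_nat_numeral)
next
  case False
  have "((\<lambda>x. 0) has_real_derivative 0) (at x)" by simp
  then have "(cutoff' \<epsilon> has_real_derivative 0) (at x)"
    by (rule has_field_derivative_transform_within_open[of _ _ _ "{..<\<epsilon>}"]) (use assms False cutoff_eq_0 in auto)
  then show ?thesis using cutoff_eq_0 assms False by simp
qed

lemma Ck_on_real_derivative:
  fixes f :: "real \<Rightarrow> real"
  assumes "open S" "\<And>x. x \<in> S \<Longrightarrow> (f has_real_derivative f' x) (at x)" "Ck_on n S f'"
  shows "Ck_on (Suc n) S f"
proof (rule Ck_on_Suc_has_derivative[OF assms(1)])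
  show "(f has_derivative (\<lambda>h. f' x * h)) (at x)" if "x \<in> S" for x
    using assms(2)[OF that] by (simp add: has_field_derivative_def)
  show "Ck_on n S (\<lambda>x. f' x * v)" for v
    by (rule Ck_on_mult[OF assms(1,3) Ck_on_const])
qed

text \<open>The powers of x in the denominator are harmless for x > 0, everything vanishes for x <
  \<epsilon>, and these two open half-lines cover the line.\<close>

lemma Ck_on_cutoff:
  assumes "\<epsilon> > 0"
  shows "Ck_on (Suc 1) UNIV (cutoff \<epsilon>)" and "Ck_on 1 UNIV (cutoff' \<epsilon>)"
proof -
  have "continuous_on {0<..} (cutoff'' \<epsilon>)"
    unfolding cutoff''_def by (auto intro!: continuous_intros)
  moreover have "continuous_on {..<\<epsilon>} (cutoff'' \<epsilon>)"
    by (rule continuous_on_eq[OF continuous_on_const[of _ 0]]) (use assms cutoff_eq_0 in auto)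
  ultimately have "continuous_on ({0<..} \<union> {..<\<epsilon>}) (cutoff'' \<epsilon>)"
    by (intro continuous_on_open_Un) auto
  moreover have "{0<..} \<union> {..<\<epsilon>} = UNIV" using assms by auto
  ultimately have "Ck_on 0 UNIV (cutoff'' \<epsilon>)" by simp
  from Ck_on_real_derivative[OF _ DERIV_cutoff'[OF assms] this]
  show 1: "Ck_on 1 UNIV (cutoff' \<epsilon>)" by simp
  show "Ck_on (Suc 1) UNIV (cutoff \<epsilon>)"
    by (rule Ck_on_real_derivative[OF _ DERIV_cutoff[OF assms] 1]) simp
qed

lemma cutoff_bounds:
  assumes "\<epsilon> > 0" "x > 0"
  shows "\<bar>cutoff \<epsilon> x\<bar> \<le> 1" "\<bar>x * cutoff' \<epsilon> x\<bar> \<le> 3" "\<bar>x\<^sup>2 * cutoff'' \<epsilon> x\<bar> \<le> 18"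
proof -
  define y where "y = max 0 (x - \<epsilon>) / x"
  \<comment> \<open>For x \<le> \<epsilon> the quotient \<epsilon>/x is at least 1, but there
    \<open>y\<close> is 0 and the value of \<open>z\<close> is free; with 0 both \<open>y\<close>
    and \<open>z\<close> lie in [0, 1], and the three quantities are y^3, 3 z y^2 and 6 z y - 12 z
    y^2.\<close>
  define z where "z = (if x \<le> \<epsilon> then 0 else \<epsilon> / x)"
  have y: "0 \<le> y" "y \<le> 1" using assms by (auto simp: y_def)
  have z: "0 \<le> z" "z \<le> 1" using assms by (auto simp: z_def)
  have "cutoff \<epsilon> x = y ^ 3" by (simp add: cutoff_def y_def power_divide)
  then show "\<bar>cutoff \<epsilon> x\<bar> \<le> 1" using y by (simp add: power_le_one)
  have "x * cutoff' \<epsilon> x = 3 * (z * y ^ 2)"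
    using assms by (auto simp: cutoff'_def y_def z_def field_simps eval_nat_numeral)
  moreover have zy2: "0 \<le> z * y ^ 2" "z * y ^ 2 \<le> 1"
    using y z by (auto intro!: mult_le_one power_le_one)
  ultimately show "\<bar>x * cutoff' \<epsilon> x\<bar> \<le> 3" by simp
  have "x\<^sup>2 * cutoff'' \<epsilon> x = 6 * (z * y) - 12 * (z * y ^ 2)"
    using assms by (auto simp: cutoff''_def y_def z_def field_simps eval_nat_numeral)
  moreover have "0 \<le> z * y" "z * y \<le> 1"
    using y z by (auto intro!: mult_le_one)
  ultimately show "\<bar>x\<^sup>2 * cutoff'' \<epsilon> x\<bar> \<le> 18" using zy2 by linarith
qed

lemma cutoff_limits:
  assumes "h \<longlonglongrightarrow> 0" "x > 0"
  shows "(\<lambda>n. cutoff (h n) x) \<longlonglongrightarrow> 1" "(\<lambda>n. cutoff' (h n) x) \<longlonglongrightarrow> 0" "(\<lambda>n. cutoff'' (h n) x) \<longlonglongrightarrow> 0"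
  unfolding cutoff_def cutoff'_def cutoff''_def using assms
  by (auto intro!: tendsto_eq_intros)


section \<open>Functions on a half-space with bounded boundary behaviour\<close>

text \<open>Boundedness is required on the side \<open>x $ i > 0\<close> near every point of
  \<open>U\<close>, those of the hyperplane included. This is the uniformity that dominated
  convergence up to the boundary asks for, and it admits functions without a limit there, such as an
  imaginary power of \<open>x $ i\<close>.\<close>

definition loc_bounded :: "(real^'n) set \<Rightarrow> 'n \<Rightarrow> (real^'n \<Rightarrow> 'b::real_normed_vector) \<Rightarrow> bool" where
  "loc_bounded U i F \<longleftrightarrow> (\<forall>x\<in>U. \<exists>W C. open W \<and> x \<in> W \<and> (\<forall>y\<in>W \<inter> U. y $ i > 0 \<longrightarrow> norm (F y) \<le> C))"

abbreviation half :: "(real^'n) set \<Rightarrow> 'n \<Rightarrow> (real^'n) set" where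
  "half U i \<equiv> U \<inter> {x. 0 < x $ i}"

lemma open_half: "open U \<Longrightarrow> open (half U i)"
  by (intro open_Int open_Collect_less) (auto intro: continuous_intros)

lemma loc_boundedE:
  assumes "loc_bounded U i F" "x \<in> U"
  obtains W C where "open W" "x \<in> W" "\<And>y. y \<in> W \<Longrightarrow> y \<in> U \<Longrightarrow> y $ i > 0 \<Longrightarrow> norm (F y) \<le> C" "0 \<le> C"
proof -
  obtain W C where *: "open W" "x \<in> W" "\<forall>y\<in>W \<inter> U. y $ i > 0 \<longrightarrow> norm (F y) \<le> C"
    using assms unfolding loc_bounded_def by blast
  show ?thesis by (rule that[of W "\<bar>C\<bar>"]) (use * in force)+
qed

lemma loc_boundedI:
  assumes "\<And>x. x \<in> U \<Longrightarrow> \<exists>W C. open W \<and> x \<in> W \<and> (\<forall>y\<in>W \<inter> U. y $ i > 0 \<longrightarrow> norm (F y) \<le> C)"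
  shows "loc_bounded U i F"
  using assms unfolding loc_bounded_def by blast

lemma loc_bounded_mono:
  assumes "loc_bounded U i F" "\<And>x. x \<in> half U i \<Longrightarrow> norm (G x) \<le> norm (F x)"
  shows "loc_bounded U i G"
proof (rule loc_boundedI)
  fix x assume "x \<in> U"
  from loc_boundedE[OF assms(1) this] obtain W C where
    W: "open W" "x \<in> W" "\<And>y. y \<in> W \<Longrightarrow> y \<in> U \<Longrightarrow> y $ i > 0 \<Longrightarrow> norm (F y) \<le> C" by metis
  have "norm (G y) \<le> C" if "y \<in> W \<inter> U" "y $ i > 0" for y
    using order_trans[OF assms(2)[of y] W(3)[of y]] that by simp
  then show "\<exists>W C. open W \<and> x \<in> W \<and> (\<forall>y\<in>W \<inter> U. y $ i > 0 \<longrightarrow> norm (G y) \<le> C)"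
    using W(1,2) by blast
qed

lemma loc_bounded_add:
  assumes "loc_bounded U i F" "loc_bounded U i G"
  shows "loc_bounded U i (\<lambda>x. F x + G x)"
proof (rule loc_boundedI)
  fix x assume x: "x \<in> U"
  from loc_boundedE[OF assms(1) x] obtain W C where
    W: "open W" "x \<in> W" "\<And>y. y \<in> W \<Longrightarrow> y \<in> U \<Longrightarrow> y $ i > 0 \<Longrightarrow> norm (F y) \<le> C" by metis
  from loc_boundedE[OF assms(2) x] obtain W' C' where
    W': "open W'" "x \<in> W'" "\<And>y. y \<in> W' \<Longrightarrow> y \<in> U \<Longrightarrow> y $ i > 0 \<Longrightarrow> norm (G y) \<le> C'" by metis
  show "\<exists>W C. open W \<and> x \<in> W \<and> (\<forall>y\<in>W \<inter> U. y $ i > 0 \<longrightarrow> norm (F y + G y) \<le> C)"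
  proof (intro exI conjI ballI impI)
    show "open (W \<inter> W')" "x \<in> W \<inter> W'" using W W' by auto
    show "norm (F y + G y) \<le> C + C'" if "y \<in> W \<inter> W' \<inter> U" "y $ i > 0" for y
      using norm_triangle_mono[OF W(3) W'(3), of y y] that by simp
  qed
qed

lemma loc_bounded_mult:
  fixes F G :: "real^'n \<Rightarrow> 'b::real_normed_algebra"
  assumes "loc_bounded U i F" "loc_bounded U i G"
  shows "loc_bounded U i (\<lambda>x. F x * G x)"
proof (rule loc_boundedI)
  fix x assume x: "x \<in> U"
  from loc_boundedE[OF assms(1) x] obtain W C where
    W: "open W" "x \<in> W" "\<And>y. y \<in> W \<Longrightarrow> y \<in> U \<Longrightarrow> y $ i > 0 \<Longrightarrow> norm (F y) \<le> C" "0 \<le> C" by metis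
  from loc_boundedE[OF assms(2) x] obtain W' C' where
    W': "open W'" "x \<in> W'" "\<And>y. y \<in> W' \<Longrightarrow> y \<in> U \<Longrightarrow> y $ i > 0 \<Longrightarrow> norm (G y) \<le> C'" "0 \<le> C'" by metis
  show "\<exists>W C. open W \<and> x \<in> W \<and> (\<forall>y\<in>W \<inter> U. y $ i > 0 \<longrightarrow> norm (F y * G y) \<le> C)"
  proof (intro exI conjI ballI impI)
    show "open (W \<inter> W')" "x \<in> W \<inter> W'" using W W' by auto
    show "norm (F y * G y) \<le> C * C'" if "y \<in> W \<inter> W' \<inter> U" "y $ i > 0" for y
      using order_trans[OF norm_mult_ineq mult_mono[OF W(3) W'(3) W(4) norm_ge_zero], of y y] that by simp
  qed
qed

lemma loc_bounded_const: "loc_bounded U i (\<lambda>x. c)"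
  unfolding loc_bounded_def using open_UNIV UNIV_I by (metis order_refl)

lemma loc_bounded_continuous:
  assumes "open U" "continuous_on U F"
  shows "loc_bounded U i F"
proof (rule loc_boundedI)
  fix x assume x: "x \<in> U"
  have "isCont F x" using assms x by (simp add: continuous_on_eq_continuous_at)
  then have "\<forall>\<^sub>F y in at x. dist (F y) (F x) < 1"
    unfolding isCont_def by (rule tendstoD) simp
  then obtain W where W: "open W" "x \<in> W" "\<And>y. y \<in> W \<Longrightarrow> y \<noteq> x \<Longrightarrow> dist (F y) (F x) < 1"
    unfolding eventually_at_topological by blast
  have "norm (F y) \<le> norm (F x) + 1" if "y \<in> W" for y
    using W(3)[OF that] norm_triangle_ineq2[of "F y" "F x"] by (cases "y = x") (auto simp: dist_norm)
  then show "\<exists>W C. open W \<and> x \<in> W \<and> (\<forall>y\<in>W \<inter> U. y $ i > 0 \<longrightarrow> norm (F y) \<le> C)"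
    using W(1,2) by blast
qed

lemma loc_bounded_compact:
  assumes "loc_bounded U i F" "compact K" "K \<subseteq> U"
  obtains C where "0 \<le> C" "\<And>y. y \<in> K \<Longrightarrow> y $ i > 0 \<Longrightarrow> norm (F y) \<le> C"
proof -
  have "\<forall>x\<in>K. \<exists>W C. open W \<and> x \<in> W \<and> (\<forall>y\<in>W \<inter> U. y $ i > 0 \<longrightarrow> norm (F y) \<le> C)"
    using assms(1,3) unfolding loc_bounded_def by blast
  then obtain W C where W: "\<And>x. x \<in> K \<Longrightarrow> open (W x)" "\<And>x. x \<in> K \<Longrightarrow> x \<in> W x"
    "\<And>x y. x \<in> K \<Longrightarrow> y \<in> W x \<inter> U \<Longrightarrow> y $ i > 0 \<Longrightarrow> norm (F y) \<le> C x"
    by metis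
  obtain D where D: "D \<subseteq> K" "finite D" "K \<subseteq> (\<Union>x\<in>D. W x)"
    by (rule compactE_image[OF assms(2), of K W]) (use W in auto)
  show ?thesis
  proof (rule that)
    show "0 \<le> (\<Sum>x\<in>D. \<bar>C x\<bar>)" by (simp add: sum_nonneg)
    fix y assume y: "y \<in> K" "y $ i > 0"
    then obtain x where x: "x \<in> D" "y \<in> W x" using D(3) by blast
    then have "norm (F y) \<le> \<bar>C x\<bar>" using W(3)[of x y] y D(1) assms(3) by force
    also have "\<dots> \<le> (\<Sum>x\<in>D. \<bar>C x\<bar>)"
      by (rule member_le_sum) (use x D(2) in auto)
    finally show "norm (F y) \<le> (\<Sum>x\<in>D. \<bar>C x\<bar>)" .
  qed
qed

text \<open>A bounded form of Hadamard's lemma: the mean value inequality on the normal segment that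
  starts at the hyperplane bounds \<open>G\<close> by \<open>x $ i\<close> times a bound for its
  normal derivative.\<close>

lemma loc_bounded_quotient:
  fixes G :: "real^'n \<Rightarrow> complex"
  assumes "open U" "smooth_on U G" "\<And>x. x \<in> U \<Longrightarrow> x $ i = 0 \<Longrightarrow> G x = 0"
  shows "loc_bounded U i (\<lambda>x. G x / of_real (x $ i))"
proof (rule loc_boundedI)
  fix x assume x: "x \<in> U"
  show "\<exists>W C. open W \<and> x \<in> W \<and> (\<forall>y\<in>W \<inter> U. y $ i > 0 \<longrightarrow> norm (G y / of_real (y $ i)) \<le> C)"
  proof (cases "x $ i = 0")
    case False
    define U' where "U' = U \<inter> {y. y $ i \<noteq> 0}"
    have o: "open U'" unfolding U'_def
      using assms(1) by (intro open_Int open_Collect_neq) (auto intro: continuous_intros)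
    have "continuous_on U' (\<lambda>x. G x / of_real (x $ i))"
      using smooth_on_continuous[OF assms(2)] unfolding U'_def
      by (intro continuous_intros) (auto intro: continuous_on_subset)
    from loc_bounded_continuous[OF o this, of i] obtain W C where
      "open W" "x \<in> W" "\<And>y. y \<in> W \<Longrightarrow> y \<in> U' \<Longrightarrow> y $ i > 0 \<Longrightarrow> norm (G y / of_real (y $ i)) \<le> C"
      by (rule loc_boundedE[of _ _ _ x]) (use x False in \<open>auto simp: U'_def\<close>)
    then show ?thesis by (intro exI[of _ W] exI[of _ C]) (auto simp: U'_def)
  next
    case True
    obtain r where r: "r > 0" "cball x r \<subseteq> U" using assms(1) x open_contains_cball by blast
    have "continuous_on (cball x r) (partial i G)"
      using smooth_on_continuous[OF smooth_on_partial[OF assms(2)]] r(2) continuous_on_subset by blast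
    then have "bounded (partial i G ` cball x r)"
      by (intro compact_imp_bounded compact_continuous_image) auto
    then obtain C where C: "\<And>y. y \<in> cball x r \<Longrightarrow> norm (partial i G y) \<le> C"
      unfolding bounded_iff by blast
    show ?thesis
    proof (intro exI[of _ "ball x r"] exI[of _ C] conjI ballI impI)
      fix y assume y: "y \<in> ball x r \<inter> U" "0 < y $ i"
      define z where "z = y - (y $ i) *\<^sub>R axis i 1"
      define p where "p t = z + t *\<^sub>R axis i 1" for t
      have pi: "p t $ i = t" for t by (simp add: p_def z_def)
      have pb: "p t \<in> cball x r" if "0 \<le> t" "t \<le> y $ i" for t
      proof -
        \<comment> \<open>The segment stays in the ball: \<open>x\<close> lies on the hyperplane,
          and \<open>p t\<close> differs from \<open>y\<close> only in coordinate \<open>i\<close>,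
          where it lies between 0 and \<open>y $ i\<close>.\<close>
        have "norm (x - p t) \<le> norm (x - y)"
        proof (rule norm_le_componentwise_cart)
          fix j show "norm ((x - p t) $ j) \<le> norm ((x - y) $ j)"
            using that True by (cases "j = i") (auto simp: p_def z_def axis_def)
        qed
        then show ?thesis using y(1) by (simp add: dist_norm)
      qed
      have d: "((\<lambda>t. G (p t)) has_derivative (\<lambda>s. frechet_derivative G (at (p t)) (s *\<^sub>R axis i 1))) (at t)"
        if "0 \<le> t" "t \<le> y $ i" for t
        by (rule has_derivative_compose[OF _ smooth_on_has_derivative[OF assms(2)]])
           (use pb[OF that] r(2) in \<open>auto simp: p_def[abs_def] intro!: derivative_eq_intros\<close>)
      have "continuous_on {0..y $ i} (\<lambda>t. G (p t))"
        by (rule has_derivative_continuous_on[OF has_derivative_at_withinI[OF d]]) auto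
      from mvt_general[OF y(2) this d] obtain t where t: "t \<in> {0<..<y $ i}"
        "norm (G (p (y $ i)) - G (p 0)) \<le> norm (frechet_derivative G (at (p t)) ((y $ i - 0) *\<^sub>R axis i 1))"
        by auto
      have pt: "p t \<in> cball x r" "p 0 \<in> cball x r" using t(1) y(2) pb by auto
      have "G (p 0) = 0" using assms(3)[of "p 0"] pi pt(2) r(2) by auto
      moreover have "p (y $ i) = y" by (simp add: p_def z_def)
      moreover have "frechet_derivative G (at (p t)) ((y $ i) *\<^sub>R axis i 1) = (y $ i) *\<^sub>R partial i G (p t)"
        using linear_scale[OF has_derivative_linear[OF smooth_on_has_derivative[OF assms(2), of "p t"]]] pt r(2)
        by (auto simp: partial_def)
      ultimately have "norm (G y) \<le> y $ i * C"
        using t(2) y(2) C[OF pt(1)] by (auto intro: order_trans mult_left_mono)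
      then show "norm (G y / of_real (y $ i)) \<le> C"
        using y(2) by (simp add: norm_divide pos_divide_le_eq mult.commute)
    qed (use r in auto)
  qed
qed

text \<open>\<open>F\<close> may jump across the hyperplane. Measurability comes from writing the
  product as the indicator of an open set times a function continuous on that set, which is possible
  since \<open>F\<close> vanishes for \<open>x $ i \<le> 0\<close>.\<close>

lemma integrable_half:
  fixes F :: "real^'n \<Rightarrow> complex"
  assumes "open U" "continuous_on (half U i) F" "\<And>x. x \<in> U \<Longrightarrow> x $ i \<le> 0 \<Longrightarrow> F x = 0"
    and "loc_bounded U i F" "test_function U \<psi>"
  shows "integrable lborel (\<lambda>x. F x * \<psi> x)"
proof -
  note \<psi> = test_functionD[OF assms(5)]
  obtain C where C: "0 \<le> C" "\<And>y. y \<in> tsupport \<psi> \<Longrightarrow> y $ i > 0 \<Longrightarrow> norm (F y) \<le> C"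
    using loc_bounded_compact[OF assms(4) \<psi>(2,3)] by metis
  have z: "x \<notin> U \<Longrightarrow> \<psi> x = 0" for x using \<psi>(3) \<psi>(4)[of x] by blast
  have eq: "(\<lambda>x. F x * \<psi> x) = (\<lambda>x. indicator (half U i) x *\<^sub>R (F x * \<psi> x))"
  proof
    show "F x * \<psi> x = indicator (half U i) x *\<^sub>R (F x * \<psi> x)" for x
      using z[of x] assms(3)[of x] by (cases "x \<in> U"; cases "x $ i > 0") auto
  qed
  have 1: "integrable lborel \<psi>"
    using integrable_mult_test[OF open_UNIV, of "\<lambda>_. 1" \<psi>] test_function_subset[OF assms(5)] by auto
  have c: "continuous_on (half U i) (\<lambda>x. F x * \<psi> x)"
    by (intro continuous_intros assms(2) continuous_on_subset[OF smooth_on_continuous[OF \<psi>(1)]]) auto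
  show ?thesis
  proof (rule Bochner_Integration.integrable_bound[of _ "\<lambda>x. C * norm (\<psi> x)"])
    show "integrable lborel (\<lambda>x. C * norm (\<psi> x))" using 1 by simp
    show "(\<lambda>x. F x * \<psi> x) \<in> borel_measurable lborel"
      unfolding eq using borel_measurable_continuous_on_indicator[OF _ c] open_half[OF assms(1)] by auto
    have "norm (F x * \<psi> x) \<le> norm (C * norm (\<psi> x))" for x
    proof (cases "x \<in> tsupport \<psi>")
      case True
      show ?thesis
      proof (cases "x $ i > 0")
        case True
        then show ?thesis using C(2)[OF \<open>x \<in> tsupport \<psi>\<close>] C(1) by (simp add: norm_mult mult_right_mono)
      next
        case False
        then have "F x = 0" using assms(3)[of x] \<psi>(3) \<open>x \<in> tsupport \<psi>\<close> by auto
        then show ?thesis by simp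
      qed
    next
      case False
      show ?thesis unfolding \<psi>(4)[OF False] by simp
    qed
    then show "AE x in lborel. norm (F x * \<psi> x) \<le> norm (C * norm (\<psi> x))" by simp
  qed
qed

text \<open>A locally bounded majorant is enough, for it is bounded on the compact support of
  \<open>\<psi>\<close>.\<close>

lemma half_dominated_convergence:
  fixes F :: "real^'n \<Rightarrow> complex" and B :: "real^'n \<Rightarrow> real"
  assumes "open U" "\<And>n. continuous_on (half U i) (Fn n)" "continuous_on (half U i) F"
    and "\<And>n x. x \<in> U \<Longrightarrow> x $ i \<le> 0 \<Longrightarrow> Fn n x = 0" "\<And>x. x \<in> U \<Longrightarrow> x $ i \<le> 0 \<Longrightarrow> F x = 0"
    and B: "loc_bounded U i B" "\<And>n x. x \<in> half U i \<Longrightarrow> norm (Fn n x) \<le> B x"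
    and lim: "\<And>x. x \<in> half U i \<Longrightarrow> (\<lambda>n. Fn n x) \<longlonglongrightarrow> F x"
    and "test_function U \<psi>"
  shows "(\<lambda>n. \<integral>x. Fn n x * \<psi> x \<partial>lborel) \<longlonglongrightarrow> (\<integral>x. F x * \<psi> x \<partial>lborel)"
proof -
  note \<psi> = test_functionD[OF \<open>test_function U \<psi>\<close>]
  obtain C where C: "0 \<le> C" "\<And>y. y \<in> tsupport \<psi> \<Longrightarrow> y $ i > 0 \<Longrightarrow> norm (B y) \<le> C"
    using loc_bounded_compact[OF B(1) \<psi>(2,3)] by metis
  have z: "x \<notin> U \<Longrightarrow> \<psi> x = 0" for x using \<psi>(3) \<psi>(4)[of x] by blast
  have 1: "integrable lborel \<psi>"
    using integrable_mult_test[OF open_UNIV, of "\<lambda>_. 1" \<psi>] test_function_subset[OF \<open>test_function U \<psi>\<close>] by auto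
  have bdn: "loc_bounded U i (Fn n)" for n
    by (rule loc_bounded_mono[OF B(1)]) (metis B(2) abs_ge_self order_trans real_norm_def)
  have Fb: "norm (F x) \<le> B x" if "x \<in> half U i" for x
    by (rule LIMSEQ_le_const2[OF tendsto_norm[OF lim[OF that]]]) (use B(2)[OF that] in auto)
  have bd: "loc_bounded U i F"
    by (rule loc_bounded_mono[OF B(1)]) (metis Fb abs_ge_self order_trans real_norm_def)
  show ?thesis
  proof (rule integral_dominated_convergence[where w = "\<lambda>x. C * norm (\<psi> x)"])
    show "(\<lambda>x. F x * \<psi> x) \<in> borel_measurable lborel"
      by (rule borel_measurable_integrable[OF integrable_half[OF assms(1,3,5) bd assms(9)]])
    show "(\<lambda>x. Fn n x * \<psi> x) \<in> borel_measurable lborel" for n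
      by (rule borel_measurable_integrable[OF integrable_half[OF assms(1,2,4) bdn assms(9)]])
    show "integrable lborel (\<lambda>x. C * norm (\<psi> x))" using 1 by simp
    have "(\<lambda>n. Fn n x * \<psi> x) \<longlonglongrightarrow> F x * \<psi> x" for x
    proof (cases "x \<in> half U i")
      case True
      then show ?thesis by (intro tendsto_intros lim)
    next
      case False
      then have "Fn n x * \<psi> x = F x * \<psi> x" for n
        using z[of x] assms(4,5)[of x] by (cases "x \<in> U") auto
      then show ?thesis by (simp only: tendsto_const)
    qed
    then show "AE x in lborel. (\<lambda>n. Fn n x * \<psi> x) \<longlonglongrightarrow> F x * \<psi> x" by simp
    have "norm (Fn n x * \<psi> x) \<le> C * norm (\<psi> x)" for n x
    proof (cases "x \<in> tsupport \<psi>")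
      case True
      show ?thesis
      proof (cases "x $ i > 0")
        case True
        then have "x \<in> half U i" using \<open>x \<in> tsupport \<psi>\<close> \<psi>(3) by auto
        from B(2)[OF this, of n] C(2)[OF \<open>x \<in> tsupport \<psi>\<close> True] have "norm (Fn n x) \<le> C" by simp
        then show ?thesis by (simp add: norm_mult mult_right_mono)
      next
        case False
        then have "Fn n x = 0" using assms(4)[of x n] \<psi>(3) \<open>x \<in> tsupport \<psi>\<close> by auto
        then show ?thesis using C(1) by simp
      qed
    next
      case False
      show ?thesis unfolding \<psi>(4)[OF False] by simp
    qed
    then show "AE x in lborel. norm (Fn n x * \<psi> x) \<le> C * norm (\<psi> x)" for n by simp
  qed
qed

section \<open>Differential operators applied to functions on a half-space\<close>

definition cut :: "'n \<Rightarrow> real \<Rightarrow> (real^'n \<Rightarrow> complex) \<Rightarrow> real^'n \<Rightarrow> complex" where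
  "cut l \<epsilon> F x = of_real (cutoff \<epsilon> (x $ l)) * F x"

lemma partial_add:
  assumes "f differentiable (at x)" "g differentiable (at x)"
  shows "partial i (\<lambda>x. f x + g x) x = partial i f x + partial i g x"
  by (rule partial_eqI[OF has_derivative_add[OF assms[THEN differentiable_has_derivative]]])
     (simp add: partial_def)

lemma Ck_on_partial: "Ck_on (Suc n) U f \<Longrightarrow> Ck_on n U (partial i f)"
  by (simp add: partial_def[abs_def])

context
  fixes U :: "(real^'n) set" and l :: 'n and F :: "real^'n \<Rightarrow> complex" and \<epsilon> :: real
  assumes U: "open U" and F: "smooth_on (half U l) F" and \<epsilon>: "\<epsilon> > 0"
begin

lemma cut_eq_0: "x $ l \<le> \<epsilon> \<Longrightarrow> cut l \<epsilon> F x = 0"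
  by (simp add: cut_def cutoff_eq_0[OF \<epsilon>])

lemma open_strip: "open (U \<inter> {x. x $ l < \<epsilon>})"
  using U by (intro open_Int open_Collect_less) (auto intro: continuous_intros)

text \<open>\<open>F\<close> is uncontrolled at the hyperplane, but the product vanishes identically
  on the strip \<open>x $ l < \<epsilon>\<close>, which together with the open half covers
  \<open>U\<close>. Order two is the order of the cutoff.\<close>

lemma Ck_on_cut: "Ck_on (Suc 1) U (cut l \<epsilon> F)"
proof -
  have 1: "Ck_on (Suc 1) (half U l) (\<lambda>x. complex_of_real (cutoff \<epsilon> (x $ l)))"
    by (rule Ck_on_bounded_linear[OF bounded_linear_of_real
          Ck_on_compose[OF open_half[OF U] open_UNIV subset_UNIV
            Ck_on_linear[OF bounded_linear_vec_nth] Ck_on_cutoff(1)[OF \<epsilon>]] open_half[OF U]])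
  have 2: "Ck_on (Suc 1) (half U l) (cut l \<epsilon> F)"
    unfolding cut_def[abs_def]
    by (rule Ck_on_mult[OF open_half[OF U] 1]) (use F smooth_on_def in blast)
  have 3: "Ck_on (Suc 1) (U \<inter> {x. x $ l < \<epsilon>}) (cut l \<epsilon> F)"
    by (rule Ck_on_cong[OF open_strip _ Ck_on_const[of _ _ 0]]) (simp add: cut_eq_0)
  have "half U l \<union> U \<inter> {x. x $ l < \<epsilon>} = U" using \<epsilon> by auto
  with Ck_on_Un[OF open_half[OF U] open_strip 2 3] show ?thesis by simp
qed

lemma partial_cut_eq_0: "x \<in> U \<Longrightarrow> x $ l < \<epsilon> \<Longrightarrow> partial j (cut l \<epsilon> F) x = 0"
  by (rule partial_eq_0[OF open_strip]) (auto intro: cut_eq_0)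

lemma has_derivative_cutoff:
  shows "((\<lambda>x::real^'n. complex_of_real (cutoff \<epsilon> (x $ l))) has_derivative
      (\<lambda>h. of_real (cutoff' \<epsilon> (x $ l) * h $ l))) (at x)"
    and "((\<lambda>x::real^'n. complex_of_real (cutoff' \<epsilon> (x $ l))) has_derivative
      (\<lambda>h. of_real (cutoff'' \<epsilon> (x $ l) * h $ l))) (at x)"
  using has_derivative_of_real[OF has_derivative_compose[OF bounded_linear_imp_has_derivative[OF bounded_linear_vec_nth]
        DERIV_cutoff[OF \<epsilon>, unfolded has_field_derivative_def]]]
    has_derivative_of_real[OF has_derivative_compose[OF bounded_linear_imp_has_derivative[OF bounded_linear_vec_nth]
        DERIV_cutoff'[OF \<epsilon>, unfolded has_field_derivative_def]]]
  by blast+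

lemma partial_cutoff:
  shows "partial j (\<lambda>x. complex_of_real (cutoff \<epsilon> (x $ l))) x = (if j = l then of_real (cutoff' \<epsilon> (x $ l)) else 0)"
    and "partial j (\<lambda>x. complex_of_real (cutoff' \<epsilon> (x $ l))) x = (if j = l then of_real (cutoff'' \<epsilon> (x $ l)) else 0)"
  by (rule partial_eqI[OF has_derivative_cutoff(1)], simp add: axis_def)
     (rule partial_eqI[OF has_derivative_cutoff(2)], simp add: axis_def)

lemma differentiable_cutoff:
  shows "(\<lambda>x. complex_of_real (cutoff \<epsilon> (x $ l))) differentiable (at x)"
    and "(\<lambda>x. complex_of_real (cutoff' \<epsilon> (x $ l))) differentiable (at x)"
  using has_derivative_cutoff differentiableI by blast+

lemma partial_cut:
  assumes "x \<in> half U l"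
  shows "partial j (cut l \<epsilon> F) x = of_real (cutoff \<epsilon> (x $ l)) * partial j F x
    + (if j = l then of_real (cutoff' \<epsilon> (x $ l)) * F x else 0)"
  unfolding cut_def[abs_def]
  by (subst partial_mult[OF differentiable_cutoff(1) smooth_on_differentiable[OF F assms]])
     (simp add: partial_cutoff)

end

lemma norm_cut_le:
  assumes "\<epsilon> > 0" "x $ l > 0"
  shows "norm (cut l \<epsilon> F x) \<le> norm (F x)"
  using cutoff_bounds(1)[OF assms] by (simp add: cut_def norm_mult mult_left_le_one_le)

definition hseq :: "nat \<Rightarrow> real" where
  "hseq n = inverse (real (Suc n))"

lemma hseq: "hseq n > 0" "hseq \<longlonglongrightarrow> 0"
  unfolding hseq_def using LIMSEQ_inverse_real_of_nat by auto

lemma cut_integral_tendsto: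
  assumes "open U" "smooth_on (half U l) F" "\<And>x. x \<in> U \<Longrightarrow> x $ l \<le> 0 \<Longrightarrow> F x = 0"
    and "loc_bounded U l F" "test_function U \<psi>"
  shows "(\<lambda>n. \<integral>x. cut l (hseq n) F x * \<psi> x \<partial>lborel) \<longlonglongrightarrow> (\<integral>x. F x * \<psi> x \<partial>lborel)"
proof (rule half_dominated_convergence[where i = l and B = "\<lambda>x. norm (F x)"])
  show "continuous_on (half U l) (cut l (hseq n) F)" for n
    by (rule continuous_on_subset[OF Ck_on_continuous[OF Ck_on_cut[OF assms(1,2) hseq(1)]]]) auto
  show "(\<lambda>n. cut l (hseq n) F x) \<longlonglongrightarrow> F x" if "x \<in> half U l" for x
    unfolding cut_def using tendsto_mult[OF tendsto_of_real[OF cutoff_limits(1)[OF hseq(2), of "x $ l"]] tendsto_const[of "F x"]] that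
    by simp
  show "loc_bounded U l (\<lambda>x. norm (F x))" by (rule loc_bounded_mono[OF assms(4)]) simp
  show "cut l (hseq n) F x = 0" if "x \<in> U" "x $ l \<le> 0" for n x
    using assms(3)[OF that] by (simp add: cut_def)
  show "norm (cut l (hseq n) F x) \<le> norm (F x)" if "x \<in> half U l" for n x
    using norm_cut_le[OF hseq(1)] that by blast
qed (use assms smooth_on_continuous in blast)+

text \<open>The commutator of the cutoff with a field tangent to the boundary is bounded and tends to
  zero pointwise.\<close>

lemma tangential_derivative_half:
  fixes V :: "'n::finite \<Rightarrow> real^'n \<Rightarrow> complex"
  assumes U: "open U" and F: "smooth_on (half U l) F"
    and F0: "\<And>x. x \<in> U \<Longrightarrow> x $ l \<le> 0 \<Longrightarrow> F x = 0" and Fb: "loc_bounded U l F"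
    and V: "\<And>j. smooth_on U (V j)" and V0: "\<And>x. x \<in> U \<Longrightarrow> x $ l = 0 \<Longrightarrow> V l x = 0"
    and VF: "\<And>x. x \<in> half U l \<Longrightarrow> VF x = (\<Sum>j\<in>UNIV. V j x * partial j F x)"
    and VF0: "\<And>x. x \<in> U \<Longrightarrow> x $ l \<le> 0 \<Longrightarrow> VF x = 0" and VFb: "loc_bounded U l VF"
    and \<psi>: "test_function U \<psi>"
  shows "(\<Sum>j\<in>UNIV. - (\<integral>x. F x * partial j (\<lambda>x. V j x * \<psi> x) x \<partial>lborel)) = (\<integral>x. VF x * \<psi> x \<partial>lborel)"
proof -
  define G where "G n = cut l (hseq n) F" for n
  define H where "H n x = (\<Sum>j\<in>UNIV. V j x * partial j (G n) x)" for n x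
  note Gk = Ck_on_cut[OF U F hseq(1)]
  have pG: "continuous_on U (partial j (G n))" for n j
    unfolding G_def by (rule Ck_on_continuous[OF Ck_on_partial[OF Gk]])
  have Hc: "continuous_on U (H n)" for n
    unfolding H_def using V by (intro continuous_intros pG smooth_on_continuous) auto
  have tV: "test_function U (\<lambda>x. V j x * \<psi> x)" for j
    by (rule test_function_mult[OF U V \<psi>])
  have 1: "(\<Sum>j\<in>UNIV. - (\<integral>x. G n x * partial j (\<lambda>x. V j x * \<psi> x) x \<partial>lborel)) = (\<integral>x. H n x * \<psi> x \<partial>lborel)" for n
  proof -
    have "(\<Sum>j\<in>UNIV. - (\<integral>x. G n x * partial j (\<lambda>x. V j x * \<psi> x) x \<partial>lborel))
      = (\<Sum>j\<in>UNIV. \<integral>x. partial j (G n) x * (V j x * \<psi> x) \<partial>lborel)"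
      using integral_by_parts_test[OF U Ck_on_Suc_imp[OF Gk[of n]] tV, folded G_def] by simp
    also have "\<dots> = (\<integral>x. (\<Sum>j\<in>UNIV. partial j (G n) x * (V j x * \<psi> x)) \<partial>lborel)"
      using integrable_mult_test[OF U pG tV] by (subst Bochner_Integration.integral_sum) auto
    finally show ?thesis by (simp add: H_def sum_distrib_left mult_ac)
  qed
  \<comment> \<open>The commutator is arranged as \<open>x $ l\<close> times the derivative of the
    cutoff, bounded by 3, times the quotient of \<open>V l\<close> by \<open>x $ l\<close>, locally
    bounded because the field is tangent.\<close>
  have Hhalf: "H n x = of_real (cutoff (hseq n) (x $ l)) * VF x + of_real (x $ l * cutoff' (hseq n) (x $ l)) * (V l x / of_real (x $ l) * F x)"
    if "x \<in> half U l" for n x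
  proof -
    have "H n x = (\<Sum>j\<in>UNIV. of_real (cutoff (hseq n) (x $ l)) * (V j x * partial j F x)
      + (if j = l then of_real (cutoff' (hseq n) (x $ l)) * (V l x * F x) else 0))"
      unfolding H_def G_def partial_cut[OF U F hseq(1) that]
      by (rule sum.cong) (auto simp: algebra_simps)
    then show ?thesis
      using that by (simp add: sum.distrib VF sum_distrib_left)
  qed
  have "(\<lambda>n. \<integral>x. H n x * \<psi> x \<partial>lborel) \<longlonglongrightarrow> (\<integral>x. VF x * \<psi> x \<partial>lborel)"
  proof (rule half_dominated_convergence[where i = l and B = "\<lambda>x. norm (VF x) + 3 * norm (V l x / of_real (x $ l) * F x)"])
    show "continuous_on (half U l) (H n)" for n using Hc continuous_on_subset by blast
    have "continuous_on (half U l) (\<lambda>x. \<Sum>j\<in>UNIV. V j x * partial j F x)"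
      by (intro continuous_intros continuous_on_subset[OF smooth_on_continuous[OF V]]
          smooth_on_continuous[OF smooth_on_partial[OF F]]) auto
    then show "continuous_on (half U l) VF"
      by (rule continuous_on_eq) (simp add: VF)
    show "H n x = 0" if "x \<in> U" "x $ l \<le> 0" for n x
      using partial_cut_eq_0[OF U F hseq(1) that(1)] hseq(1)[of n] that(2)
      unfolding H_def G_def by (simp add: le_less_trans)
    show "loc_bounded U l (\<lambda>x. norm (VF x) + 3 * norm (V l x / of_real (x $ l) * F x))"
      by (intro loc_bounded_add loc_bounded_mult loc_bounded_const
          loc_bounded_mono[OF VFb] loc_bounded_mono[OF loc_bounded_mult[OF loc_bounded_quotient[OF U V V0] Fb]]) auto
    show "norm (H n x) \<le> norm (VF x) + 3 * norm (V l x / of_real (x $ l) * F x)" if x: "x \<in> half U l" for n x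
    proof -
      have xl: "x $ l > 0" using x by simp
      show ?thesis
        unfolding Hhalf[OF x]
        by (intro norm_triangle_mono)
           (use cutoff_bounds(1,2)[OF hseq(1)[of n] xl] in
             \<open>auto simp only: norm_mult norm_of_real intro!: mult_left_le_one_le mult_right_mono mult_nonneg_nonneg norm_ge_zero abs_ge_zero\<close>)
    qed
    show "(\<lambda>n. H n x) \<longlonglongrightarrow> VF x" if x: "x \<in> half U l" for x
    proof -
      have xl: "x $ l > 0" using x by simp
      show ?thesis
        unfolding Hhalf[OF x]
        by (rule tendsto_eq_intros cutoff_limits(1,2)[OF hseq(2) xl] refl)+ simp
    qed
  qed (use assms in auto)
  moreover have "(\<lambda>n. \<Sum>j\<in>UNIV. - (\<integral>x. G n x * partial j (\<lambda>x. V j x * \<psi> x) x \<partial>lborel)) \<longlonglongrightarrow>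
     (\<Sum>j\<in>UNIV. - (\<integral>x. F x * partial j (\<lambda>x. V j x * \<psi> x) x \<partial>lborel))"
    unfolding G_def
    by (intro tendsto_intros cut_integral_tendsto[OF U F F0 Fb] test_function_partial tV)
  ultimately show ?thesis
    unfolding 1 by (rule LIMSEQ_unique[symmetric])
qed

text \<open>The shape of the product rule for a cutoff in coordinate \<open>l\<close> alone:
  \<open>q\<close> and \<open>r\<close> collect the terms in which the outer or the inner derivative
  falls on the cutoff, \<open>s\<close> the term in which both do.\<close>

lemma sum_sum_Kronecker:
  fixes p :: "'n::finite \<Rightarrow> 'n \<Rightarrow> complex"
  shows "(\<Sum>i\<in>UNIV. \<Sum>j\<in>UNIV. p i j + (if i = l then q j else 0) + (if j = l then r i + (if i = l then s else 0) else 0))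
    = (\<Sum>i\<in>UNIV. \<Sum>j\<in>UNIV. p i j) + (\<Sum>j\<in>UNIV. q j) + (\<Sum>i\<in>UNIV. r i) + s"
proof -
  have "(\<Sum>i\<in>UNIV. \<Sum>j\<in>UNIV. if i = l then q j else 0) = (\<Sum>j\<in>UNIV. q j)"
    by (subst sum.swap) simp
  then show ?thesis by (simp add: sum.distrib)
qed

text \<open>The hypotheses on \<open>A l l\<close>, on the flux through the levels of \<open>x $ l\<close> and on the divergence
  of the \<open>l\<close>-th column bound the commutator of the operator with the cutoff.\<close>

lemma divergence_form_weak_solution:
  fixes A :: "'n::finite \<Rightarrow> 'n \<Rightarrow> real^'n \<Rightarrow> complex"
  assumes U: "open U" and F: "smooth_on (half U l) F"
    and F0: "\<And>x. x \<in> U \<Longrightarrow> x $ l \<le> 0 \<Longrightarrow> F x = 0" and Fb: "loc_bounded U l F"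
    and A: "\<And>i j. smooth_on U (A i j)" and sym: "\<And>i j x. x \<in> U \<Longrightarrow> A i j x = A j i x"
    and LF: "\<And>x. x \<in> half U l \<Longrightarrow> (\<Sum>i\<in>UNIV. partial i (\<lambda>y. \<Sum>j\<in>UNIV. A i j y * partial j F y) x) = 0"
    and b1: "loc_bounded U l (\<lambda>x. A l l x * F x / of_real (x $ l) ^ 2)"
    and b2: "loc_bounded U l (\<lambda>x. (\<Sum>j\<in>UNIV. A l j x * partial j F x) / of_real (x $ l))"
    and b3: "loc_bounded U l (\<lambda>x. F x * (\<Sum>i\<in>UNIV. partial i (A i l) x) / of_real (x $ l))"
    and \<psi>: "test_function U \<psi>"
  shows "(\<Sum>i\<in>UNIV. \<Sum>j\<in>UNIV. \<integral>x. F x * partial j (\<lambda>x. A i j x * partial i \<psi> x) x \<partial>lborel) = 0"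
proof -
  define G where "G n = cut l (hseq n) F" for n
  define H where "H n x = (\<Sum>i\<in>UNIV. \<Sum>j\<in>UNIV. partial i (\<lambda>x. A i j x * partial j (G n) x) x)" for n x
  have Gk: "Ck_on (Suc 1) U (G n)" for n
    unfolding G_def by (rule Ck_on_cut[OF U F hseq(1)])
  have pG: "Ck_on 1 U (partial j (G n))" for n j
    by (rule Ck_on_partial[OF Gk])
  have A': "Ck_on k U (A i j)" for k i j using A smooth_on_def by blast
  have ApG: "Ck_on 1 U (\<lambda>x. A i j x * partial j (G n) x)" for i j n
    by (rule Ck_on_mult[OF U A' pG])
  have pApG: "continuous_on U (partial i (\<lambda>x. A i j x * partial j (G n) x))" for i j n
    using Ck_on_partial[OF ApG[unfolded One_nat_def]] by (simp add: Ck_on_continuous)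
  have Hc: "continuous_on U (H n)" for n
    unfolding H_def by (intro continuous_intros pApG)
  have t1: "test_function U (partial i \<psi>)" for i by (rule test_function_partial[OF \<psi>])
  have tA: "test_function U (\<lambda>x. A i j x * partial i \<psi> x)" for i j
    by (rule test_function_mult[OF U A t1])
  have 1: "(\<Sum>i\<in>UNIV. \<Sum>j\<in>UNIV. \<integral>x. G n x * partial j (\<lambda>x. A i j x * partial i \<psi> x) x \<partial>lborel)
    = (\<integral>x. H n x * \<psi> x \<partial>lborel)" for n
  proof -
    have "(\<integral>x. G n x * partial j (\<lambda>x. A i j x * partial i \<psi> x) x \<partial>lborel)
      = (\<integral>x. partial i (\<lambda>x. A i j x * partial j (G n) x) x * \<psi> x \<partial>lborel)" for i j
    proof -
      have "(\<integral>x. G n x * partial j (\<lambda>x. A i j x * partial i \<psi> x) x \<partial>lborel)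
        = - (\<integral>x. partial j (G n) x * (A i j x * partial i \<psi> x) \<partial>lborel)"
        by (rule integral_by_parts_test[OF U Ck_on_Suc_imp[OF Gk] tA])
      also have "\<dots> = - (\<integral>x. (A i j x * partial j (G n) x) * partial i \<psi> x \<partial>lborel)"
        by (simp add: mult_ac)
      finally show ?thesis
        by (simp add: integral_by_parts_test[OF U ApG \<psi>])
    qed
    then have "(\<Sum>i\<in>UNIV. \<Sum>j\<in>UNIV. \<integral>x. G n x * partial j (\<lambda>x. A i j x * partial i \<psi> x) x \<partial>lborel)
      = (\<Sum>i\<in>UNIV. \<Sum>j\<in>UNIV. \<integral>x. partial i (\<lambda>x. A i j x * partial j (G n) x) x * \<psi> x \<partial>lborel)" by simp
    also have "\<dots> = (\<integral>x. (\<Sum>i\<in>UNIV. \<Sum>j\<in>UNIV. partial i (\<lambda>x. A i j x * partial j (G n) x) x * \<psi> x) \<partial>lborel)"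
      using integrable_mult_test[OF U pApG \<psi>]
      by (subst Bochner_Integration.integral_sum; (subst Bochner_Integration.integral_sum)?) auto
    finally show ?thesis by (simp add: H_def sum_distrib_right)
  qed
  define c where "c n x = complex_of_real (cutoff (hseq n) (x $ l))" for n and x :: "real^'n"
  define c' where "c' n x = complex_of_real (cutoff' (hseq n) (x $ l))" for n and x :: "real^'n"
  define c'' where "c'' n x = complex_of_real (cutoff'' (hseq n) (x $ l))" for n and x :: "real^'n"
  have dc: "c n differentiable (at x)" "c' n differentiable (at x)" for n x
    unfolding c_def[abs_def] c'_def[abs_def] by (rule differentiable_cutoff[OF U F hseq(1)])+
  have pc: "partial j (c n) x = (if j = l then c' n x else 0)" "partial j (c' n) x = (if j = l then c'' n x else 0)" for j n x
    unfolding c_def[abs_def] c'_def[abs_def] c''_def by (rule partial_cutoff[OF U F hseq(1)])+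
  \<comment> \<open>The term without derivatives of the cutoff is the equation for \<open>F\<close>
    and drops out. By symmetry of \<open>A\<close> the flux through the levels of
    \<open>x $ l\<close> occurs twice; the divergence of column \<open>l\<close> arises when the
    outer derivative falls on \<open>A i l\<close>.\<close>
  have Hhalf: "H n x = c' n x * (2 * (\<Sum>j\<in>UNIV. A l j x * partial j F x) + F x * (\<Sum>i\<in>UNIV. partial i (A i l) x))
      + c'' n x * (A l l x * F x)" if x: "x \<in> half U l" for n x
  proof -
    have dF: "F differentiable (at x)" "partial j F differentiable (at x)" for j
      using smooth_on_differentiable[OF F x] smooth_on_differentiable[OF smooth_on_partial[OF F] x] by auto
    have dA: "A i j differentiable (at x)" for i j
      using smooth_on_differentiable[OF A] x by auto
    have d1: "(\<lambda>y. A i j y * partial j F y) differentiable (at x)" for i j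
      by (intro differentiable_mult dA dF)
    have "partial i (\<lambda>y. A i j y * partial j (G n) y) x =
        c n x * partial i (\<lambda>y. A i j y * partial j F y) x
      + (if i = l then c' n x * (A l j x * partial j F x) else 0)
      + (if j = l then c' n x * (partial i (A i l) x * F x) + c' n x * (A l i x * partial i F x)
           + (if i = l then c'' n x * (A l l x * F x) else 0) else 0)" for i j
    proof -
      have "partial i (\<lambda>y. A i j y * partial j (G n) y) x = partial i (\<lambda>y. c n y * (A i j y * partial j F y)
         + (if j = l then c' n y * (A i l y * F y) else 0)) x"
        by (rule partial_cong[OF open_half[OF U] x])
           (auto simp: G_def partial_cut[OF U F hseq(1)] c_def c'_def algebra_simps)
      also have "\<dots> = partial i (\<lambda>y. c n y * (A i j y * partial j F y)) x
         + partial i (\<lambda>y. if j = l then c' n y * (A i l y * F y) else 0) x"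
        by (rule partial_add, intro differentiable_mult dA dF dc)
           (cases "j = l"; simp add: differentiable_mult dA dF dc)
      also have "\<dots> = c n x * partial i (\<lambda>y. A i j y * partial j F y) x
      + (if i = l then c' n x * (A l j x * partial j F x) else 0)
      + (if j = l then c' n x * (partial i (A i l) x * F x) + c' n x * (A l i x * partial i F x)
           + (if i = l then c'' n x * (A l l x * F x) else 0) else 0)"
      proof -
        have p1: "partial i (\<lambda>y. c n y * (A i j y * partial j F y)) x
          = (if i = l then c' n x * (A l j x * partial j F x) else 0) + c n x * partial i (\<lambda>y. A i j y * partial j F y) x"
          by (subst partial_mult[OF dc(1) d1]) (simp add: pc)
        have p2: "partial i (\<lambda>y. c' n y * (A i l y * F y)) x
          = (if i = l then c'' n x * (A l l x * F x) else 0) + c' n x * (partial i (A i l) x * F x + A l i x * partial i F x)"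
          using sym[of x i l] x
          by (subst partial_mult[OF dc(2) differentiable_mult[OF dA dF(1)]], subst partial_mult[OF dA dF(1)]) (simp add: pc)
        show ?thesis
          unfolding p1 using p2 by (cases "j = l") (simp_all add: partial_def[of _ "\<lambda>_. 0"] distrib_left)
      qed
      finally show ?thesis .
    qed
    then have "H n x = (\<Sum>i\<in>UNIV. \<Sum>j\<in>UNIV. c n x * partial i (\<lambda>y. A i j y * partial j F y) x)
      + (\<Sum>j\<in>UNIV. c' n x * (A l j x * partial j F x))
      + (\<Sum>i\<in>UNIV. c' n x * (partial i (A i l) x * F x) + c' n x * (A l i x * partial i F x)) + c'' n x * (A l l x * F x)"
      unfolding H_def by (simp only: sum_sum_Kronecker)
    then have "H n x = c n x * (\<Sum>i\<in>UNIV. \<Sum>j\<in>UNIV. partial i (\<lambda>y. A i j y * partial j F y) x)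
      + c' n x * (\<Sum>j\<in>UNIV. A l j x * partial j F x)
      + (c' n x * (F x * (\<Sum>i\<in>UNIV. partial i (A i l) x)) + c' n x * (\<Sum>j\<in>UNIV. A l j x * partial j F x))
      + c'' n x * (A l l x * F x)"
      by (simp add: sum.distrib sum_distrib_left mult_ac)
    moreover have "(\<Sum>i\<in>UNIV. \<Sum>j\<in>UNIV. partial i (\<lambda>y. A i j y * partial j F y) x) = 0"
      using LF[OF x] d1 by (simp add: partial_sum)
    ultimately show ?thesis
      by (simp add: algebra_simps)
  qed
  define B where "B x = 3 * (2 * norm ((\<Sum>j\<in>UNIV. A l j x * partial j F x) / of_real (x $ l))
       + norm (F x * (\<Sum>i\<in>UNIV. partial i (A i l) x) / of_real (x $ l))) + 18 * norm (A l l x * F x / of_real (x $ l) ^ 2)" for x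
  \<comment> \<open>Each derivative of the cutoff is given the power of \<open>x $ l\<close> that
    makes it bounded uniformly in \<open>n\<close>; the inverse powers left over are those in the
    hypotheses \<open>b1\<close>, \<open>b2\<close>, \<open>b3\<close>. The constants 3 and 18 in
    \<open>B\<close> come from \<open>cutoff_bounds\<close>.\<close>
  have Hhalf': "H n x = of_real (x $ l * cutoff' (hseq n) (x $ l)) * (2 * ((\<Sum>j\<in>UNIV. A l j x * partial j F x) / of_real (x $ l))
       + F x * (\<Sum>i\<in>UNIV. partial i (A i l) x) / of_real (x $ l)) +
       of_real ((x $ l)\<^sup>2 * cutoff'' (hseq n) (x $ l)) * (A l l x * F x / of_real (x $ l) ^ 2)" if x: "x \<in> half U l" for n x
    using x unfolding Hhalf[OF x] c'_def c''_def by (simp add: field_simps)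
  have "(\<lambda>n. \<integral>x. H n x * \<psi> x \<partial>lborel) \<longlonglongrightarrow> (\<integral>x. (\<lambda>_. 0) x * \<psi> x \<partial>lborel)"
  proof (rule half_dominated_convergence[where i = l and B = B])
    show "continuous_on (half U l) (H n)" for n using Hc continuous_on_subset by blast
    show "H n x = 0" if x: "x \<in> U" "x $ l \<le> 0" for n x
    proof -
      have "x \<in> U \<inter> {x. x $ l < hseq n}" using x hseq(1)[of n] by auto
      then have "partial i (\<lambda>x. A i j x * partial j (G n) x) x = 0" for i j
        by (rule partial_eq_0[OF open_strip[OF U F hseq(1)]])
           (auto simp: G_def partial_cut_eq_0[OF U F hseq(1)])
      then show ?thesis by (simp add: H_def)
    qed
    show "loc_bounded U l B"
      unfolding B_def
      by (intro loc_bounded_add loc_bounded_mult loc_bounded_const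
          loc_bounded_mono[OF b1] loc_bounded_mono[OF b2] loc_bounded_mono[OF b3]) auto
    show "norm (H n x) \<le> B x" if x: "x \<in> half U l" for n x
    proof -
      have xl: "x $ l > 0" using x by simp
      have m: "norm (2 * a + b) \<le> 2 * norm a + norm b" for a b :: complex
        using norm_triangle_ineq[of "2 * a" b] by (simp add: norm_mult)
      show ?thesis
        unfolding Hhalf'[OF x] B_def
        by (intro norm_triangle_mono)
           (use cutoff_bounds(2,3)[OF hseq(1)[of n] xl] m in
             \<open>auto simp only: norm_mult norm_of_real intro!: mult_mono mult_nonneg_nonneg add_nonneg_nonneg norm_ge_zero abs_ge_zero\<close>)
    qed
    show "(\<lambda>n. H n x) \<longlonglongrightarrow> 0" if x: "x \<in> half U l" for x
    proof -
      have xl: "x $ l > 0" using x by simp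
      show ?thesis
        unfolding Hhalf'[OF x]
        by (rule tendsto_eq_intros cutoff_limits(2,3)[OF hseq(2) xl] refl)+ simp
    qed
  qed (use assms in auto)
  moreover have "(\<lambda>n. \<Sum>i\<in>UNIV. \<Sum>j\<in>UNIV. \<integral>x. G n x * partial j (\<lambda>x. A i j x * partial i \<psi> x) x \<partial>lborel) \<longlonglongrightarrow>
     (\<Sum>i\<in>UNIV. \<Sum>j\<in>UNIV. \<integral>x. F x * partial j (\<lambda>x. A i j x * partial i \<psi> x) x \<partial>lborel)"
    unfolding G_def
    by (intro tendsto_intros cut_integral_tendsto[OF U F F0 Fb] test_function_partial tA)
  ultimately show ?thesis
    unfolding 1 using LIMSEQ_unique by fastforce
qed

section \<open>Conormality of \<open>x\<^sub>+\<^sup>\<alpha> v\<close>\<close>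

lemma plus_power_eq_0: "x \<le> 0 \<Longrightarrow> plus_power \<alpha> x = 0"
  by (simp add: plus_power_def)

lemma plus_power_eq: "x > 0 \<Longrightarrow> plus_power \<alpha> x = exp (\<alpha> * of_real (ln x))"
  by (simp add: plus_power_def powr_def Ln_of_real)

lemma norm_plus_power: "Re \<alpha> = 0 \<Longrightarrow> x > 0 \<Longrightarrow> norm (plus_power \<alpha> x) = 1"
  by (simp add: plus_power_eq)

lemma has_derivative_plus_power:
  fixes x :: "real^'n"
  assumes "x $ l > 0"
  shows "((\<lambda>x. plus_power \<alpha> (x $ l)) has_derivative
    (\<lambda>h. plus_power \<alpha> (x $ l) * (\<alpha> * of_real (h $ l / x $ l)))) (at x)"
proof -
  have "((\<lambda>x. exp (\<alpha> * of_real (ln (x $ l)))) has_derivative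
     (\<lambda>h. exp (\<alpha> * of_real (ln (x $ l))) * (\<alpha> * of_real (h $ l / x $ l)))) (at x)"
    using has_derivative_compose[OF has_derivative_mult_right[OF has_derivative_of_real[OF
          has_derivative_ln[OF assms bounded_linear_imp_has_derivative[OF bounded_linear_vec_nth]]], of \<alpha>]
        DERIV_exp[unfolded has_field_derivative_def]] assms
    by (simp add: divide_inverse mult.commute)
  then show ?thesis
    by (rule has_derivative_transform_within_open[of _ _ _ _ "half UNIV l", OF _ open_half, THEN has_derivative_eq_rhs])
       (use assms in \<open>auto simp: plus_power_eq\<close>)
qed

lemma smooth_on_plus_power:
  assumes "open U"
  shows "smooth_on (half U l) (\<lambda>x. plus_power \<alpha> (x $ l))"
proof (rule smooth_on_cong[OF open_half[OF assms]])
  show "smooth_on (half U l) (\<lambda>x. exp (\<alpha> * of_real (ln (x $ l))))"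
    by (intro smooth_on_exp smooth_on_mult smooth_on_const smooth_on_of_real smooth_on_ln
        smooth_on_vec_nth open_half[OF assms]) auto
qed (simp add: plus_power_eq)

text \<open>Differentiating x^\<alpha> along a tangent field produces the quotient of the normal
  component of the field by x. Hadamard's lemma would show such quotients to be smooth; taken as
  generators, they only have to be bounded and to be reproduced by tangent fields.\<close>

inductive symbol :: "(real^'n) set \<Rightarrow> 'n \<Rightarrow> (real^'n \<Rightarrow> complex) \<Rightarrow> bool" for U l where
  symbol_smooth: "smooth_on U f \<Longrightarrow> symbol U l f"
| symbol_quotient: "smooth_on U f \<Longrightarrow> (\<And>x. x \<in> U \<Longrightarrow> x $ l = 0 \<Longrightarrow> f x = 0) \<Longrightarrow>
    symbol U l (\<lambda>x. f x / of_real (x $ l))"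
| symbol_add: "symbol U l f \<Longrightarrow> symbol U l g \<Longrightarrow> symbol U l (\<lambda>x. f x + g x)"
| symbol_mult: "symbol U l f \<Longrightarrow> symbol U l g \<Longrightarrow> symbol U l (\<lambda>x. f x * g x)"

lemma symbol_smooth_on_half:
  assumes "open U" "symbol U l f"
  shows "smooth_on (half U l) f"
  using assms(2)
proof induction
  case (symbol_smooth f)
  then show ?case by (rule smooth_on_subset) auto
next
  case (symbol_quotient f)
  have "smooth_on (half U l) f" using symbol_quotient(1) by (rule smooth_on_subset) auto
  then show ?case
    by (intro smooth_on_divide smooth_on_of_real smooth_on_vec_nth open_half[OF assms(1)]) auto
next
  case (symbol_add f g)
  then show ?case using smooth_on_add[OF open_half[OF assms(1)]] by blast
next
  case (symbol_mult f g)
  then show ?case using smooth_on_mult[OF open_half[OF assms(1)]] by blast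
qed

lemma symbol_loc_bounded:
  assumes "open U" "symbol U l f"
  shows "loc_bounded U l f"
  using assms(2)
  by induction (auto intro: loc_bounded_add loc_bounded_mult loc_bounded_quotient[OF assms(1)]
      loc_bounded_continuous[OF assms(1) smooth_on_continuous])

text \<open>The line through \<open>x\<close> in a direction \<open>j \<noteq> l\<close> stays in
  the hyperplane, so \<open>f\<close> vanishes along it near \<open>x\<close>.\<close>

lemma partial_eq_0_tangential:
  fixes f :: "real^'n \<Rightarrow> complex"
  assumes "open U" "smooth_on U f" "\<And>x. x \<in> U \<Longrightarrow> x $ l = 0 \<Longrightarrow> f x = 0" "x \<in> U" "x $ l = 0" "j \<noteq> l"
  shows "partial j f x = 0"
proof -
  define p where "p t = x + t *\<^sub>R axis j 1" for t :: real
  have pd: "(p has_derivative (\<lambda>s. s *\<^sub>R axis j 1)) (at 0)"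
    unfolding p_def[abs_def] by (auto intro!: derivative_eq_intros)
  have "(f has_derivative frechet_derivative f (at (p 0))) (at (p 0))"
    using smooth_on_has_derivative[OF assms(2), of "p 0"] assms(4) by (simp add: p_def)
  from has_derivative_compose[OF pd this]
  have 1: "((\<lambda>t. f (p t)) has_derivative (\<lambda>s. frechet_derivative f (at (p 0)) (s *\<^sub>R axis j 1))) (at 0)" .
  have "open (p -` U)"
    by (rule open_vimage[OF assms(1)]) (auto simp: p_def[abs_def] intro!: continuous_intros)
  then have "((\<lambda>t. f (p t)) has_derivative (\<lambda>_. 0)) (at 0)"
    using has_derivative_transform_within_open[OF has_derivative_const[of 0], of "p -` U" 0 "\<lambda>t. f (p t)"] assms(3-6)
    by (auto simp: p_def axis_def)
  from has_derivative_unique[OF 1 this] show ?thesis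
    by (metis p_def partial_def scaleR_one scaleR_zero_left add.right_neutral)
qed

lemma partial_inverse_nth:
  fixes x :: "real^'n"
  assumes "x $ l > 0"
  shows "(\<lambda>x. inverse (complex_of_real (x $ l))) differentiable (at x)"
    and "partial j (\<lambda>x. inverse (complex_of_real (x $ l))) x = (if j = l then - (1 / of_real (x $ l) ^ 2) else 0)"
proof -
  have "((\<lambda>x. inverse (complex_of_real (x $ l))) has_derivative
     (\<lambda>h. - (inverse (of_real (x $ l)) * of_real (h $ l) * inverse (of_real (x $ l))))) (at x)"
    by (rule Deriv.has_derivative_inverse[OF _ has_derivative_of_real[OF bounded_linear_imp_has_derivative[OF bounded_linear_vec_nth]]])
       (use assms in auto)
  then show "(\<lambda>x. inverse (complex_of_real (x $ l))) differentiable (at x)"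
    "partial j (\<lambda>x. inverse (complex_of_real (x $ l))) x = (if j = l then - (1 / of_real (x $ l) ^ 2) else 0)"
    by (auto intro: differentiableI partial_eqI simp: axis_def power2_eq_square divide_inverse)
qed

text \<open>On the second kind of generator V(f/x) = (V f)/x - (V_l/x)(f/x), and V f vanishes on the
  hyperplane along with f because V is tangent. The sum and product rules extend this to the whole
  algebra.\<close>

lemma symbol_tangential_derivative:
  fixes V :: "'n::finite \<Rightarrow> real^'n \<Rightarrow> complex"
  assumes U: "open U" and V: "\<And>j. smooth_on U (V j)" and V0: "\<And>x. x \<in> U \<Longrightarrow> x $ l = 0 \<Longrightarrow> V l x = 0"
    and "symbol U l f"
  shows "\<exists>g. symbol U l g \<and> (\<forall>x\<in>half U l. (\<Sum>j\<in>UNIV. V j x * partial j f x) = g x)"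
  using assms(4)
proof induction
  case (symbol_smooth f)
  have "smooth_on U (\<lambda>x. \<Sum>j\<in>UNIV. V j x * partial j f x)"
    by (intro smooth_on_sum smooth_on_mult U V smooth_on_partial symbol_smooth)
  then show ?case using symbol.symbol_smooth by blast
next
  case (symbol_quotient f)
  define g where "g x = (\<Sum>j\<in>UNIV. V j x * partial j f x)" for x
  have g: "smooth_on U g"
    unfolding g_def by (intro smooth_on_sum smooth_on_mult U V smooth_on_partial symbol_quotient)
  have g0: "g x = 0" if "x \<in> U" "x $ l = 0" for x
    unfolding g_def
  proof (rule sum.neutral, rule ballI)
    fix j show "V j x * partial j f x = 0"
      using V0[OF that] partial_eq_0_tangential[OF U symbol_quotient that] by (cases "j = l") auto
  qed
  have eq: "(\<Sum>j\<in>UNIV. V j x * partial j (\<lambda>x. f x / of_real (x $ l)) x)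
     = g x / of_real (x $ l) + (- 1) * ((V l x / of_real (x $ l)) * (f x / of_real (x $ l)))" if x: "x \<in> half U l" for x
  proof -
    have xl: "x $ l > 0" and xU: "x \<in> U" using x by auto
    have p: "partial j (\<lambda>x. f x / of_real (x $ l)) x = partial j f x / of_real (x $ l)
       - (if j = l then f x / of_real (x $ l) ^ 2 else 0)" for j
      unfolding divide_inverse
      by (subst partial_mult[OF smooth_on_differentiable[OF symbol_quotient(1) xU] partial_inverse_nth(1)[OF xl]])
         (simp add: partial_inverse_nth(2)[OF xl] divide_inverse)
    have "(\<Sum>j\<in>UNIV. V j x * partial j (\<lambda>x. f x / of_real (x $ l)) x)
      = (\<Sum>j\<in>UNIV. V j x * partial j f x / of_real (x $ l) - (if j = l then V j x * (f x / of_real (x $ l) ^ 2) else 0))"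
      unfolding p by (rule sum.cong) (auto simp: right_diff_distrib)
    then show ?thesis
      by (simp add: sum_subtractf g_def sum_divide_distrib power2_eq_square)
  qed
  have "symbol U l (\<lambda>x. g x / of_real (x $ l) + (- 1) * ((V l x / of_real (x $ l)) * (f x / of_real (x $ l))))"
    using symbol.symbol_quotient[OF g g0] symbol.symbol_quotient[OF V V0] symbol.symbol_quotient[OF symbol_quotient]
    by (intro symbol_add symbol_mult symbol.symbol_smooth[OF smooth_on_const]) auto
  with eq show ?case by blast
next
  case (symbol_add f g)
  then obtain f' g' where *: "symbol U l f'" "\<forall>x\<in>half U l. (\<Sum>j\<in>UNIV. V j x * partial j f x) = f' x"
    "symbol U l g'" "\<forall>x\<in>half U l. (\<Sum>j\<in>UNIV. V j x * partial j g x) = g' x" by blast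
  have "(\<Sum>j\<in>UNIV. V j x * partial j (\<lambda>x. f x + g x) x) = f' x + g' x" if x: "x \<in> half U l" for x
  proof -
    have "partial j (\<lambda>x. f x + g x) x = partial j f x + partial j g x" for j
      by (rule partial_add; rule smooth_on_differentiable[OF symbol_smooth_on_half[OF U] x]) (rule symbol_add)+
    then show ?thesis using *(2,4) x by (simp add: distrib_left sum.distrib)
  qed
  with symbol.symbol_add[OF *(1,3)] show ?case by blast
next
  case (symbol_mult f g)
  then obtain f' g' where *: "symbol U l f'" "\<forall>x\<in>half U l. (\<Sum>j\<in>UNIV. V j x * partial j f x) = f' x"
    "symbol U l g'" "\<forall>x\<in>half U l. (\<Sum>j\<in>UNIV. V j x * partial j g x) = g' x" by blast
  have "(\<Sum>j\<in>UNIV. V j x * partial j (\<lambda>x. f x * g x) x) = f' x * g x + f x * g' x" if x: "x \<in> half U l" for x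
  proof -
    have "partial j (\<lambda>x. f x * g x) x = partial j f x * g x + f x * partial j g x" for j
      by (rule partial_mult; rule smooth_on_differentiable[OF symbol_smooth_on_half[OF U] x]) (rule symbol_mult)+
    then have "(\<Sum>j\<in>UNIV. V j x * partial j (\<lambda>x. f x * g x) x)
       = (\<Sum>j\<in>UNIV. V j x * partial j f x * g x + f x * (V j x * partial j g x))"
      by (simp add: algebra_simps)
    then show ?thesis using *(2,4) x by (simp add: sum.distrib sum_distrib_left[symmetric] sum_distrib_right[symmetric])
  qed
  moreover have "symbol U l (\<lambda>x. f' x * g x + f x * g' x)"
    by (intro symbol.symbol_add symbol.symbol_mult * symbol_mult)
  ultimately show ?case by blast
qed

context
  fixes U :: "(real^'n) set" and l :: "'n" and \<alpha> :: complex
  assumes U: "open U" and \<alpha>: "Re \<alpha> = 0"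
begin

lemma smooth_on_half_power_symbol:
  "symbol U l f \<Longrightarrow> smooth_on (half U l) (\<lambda>x. plus_power \<alpha> (x $ l) * f x)"
  by (intro smooth_on_mult smooth_on_plus_power symbol_smooth_on_half open_half U)

lemma loc_bounded_power_symbol:
  "symbol U l f \<Longrightarrow> loc_bounded U l (\<lambda>x. plus_power \<alpha> (x $ l) * f x)"
  by (rule loc_bounded_mono[OF symbol_loc_bounded[OF U]]) (auto simp: norm_mult norm_plus_power \<alpha>)

lemma integrable_power_symbol:
  assumes "symbol U l f" "test_function U \<psi>"
  shows "integrable lborel (\<lambda>x. plus_power \<alpha> (x $ l) * f x * \<psi> x)"
  by (rule integrable_half[OF U smooth_on_continuous[OF smooth_on_half_power_symbol] _ loc_bounded_power_symbol])
     (use assms in \<open>auto simp: plus_power_eq_0\<close>)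

lemma partial_power_symbol:
  assumes "symbol U l f" "x \<in> half U l"
  shows "partial j (\<lambda>x. plus_power \<alpha> (x $ l) * f x) x
    = plus_power \<alpha> (x $ l) * (partial j f x + (if j = l then \<alpha> * f x / of_real (x $ l) else 0))"
proof -
  have xl: "x $ l > 0" using assms by simp
  show ?thesis
    by (subst partial_mult[OF differentiableI[OF has_derivative_plus_power[OF xl]]
          smooth_on_differentiable[OF symbol_smooth_on_half[OF U assms(1)] assms(2)]])
       (auto simp: partial_eqI[OF has_derivative_plus_power[OF xl] refl] axis_def algebra_simps)
qed

text \<open>Along tangent fields no boundary term appears at the hyperplane: the distributional
  derivative is the pointwise one on the open half, extended by 0. Equality on the test functions of
  \<open>U\<close> can be iterated, because multiplying by a component of a field and
  differentiating leads from test functions to test functions.\<close>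

lemma iterated_vector_field_deriv:
  assumes "\<forall>V\<in>set Vs. tangent_field U l V" "symbol U l f"
  shows "\<exists>g. symbol U l g \<and> (\<forall>\<psi>. test_function U \<psi> \<longrightarrow>
    foldr vector_field_deriv Vs (distr_of (\<lambda>x. plus_power \<alpha> (x $ l) * f x)) \<psi> =
    distr_of (\<lambda>x. plus_power \<alpha> (x $ l) * g x) \<psi>)"
  using assms(1)
proof (induction Vs)
  case Nil
  then show ?case using assms(2) by auto
next
  case (Cons V Vs)
  define T where "T = foldr vector_field_deriv Vs (distr_of (\<lambda>x. plus_power \<alpha> (x $ l) * f x))"
  obtain g where g: "symbol U l g"
    "\<And>\<psi>. test_function U \<psi> \<Longrightarrow> T \<psi> = distr_of (\<lambda>x. plus_power \<alpha> (x $ l) * g x) \<psi>"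
    using Cons unfolding T_def by auto
  define W where "W j x = complex_of_real (V x $ j)" for j x
  have tV: "smooth_on U V" "\<And>x. x \<in> U \<Longrightarrow> x $ l = 0 \<Longrightarrow> V x $ l = 0"
    using Cons.prems by (auto simp: tangent_field_def)
  have W: "smooth_on U (W j)" for j
    unfolding W_def
    by (rule smooth_on_of_real[OF U smooth_on_bounded_linear[OF bounded_linear_vec_nth U tV(1)]])
  have W0: "W l x = 0" if "x \<in> U" "x $ l = 0" for x using tV(2)[OF that] by (simp add: W_def)
  obtain g' where g': "symbol U l g'" "\<And>x. x \<in> half U l \<Longrightarrow> (\<Sum>j\<in>UNIV. W j x * partial j g x) = g' x"
    using symbol_tangential_derivative[of U W l g, OF U W W0 g(1)] by blast
  \<comment> \<open>From V(x^\<alpha> g) = x^\<alpha> (V g + \<alpha> (V_l/x) g).\<close>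
  define k where "k x = g' x + \<alpha> * (W l x / of_real (x $ l) * g x)" for x
  have k: "symbol U l k"
    unfolding k_def using symbol_quotient[OF W W0]
    by (intro symbol_add symbol_mult symbol_smooth[OF smooth_on_const] g g') auto
  have "vector_field_deriv V T \<psi> = distr_of (\<lambda>x. plus_power \<alpha> (x $ l) * k x) \<psi>" if \<psi>: "test_function U \<psi>" for \<psi>
  proof -
    have "vector_field_deriv V T \<psi> = (\<Sum>j\<in>UNIV. - T (partial j (\<lambda>x. W j x * \<psi> x)))"
      by (simp add: vector_field_deriv_def distr_sum_def distr_mult_def distr_partial_def W_def)
    also have "\<dots> = (\<Sum>j\<in>UNIV. - (\<integral>x. plus_power \<alpha> (x $ l) * g x * partial j (\<lambda>x. W j x * \<psi> x) x \<partial>lborel))"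
      using g(2)[OF test_function_partial[OF test_function_mult[OF U W \<psi>]]] by (simp add: distr_of_def)
    also have "\<dots> = (\<integral>x. plus_power \<alpha> (x $ l) * k x * \<psi> x \<partial>lborel)"
    proof (rule tangential_derivative_half[where V = W and U = U and l = l, OF U smooth_on_half_power_symbol[OF g(1)] _ loc_bounded_power_symbol[OF g(1)] W W0])
      show "plus_power \<alpha> (x $ l) * k x = (\<Sum>j\<in>UNIV. W j x * partial j (\<lambda>x. plus_power \<alpha> (x $ l) * g x) x)"
        if x: "x \<in> half U l" for x
      proof -
        have "(\<Sum>j\<in>UNIV. W j x * partial j (\<lambda>x. plus_power \<alpha> (x $ l) * g x) x)
          = (\<Sum>j\<in>UNIV. plus_power \<alpha> (x $ l) * (W j x * partial j g x)
              + (if j = l then plus_power \<alpha> (x $ l) * (W l x * (\<alpha> * g x / of_real (x $ l))) else 0))"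
          unfolding partial_power_symbol[OF g(1) x] by (intro sum.cong) (auto simp: algebra_simps)
        also have "\<dots> = plus_power \<alpha> (x $ l) * g' x + plus_power \<alpha> (x $ l) * (W l x * (\<alpha> * g x / of_real (x $ l)))"
          using g'(2)[OF x] by (simp add: sum.distrib sum_distrib_left[symmetric])
        finally show ?thesis by (simp add: k_def algebra_simps)
      qed
    qed (auto simp: plus_power_eq_0 loc_bounded_power_symbol[OF k] \<psi>)
    finally show ?thesis by (simp add: distr_of_def)
  qed
  with k show ?case unfolding T_def by auto
qed

end

text \<open>Every order below minus half the dimension n would do; at order -n the weight is at most
  the product over the coordinates of 1/(1 + t^2), and each of these n factors is integrable on the
  line.\<close>

lemma integrable_sobolev_weight:
  "integrable lborel (\<lambda>\<xi>::real^'n. (1 + (norm \<xi>)\<^sup>2) powr (- real CARD('n)))"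
proof -
  define f where "f t = inverse (1 + t\<^sup>2)" for t :: real
  have fpos: "f t > 0" for t by (auto simp: f_def add_pos_nonneg)
  have fm [measurable]: "f \<in> borel_measurable borel" unfolding f_def by measurable
  have "integrable lborel f"
    using integrable_inverse_1_plus_square by (simp add: set_integrable_def f_def[abs_def])
  then have fin: "(\<integral>\<^sup>+t. ennreal (f t) \<partial>lborel) < \<infinity>"
    using fpos by (simp add: integrable_iff_bounded less_imp_le)
  have "(\<integral>\<^sup>+\<xi>. (\<Prod>b\<in>Basis. ennreal (f (\<xi> \<bullet> b))) \<partial>(lborel :: (real^'n) measure))
     = (\<Prod>b\<in>(Basis :: (real^'n) set). (\<integral>\<^sup>+t. ennreal (f t) \<partial>lborel))"
    using nn_integral_lborel_prod[of "\<lambda>(_ :: real^'n) t. ennreal (f t)"] by simp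
  also have "\<dots> < \<infinity>"
    using fin by (simp add: power_less_top_ennreal)
  finally have "integrable lborel (\<lambda>\<xi>::real^'n. \<Prod>b\<in>Basis. f (\<xi> \<bullet> b))"
    using fpos by (subst integrable_iff_bounded) (simp add: prod_ennreal less_imp_le abs_prod)
  then show ?thesis
  proof (rule Bochner_Integration.integrable_bound)
    have "(1 + (norm \<xi>)\<^sup>2) powr (- real CARD('n)) \<le> (\<Prod>b\<in>Basis. f (\<xi> \<bullet> b))" for \<xi> :: "real^'n"
    proof -
      have p: "1 + (norm \<xi>)\<^sup>2 > 0" by (auto intro: add_pos_nonneg)
      have "(1 + (norm \<xi>)\<^sup>2) powr (- real CARD('n)) = inverse (1 + (norm \<xi>)\<^sup>2) ^ CARD('n)"
        using p by (simp add: powr_minus powr_realpow power_inverse)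
      also have "\<dots> = (\<Prod>b\<in>(Basis :: (real^'n) set). inverse (1 + (norm \<xi>)\<^sup>2))" by simp
      also have "\<dots> \<le> (\<Prod>b\<in>Basis. f (\<xi> \<bullet> b))"
      proof (rule prod_mono)
        fix b :: "real^'n" assume "b \<in> Basis"
        then have "(\<xi> \<bullet> b)\<^sup>2 \<le> (norm \<xi>)\<^sup>2" by (metis Basis_le_norm abs_le_square_iff abs_norm_cancel)
        then show "0 \<le> inverse (1 + (norm \<xi>)\<^sup>2) \<and> inverse (1 + (norm \<xi>)\<^sup>2) \<le> f (\<xi> \<bullet> b)"
          using p unfolding f_def by (auto intro!: le_imp_inverse_le add_pos_nonneg)
      qed
      finally show ?thesis .
    qed
    then show "AE \<xi> in lborel. norm ((1 + (norm (\<xi>::real^'n))\<^sup>2) powr (- real CARD('n))) \<le> norm (\<Prod>b\<in>Basis. f (\<xi> \<bullet> b))"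
      by (auto intro!: always_eventually order_trans[OF _ abs_ge_self])
  qed simp
qed

lemma in_sobolev_loc_bounded:
  fixes F :: "real^'n \<Rightarrow> complex"
  assumes U: "open U" and int: "\<And>\<psi>. test_function U \<psi> \<Longrightarrow> integrable lborel (\<lambda>x. F x * \<psi> x)"
    and T: "\<And>\<psi>. test_function U \<psi> \<Longrightarrow> T \<psi> = distr_of F \<psi>"
  shows "in_sobolev_loc (- real CARD('n)) U T"
  unfolding in_sobolev_loc_def
proof (intro allI impI)
  fix c assume c: "test_function U c"
  define e where "e \<xi> x = exp (- \<i> * complex_of_real (\<xi> \<bullet> x))" for \<xi> x :: "real^'n"
  have ne: "norm (e \<xi> x) = 1" for \<xi> x by (simp add: e_def)
  have es: "smooth_on U (e \<xi>)" for \<xi>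
    unfolding e_def
    by (intro smooth_on_exp smooth_on_mult smooth_on_const smooth_on_of_real U smooth_on_linear bounded_linear_inner_right)
  have gi: "integrable lborel (\<lambda>x. F x * c x)" by (rule int[OF c])
  then have gm [measurable]: "(\<lambda>x. F x * c x) \<in> borel_measurable borel"
    by (simp add: borel_measurable_integrable)
  have Tc: "T (\<lambda>x. c x * e \<xi> x) = (\<integral>x. (F x * c x) * e \<xi> x \<partial>lborel)" for \<xi>
    using T[OF test_function_mult[OF U es c]] by (simp add: distr_of_def mult_ac)
  define M where "M = (\<integral>x. norm (F x * c x) \<partial>lborel)"
  have bd: "norm (T (\<lambda>x. c x * e \<xi> x)) \<le> M" for \<xi>
    unfolding Tc M_def using integral_norm_bound[of lborel "\<lambda>x. F x * c x * e \<xi> x"] by (simp add: norm_mult ne)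
  \<comment> \<open>Joint measurability of the integrand makes the Fourier transform measurable in
    \<xi>.\<close>
  have "(\<lambda>(\<xi>, x). (F x * c x) * e \<xi> x) \<in> borel_measurable (lborel \<Otimes>\<^sub>M lborel)"
    unfolding e_def by measurable
  then have m [measurable]: "(\<lambda>\<xi>. T (\<lambda>x. c x * e \<xi> x)) \<in> borel_measurable lborel"
    unfolding Tc by (rule lborel.borel_measurable_lebesgue_integral)
  show "integrable lborel (\<lambda>\<xi>. (1 + (norm \<xi>)\<^sup>2) powr (- real CARD('n)) *
    (cmod (T (\<lambda>x. c x * exp (- \<i> * complex_of_real (\<xi> \<bullet> x)))))\<^sup>2)"
    unfolding e_def[symmetric]
  proof (rule Bochner_Integration.integrable_bound[OF integrable_mult_left[OF integrable_sobolev_weight, of "M\<^sup>2"]])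
    show "(\<lambda>\<xi>. (1 + (norm \<xi>)\<^sup>2) powr (- real CARD('n)) * (cmod (T (\<lambda>x. c x * e \<xi> x)))\<^sup>2) \<in> borel_measurable lborel"
      by measurable
    show "AE \<xi> in lborel. norm ((1 + (norm (\<xi> :: real^'n))\<^sup>2) powr (- real CARD('n)) * (cmod (T (\<lambda>x. c x * e \<xi> x)))\<^sup>2)
       \<le> norm ((1 + (norm \<xi>)\<^sup>2) powr (- real CARD('n)) * M\<^sup>2)"
      by (auto intro!: always_eventually mult_left_mono power_mono bd)
  qed
qed

theorem conormal_plus_power:
  fixes v :: "real^'n \<Rightarrow> complex"
  assumes "open U" "Re \<alpha> = 0" "smooth_on U v"
  shows "conormal_rel (- real CARD('n)) U l (distr_of (\<lambda>x. plus_power \<alpha> (x $ l) * v x))"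
  unfolding conormal_rel_def
proof (intro allI impI)
  fix Vs :: "(real^'n \<Rightarrow> real^'n) list"
  assume "\<forall>V\<in>set Vs. tangent_field U l V"
  from iterated_vector_field_deriv[OF assms(1,2) this symbol_smooth[OF assms(3)]] obtain g where
    g: "symbol U l g" "\<And>\<psi>. test_function U \<psi> \<Longrightarrow>
      foldr vector_field_deriv Vs (distr_of (\<lambda>x. plus_power \<alpha> (x $ l) * v x)) \<psi> =
      distr_of (\<lambda>x. plus_power \<alpha> (x $ l) * g x) \<psi>" by blast
  show "in_sobolev_loc (- real CARD('n)) U (foldr vector_field_deriv Vs (distr_of (\<lambda>x. plus_power \<alpha> (x $ l) * v x)))"
    by (rule in_sobolev_loc_bounded[OF assms(1) integrable_power_symbol[OF assms(1,2) g(1)] g(2)])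
qed

section \<open>Linear algebra in dimension four\<close>

lemma vector_4 [simp]:
  "(vector [x, y, z, w] :: 'a::zero^4) $ 1 = x"
  "(vector [x, y, z, w] :: 'a::zero^4) $ 2 = y"
  "(vector [x, y, z, w] :: 'a::zero^4) $ 3 = z"
  "(vector [x, y, z, w] :: 'a::zero^4) $ 4 = w"
  unfolding vector_def by simp_all

lemma axis_4 [simp]:
  "axis 1 c $ (1::4) = c" "axis 1 c $ (2::4) = 0" "axis 1 c $ (3::4) = 0" "axis 1 c $ (4::4) = 0"
  "axis 2 c $ (1::4) = 0" "axis 2 c $ (2::4) = c" "axis 2 c $ (3::4) = 0" "axis 2 c $ (4::4) = 0"
  "axis 3 c $ (1::4) = 0" "axis 3 c $ (2::4) = 0" "axis 3 c $ (3::4) = c" "axis 3 c $ (4::4) = 0"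
  "axis 4 c $ (1::4) = 0" "axis 4 c $ (2::4) = 0" "axis 4 c $ (3::4) = 0" "axis 4 c $ (4::4) = c"
  by (simp_all add: axis_def)

lemma det_4:
  "det (A::'a::comm_ring_1^4^4) =
    A$1$1 * (A$2$2 * (A$3$3 * A$4$4 - A$3$4 * A$4$3) - A$2$3 * (A$3$2 * A$4$4 - A$3$4 * A$4$2) + A$2$4 * (A$3$2 * A$4$3 - A$3$3 * A$4$2))
  - A$1$2 * (A$2$1 * (A$3$3 * A$4$4 - A$3$4 * A$4$3) - A$2$3 * (A$3$1 * A$4$4 - A$3$4 * A$4$1) + A$2$4 * (A$3$1 * A$4$3 - A$3$3 * A$4$1))
  + A$1$3 * (A$2$1 * (A$3$2 * A$4$4 - A$3$4 * A$4$2) - A$2$2 * (A$3$1 * A$4$4 - A$3$4 * A$4$1) + A$2$4 * (A$3$1 * A$4$2 - A$3$2 * A$4$1))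
  - A$1$4 * (A$2$1 * (A$3$2 * A$4$3 - A$3$3 * A$4$2) - A$2$2 * (A$3$1 * A$4$3 - A$3$3 * A$4$1) + A$2$3 * (A$3$1 * A$4$2 - A$3$2 * A$4$1))"
proof -
  have f1: "finite {2::4, 3, 4}" "1 \<notin> {2::4, 3, 4}"
    and f2: "finite {3::4, 4}" "2 \<notin> {3::4, 4}"
    and f3: "finite {4::4}" "3 \<notin> {4::4}" by auto
  show ?thesis
    unfolding det_def UNIV_4
    unfolding sum_over_permutations_insert[OF f1]
    unfolding sum_over_permutations_insert[OF f2]
    unfolding sum_over_permutations_insert[OF f3]
    unfolding permutes_sing
    by (simp add: sign_swap_id permutation_swap_id sign_compose sign_id swap_id_eq permutation_compose)
      (simp add: algebra_simps)
qed

lemma matrix_inv_eqI: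
  fixes A B :: "real^'n^'n"
  assumes "A ** B = mat 1"
  shows "matrix_inv A = B"
proof -
  have BA: "B ** A = mat 1" using assms matrix_left_right_inverse by blast
  have "\<exists>A'. A ** A' = mat 1 \<and> A' ** A = mat 1" using assms BA by blast
  then have "A ** matrix_inv A = mat 1 \<and> matrix_inv A ** A = mat 1"
    unfolding matrix_inv_def by (rule someI_ex)
  then show ?thesis
    by (metis BA matrix_mul_assoc matrix_mul_lid matrix_mul_rid)
qed

lemma tendsto_det:
  fixes A :: "'a \<Rightarrow> real^'n^'n"
  assumes "\<And>i j. ((\<lambda>x. A x $ i $ j) \<longlongrightarrow> B $ i $ j) F"
  shows "((\<lambda>x. det (A x)) \<longlongrightarrow> det B) F"
  unfolding det_def by (intro tendsto_intros assms)

text \<open>In the application the matrices \<open>G\<close> are the metric at regular points and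
  the matrices \<open>A\<close> their inverses, which are the ones known to converge. Cramer's rule,
  written as \<open>M\<close>, makes inversion continuous where the limit is nonsingular.\<close>

lemma tendsto_inverse_matrix:
  fixes A G :: "'a \<Rightarrow> real^'n^'n"
  assumes lim: "\<And>i j. ((\<lambda>x. A x $ i $ j) \<longlongrightarrow> B $ i $ j) F"
    and inv: "\<forall>\<^sub>F x in F. G x ** A x = mat 1" and B: "det B \<noteq> 0"
  shows "(G \<longlongrightarrow> matrix_inv B) F"
proof -
  define M where "M A = (\<chi> k j. det (\<chi> i l. if l = k then axis j 1 $ i else A $ i $ l) / det A)" for A :: "real^'n^'n"
  have cram: "A ** M A = mat 1" if "det A \<noteq> 0" for A :: "real^'n^'n"
  proof -
    have "A *v (\<chi> k. M A $ k $ j) = axis j 1" for j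
      unfolding cramer[OF that] M_def by (simp add: vec_eq_iff)
    then have "(A ** M A) $ i $ j = (mat 1 :: real^'n^'n) $ i $ j" for i j
      by (simp add: matrix_matrix_mult_def matrix_vector_mult_def vec_eq_iff mat_def axis_def)
    then show ?thesis by (simp add: vec_eq_iff)
  qed
  have 1: "((\<lambda>x. M (A x)) \<longlongrightarrow> M B) F"
    unfolding M_def
    by (intro tendsto_vec_lambda tendsto_divide tendsto_det lim B)
       (simp add: lim tendsto_const)
  have 2: "M B = matrix_inv B" using matrix_inv_eqI[OF cram[OF B]] by simp
  have 3: "\<forall>\<^sub>F x in F. M (A x) = G x"
    using inv
  proof (rule eventually_mono)
    fix x assume *: "G x ** A x = mat 1"
    then have "det (G x) * det (A x) = 1" by (metis det_I det_mul)
    then have "A x ** M (A x) = mat 1" by (intro cram) auto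
    then show "M (A x) = G x" using * by (metis matrix_mul_assoc matrix_mul_lid matrix_mul_rid)
  qed
  show ?thesis using Lim_transform_eventually[OF 1[unfolded 2] 3] .
qed


section \<open>The Kerr metric and its inverse in regular coordinates\<close>

text \<open>The conformal factor of the round metric in stereographic coordinates;
  \<open>sin_sq\<close> is sin^2 \<theta> and \<open>rho_sq\<close> is \<rho>^2. They are rational
  in the chart coordinates, hence smooth at the pole, and have the same form in both charts.\<close>

definition sphere_factor :: "real^4 \<Rightarrow> real" where
  "sphere_factor X = 4 / (1 + (X $ 3)\<^sup>2 + (X $ 4)\<^sup>2)\<^sup>2"

definition sin_sq :: "real^4 \<Rightarrow> real" where
  "sin_sq X = sphere_factor X * ((X $ 3)\<^sup>2 + (X $ 4)\<^sup>2)"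

definition rho_sq :: "real \<Rightarrow> real \<Rightarrow> real^4 \<Rightarrow> real" where
  "rho_sq a r X = r\<^sup>2 + a\<^sup>2 * (1 - sin_sq X)"

lemma sphere_factor_pos: "sphere_factor X > 0"
  unfolding sphere_factor_def by (intro divide_pos_pos zero_less_power add_pos_nonneg) auto

lemma sin_sq_le_1: "sin_sq X \<le> 1"
proof -
  define n where "n = (X $ 3)\<^sup>2 + (X $ 4)\<^sup>2"
  have n: "n \<ge> 0" by (simp add: n_def)
  have "(1 + n)\<^sup>2 - 4 * n = (1 - n)\<^sup>2" by (simp add: power2_eq_square algebra_simps)
  then have "4 * n \<le> (1 + n)\<^sup>2" by (metis diff_ge_0_iff_ge zero_le_power2)
  then have "4 * n / (1 + n)\<^sup>2 \<le> 1" using n by (subst pos_divide_le_eq) auto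
  then show ?thesis by (simp add: sin_sq_def sphere_factor_def n_def add.assoc)
qed

lemma rho_sq_pos: "r > 0 \<Longrightarrow> rho_sq a r X > 0"
  unfolding rho_sq_def using sin_sq_le_1[of X] by (intro add_pos_nonneg mult_nonneg_nonneg) auto

text \<open>In ingoing coordinates the metric is \<open>c \<beta>\<^sup>2 + 2 \<beta> (dr - a N) + \<rho>\<^sup>2 s (dx\<^sup>2 + dy\<^sup>2)\<close> with
  \<open>c = 2mr/\<rho>\<^sup>2 - 1\<close>, \<open>s (dx\<^sup>2 + dy\<^sup>2)\<close> the round metric, \<open>N = sin\<^sup>2\<theta> d\<phi> = s (x dy - y dx)\<close> and
  \<open>\<beta> = dt\<^sub>* - a N\<close>. It has the same form in both charts of the sphere.\<close>

definition beta :: "real \<Rightarrow> real^4 \<Rightarrow> real^4 \<Rightarrow> real" where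
  "beta a X v = v $ 1 - a * sphere_factor X * (X $ 3 * v $ 4 - X $ 4 * v $ 3)"

definition gammaf :: "real \<Rightarrow> real^4 \<Rightarrow> real^4 \<Rightarrow> real" where
  "gammaf a X v = v $ 2 - a * sphere_factor X * (X $ 3 * v $ 4 - X $ 4 * v $ 3)"

definition ingoing_form :: "real \<Rightarrow> real \<Rightarrow> real \<Rightarrow> real^4 \<Rightarrow> real^4 \<Rightarrow> real^4 \<Rightarrow> real" where
  "ingoing_form m a r X v w = (2 * m * r / rho_sq a r X - 1) * beta a X v * beta a X w
     + beta a X v * gammaf a X w + gammaf a X v * beta a X w
     + rho_sq a r X * sphere_factor X * (v $ 3 * w $ 3 + v $ 4 * w $ 4)"

text \<open>The primed vectors are the images in Boyer-Lindquist coordinates of vectors given in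
  ingoing stereographic ones. Of their \<theta>-components only the product is prescribed, so that
  the opposite signs of d\<theta> in the two charts of the sphere are both covered.\<close>

lemma kerr_metric_ingoing_form:
  assumes r: "q $ 2 = r" and s: "(sin (q $ 4))\<^sup>2 = sin_sq X"
    and \<mu>: "mu m a r \<noteq> 0" and \<rho>: "rho_sq a r X \<noteq> 0" and n0: "(X $ 3)\<^sup>2 + (X $ 4)\<^sup>2 \<noteq> 0"
    and v: "v' $ 1 = v $ 1 - (r\<^sup>2 + a\<^sup>2) / mu m a r * v $ 2" "v' $ 2 = v $ 2"
      "v' $ 3 = (X $ 3 * v $ 4 - X $ 4 * v $ 3) / ((X $ 3)\<^sup>2 + (X $ 4)\<^sup>2) - a / mu m a r * v $ 2"
    and w: "w' $ 1 = w $ 1 - (r\<^sup>2 + a\<^sup>2) / mu m a r * w $ 2" "w' $ 2 = w $ 2"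
      "w' $ 3 = (X $ 3 * w $ 4 - X $ 4 * w $ 3) / ((X $ 3)\<^sup>2 + (X $ 4)\<^sup>2) - a / mu m a r * w $ 2"
    and vw: "v' $ 4 * w' $ 4 = sphere_factor X * ((X $ 3 * v $ 3 + X $ 4 * v $ 4) * (X $ 3 * w $ 3 + X $ 4 * w $ 4)) / ((X $ 3)\<^sup>2 + (X $ 4)\<^sup>2)"
  shows "kerr_metric m a q v' w' = ingoing_form m a r X v w"
proof -
  define n where "n = (X $ 3)\<^sup>2 + (X $ 4)\<^sup>2"
  define E where "E = (X $ 3 * v $ 4 - X $ 4 * v $ 3) / n"
  define E' where "E' = (X $ 3 * w $ 4 - X $ 4 * w $ 3) / n"
  define B where "B = beta a X v"
  define B' where "B' = beta a X w"
  define S where "S = sin_sq X"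
  define R where "R = rho_sq a r X"
  define M where "M = mu m a r"
  have nE: "X $ 3 * v $ 4 - X $ 4 * v $ 3 = n * E" "X $ 3 * w $ 4 - X $ 4 * w $ 3 = n * E'"
    using n0 by (auto simp: E_def E'_def n_def)
  have Sn: "S = sphere_factor X * n" by (simp add: S_def n_def sin_sq_def)
  have N: "sphere_factor X * (X $ 3 * v $ 4 - X $ 4 * v $ 3) = S * E"
    "sphere_factor X * (X $ 3 * w $ 4 - X $ 4 * w $ 3) = S * E'"
    unfolding nE Sn by simp_all
  have v1: "v $ 1 = B + a * (S * E)" "w $ 1 = B' + a * (S * E')"
    unfolding B_def B'_def beta_def N[symmetric] by (simp_all add: mult.assoc)
  have g: "gammaf a X v = v $ 2 - a * (S * E)" "gammaf a X w = w $ 2 - a * (S * E')"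
    unfolding gammaf_def N[symmetric] by (simp_all add: mult.assoc)
  have fR: "r\<^sup>2 + a\<^sup>2 = R + a\<^sup>2 * S" by (simp add: R_def rho_sq_def S_def algebra_simps)
  have rM: "2 * m * r = R + a\<^sup>2 * S - M" by (simp add: M_def mu_def fR[symmetric])
  have nz: "M \<noteq> 0" "R \<noteq> 0" using \<mu> \<rho> by (auto simp: M_def R_def)
  have "(X $ 3 * v $ 3 + X $ 4 * v $ 4) * (X $ 3 * w $ 3 + X $ 4 * w $ 4)
      + (X $ 3 * v $ 4 - X $ 4 * v $ 3) * (X $ 3 * w $ 4 - X $ 4 * w $ 3)
     = n * (v $ 3 * w $ 3 + v $ 4 * w $ 4)"
    unfolding n_def by (simp add: power2_eq_square algebra_simps)
  then have xi: "(X $ 3 * v $ 3 + X $ 4 * v $ 4) * (X $ 3 * w $ 3 + X $ 4 * w $ 4)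
     = n * (v $ 3 * w $ 3 + v $ 4 * w $ 4) - n * E * (n * E')" unfolding nE by simp
  have vw': "v' $ 4 * w' $ 4 = sphere_factor X * (v $ 3 * w $ 3 + v $ 4 * w $ 4) - S * E * E'"
    unfolding vw xi n_def[symmetric] Sn using n0 by (simp add: n_def[symmetric] field_simps)
  have cos: "(cos (q $ 4))\<^sup>2 = 1 - S" using s by (simp add: cos_squared_eq S_def)
  have \<rho>': "r\<^sup>2 + a\<^sup>2 * (cos (q $ 4))\<^sup>2 = R" by (simp add: cos R_def rho_sq_def S_def)
  \<comment> \<open>The two one-forms of the metric, evaluated in terms of \<beta>, dr and the
    angle. In the first the poles at \<mu> = 0 cancel; the pole left in the second cancels in the
    last step against \<rho>^2 dr^2 / \<mu>.\<close>
  have e1: "a * v' $ 1 - (r\<^sup>2 + a\<^sup>2) * v' $ 3 = a * B - R * E"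
    "a * w' $ 1 - (r\<^sup>2 + a\<^sup>2) * w' $ 3 = a * B' - R * E'"
    unfolding v w v1 n_def[symmetric] E_def[symmetric] E'_def[symmetric] M_def[symmetric] fR
    using nz by (simp_all add: field_simps power2_eq_square)
  have e2: "v' $ 1 - a * S * v' $ 3 = B - R / M * v $ 2" "w' $ 1 - a * S * w' $ 3 = B' - R / M * w $ 2"
    unfolding v w v1 n_def[symmetric] E_def[symmetric] E'_def[symmetric] M_def[symmetric] fR
    using nz by (simp_all add: field_simps power2_eq_square)
  have "kerr_metric m a q v' w' = R * (v $ 2 * w $ 2 / M + v' $ 4 * w' $ 4)
      + S / R * (a * B - R * E) * (a * B' - R * E')
      - M / R * (B - R / M * v $ 2) * (B' - R / M * w $ 2)"
    unfolding kerr_metric_def Let_def r s S_def[symmetric] \<rho>' e1 e2 M_def[symmetric] v(2) w(2) ..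
  also have "\<dots> = ingoing_form m a r X v w"
    unfolding ingoing_form_def B_def[symmetric] B'_def[symmetric] R_def[symmetric] g rM vw'
    using nz by (simp add: field_simps power2_eq_square)
  finally show ?thesis .
qed

definition ingoing_metric :: "real \<Rightarrow> real \<Rightarrow> real \<Rightarrow> real^4 \<Rightarrow> real^4^4" where
  "ingoing_metric m a r X = (\<chi> i j. ingoing_form m a r X (axis i 1) (axis j 1))"

definition ingoing_inverse :: "real \<Rightarrow> real \<Rightarrow> real \<Rightarrow> real^4 \<Rightarrow> real^4^4" where
  "ingoing_inverse m a r X = (\<chi> i j. 1 / rho_sq a r X * (vector [
     vector [a\<^sup>2 * sin_sq X, r\<^sup>2 + a\<^sup>2, - (a * X $ 4), a * X $ 3],
     vector [r\<^sup>2 + a\<^sup>2, mu m a r, - (a * X $ 4), a * X $ 3],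
     vector [- (a * X $ 4), - (a * X $ 4), 1 / sphere_factor X, 0],
     vector [a * X $ 3, a * X $ 3, 0, 1 / sphere_factor X]] :: real^4^4) $ i $ j)"

lemma ingoing_metric_inverse:
  assumes "rho_sq a r X \<noteq> 0"
  shows "ingoing_metric m a r X ** ingoing_inverse m a r X = mat 1"
proof -
  define s where "s = sphere_factor X"
  define R where "R = rho_sq a r X"
  define S where "S = sin_sq X"
  have s: "s \<noteq> 0" using sphere_factor_pos[of X] by (simp add: s_def)
  have R: "R \<noteq> 0" using assms by (simp add: R_def)
  have S: "S = s * ((X $ 3)\<^sup>2 + (X $ 4)\<^sup>2)" by (simp add: S_def s_def sin_sq_def)
  have f: "r\<^sup>2 + a\<^sup>2 = R + a\<^sup>2 * S" by (simp add: R_def rho_sq_def S_def algebra_simps)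
  have M: "mu m a r = R + a\<^sup>2 * S - 2 * m * r" by (simp add: mu_def f[symmetric])
  show ?thesis
    unfolding ingoing_metric_def ingoing_inverse_def ingoing_form_def M f R_def[symmetric] S_def[symmetric]
      s_def[symmetric] beta_def gammaf_def
    unfolding S using R s
    by (simp add: vec_eq_iff forall_4 matrix_matrix_mult_def sum_4 mat_def)
       (simp add: field_simps power2_eq_square)
qed

lemma det_ingoing_metric:
  "det (ingoing_metric m a r X) = - (rho_sq a r X * sphere_factor X)\<^sup>2"
  unfolding det_4 ingoing_metric_def ingoing_form_def beta_def gammaf_def
  by simp (simp add: algebra_simps power2_eq_square)

text \<open>The differential of the passage to ingoing coordinates, with \<open>p'\<close> the
  derivative of p(r) = x_1 x_2. There z becomes e^{i\<omega> t_*} z; as the metric is invariant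
  under rotations, this factor is turned back after differentiation, which leaves dz + i\<omega> z
  dt_* in the last two rows.\<close>

definition kruskal_jacobian :: "real \<Rightarrow> real \<Rightarrow> real \<Rightarrow> real^4 \<Rightarrow> real^4^4" where
  "kruskal_jacobian \<kappa> \<omega> p' X = vector [
     vector [1 / (\<kappa> * X $ 1), 0, 0, 0],
     vector [X $ 2 / p', X $ 1 / p', 0, 0],
     vector [- (\<omega> * X $ 4) / (\<kappa> * X $ 1), 0, 1, 0],
     vector [\<omega> * X $ 3 / (\<kappa> * X $ 1), 0, 0, 1]]"

text \<open>The inverse metric is \<open>\<rho>\<^sup>-\<^sup>2\<close> times
  \<open>2 \<kappa> (r\<^sup>2 + a\<^sup>2) p' \<partial>\<^sub>1 \<partial>\<^sub>2 + 2 x\<^sub>2 q p' \<partial>\<^sub>2 R + s\<^sup>-\<^sup>1 (\<partial>\<^sub>3\<^sup>2 + \<partial>\<^sub>4\<^sup>2) + 2 a T R + a\<^sup>2 sin\<^sup>2\<theta> T\<^sup>2\<close>,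
  where \<open>R = x\<^sub>3 \<partial>\<^sub>4 - x\<^sub>4 \<partial>\<^sub>3\<close> is the rotation field and \<open>T = \<kappa> (x\<^sub>1 \<partial>\<^sub>1 - x\<^sub>2 \<partial>\<^sub>2) - \<omega> R\<close> is \<open>\<partial>\<^sub>t\<close>;
  \<open>p\<close> is the product \<open>x\<^sub>1 x\<^sub>2\<close> as a function of \<open>r\<close>, and \<open>q p = a - \<omega> (r\<^sup>2 + a\<^sup>2)\<close>. The singular
  coefficient of \<open>\<partial>\<^sub>2\<^sup>2\<close> cancels because of \<open>\<mu> p' = 2 \<kappa> (r\<^sup>2 + a\<^sup>2) p\<close>.\<close>

definition kruskal_inverse :: "real \<Rightarrow> real \<Rightarrow> real \<Rightarrow> real \<Rightarrow> real \<Rightarrow> real \<Rightarrow> real^4 \<Rightarrow> real^4^4" where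
  "kruskal_inverse a \<kappa> \<omega> r p' q X =
    (let S = sin_sq X; f = r\<^sup>2 + a\<^sup>2; b = a - a\<^sup>2 * S * \<omega>; d = a\<^sup>2 * S * \<omega>\<^sup>2 - 2 * a * \<omega>;
         e = X $ 2 * q * p' - \<kappa> * X $ 2 * b; s = sphere_factor X
     in (\<chi> i j. 1 / rho_sq a r X * (vector [
     vector [a\<^sup>2 * S * \<kappa>\<^sup>2 * (X $ 1)\<^sup>2, \<kappa> * f * p' - a\<^sup>2 * S * \<kappa>\<^sup>2 * X $ 1 * X $ 2, - (X $ 4 * \<kappa> * X $ 1 * b), X $ 3 * \<kappa> * X $ 1 * b],
     vector [\<kappa> * f * p' - a\<^sup>2 * S * \<kappa>\<^sup>2 * X $ 1 * X $ 2, a\<^sup>2 * S * \<kappa>\<^sup>2 * (X $ 2)\<^sup>2, - (X $ 4 * e), X $ 3 * e],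
     vector [- (X $ 4 * \<kappa> * X $ 1 * b), - (X $ 4 * e), 1 / s + (X $ 4)\<^sup>2 * d, - (X $ 3 * X $ 4 * d)],
     vector [X $ 3 * \<kappa> * X $ 1 * b, X $ 3 * e, - (X $ 3 * X $ 4 * d), 1 / s + (X $ 3)\<^sup>2 * d]] :: real^4^4) $ i $ j))"

text \<open>Inverse metrics push forward, so the regular matrix is checked by mapping it to the
  ingoing one. The Jacobian is singular at x_1 = 0 only; the future horizon x_2 = 0 is
  covered.\<close>

lemma kruskal_inverse_transform:
  assumes "X $ 1 \<noteq> 0" "\<kappa> \<noteq> 0" "p' \<noteq> 0"
    and \<mu>: "mu m a r * p' = 2 * \<kappa> * (r\<^sup>2 + a\<^sup>2) * (X $ 1 * X $ 2)"
    and q: "q * (X $ 1 * X $ 2) = a - \<omega> * (r\<^sup>2 + a\<^sup>2)"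
  shows "kruskal_jacobian \<kappa> \<omega> p' X ** kruskal_inverse a \<kappa> \<omega> r p' q X ** transpose (kruskal_jacobian \<kappa> \<omega> p' X)
    = ingoing_inverse m a r X"
proof -
  define R where "R = 1 / rho_sq a r X"
  define S where "S = sin_sq X"
  define f where "f = r\<^sup>2 + a\<^sup>2"
  define si where "si = 1 / sphere_factor X"
  define x where "x = X $ 1"
  define y where "y = X $ 2"
  define z where "z = X $ 3"
  define w where "w = X $ 4"
  note nz = assms(1-3)[folded x_def]
  have M: "mu m a r = 2 * \<kappa> * f * (x * y) / p'" using \<mu> nz by (simp add: f_def x_def y_def field_simps)
  \<comment> \<open>Substituting for \<mu>, clearing the denominators and then substituting for
    \<open>a\<close> turns each of the sixteen entries into a polynomial identity, with
    \<open>f\<close> as an independent symbol.\<close>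
  have a: "a = q * (x * y) + \<omega> * f" using q by (simp add: f_def x_def y_def)
  define K :: "real^4^4" where "K = vector [
     vector [a\<^sup>2 * S * \<kappa>\<^sup>2 * x\<^sup>2, \<kappa> * f * p' - a\<^sup>2 * S * \<kappa>\<^sup>2 * x * y, - (w * \<kappa> * x * (a - a\<^sup>2 * S * \<omega>)), z * \<kappa> * x * (a - a\<^sup>2 * S * \<omega>)],
     vector [\<kappa> * f * p' - a\<^sup>2 * S * \<kappa>\<^sup>2 * x * y, a\<^sup>2 * S * \<kappa>\<^sup>2 * y\<^sup>2, - (w * (y * q * p' - \<kappa> * y * (a - a\<^sup>2 * S * \<omega>))), z * (y * q * p' - \<kappa> * y * (a - a\<^sup>2 * S * \<omega>))],
     vector [- (w * \<kappa> * x * (a - a\<^sup>2 * S * \<omega>)), - (w * (y * q * p' - \<kappa> * y * (a - a\<^sup>2 * S * \<omega>))), si + w\<^sup>2 * (a\<^sup>2 * S * \<omega>\<^sup>2 - 2 * a * \<omega>), - (z * w * (a\<^sup>2 * S * \<omega>\<^sup>2 - 2 * a * \<omega>))],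
     vector [z * \<kappa> * x * (a - a\<^sup>2 * S * \<omega>), z * (y * q * p' - \<kappa> * y * (a - a\<^sup>2 * S * \<omega>)), - (z * w * (a\<^sup>2 * S * \<omega>\<^sup>2 - 2 * a * \<omega>)), si + z\<^sup>2 * (a\<^sup>2 * S * \<omega>\<^sup>2 - 2 * a * \<omega>)]]"
  define I :: "real^4^4" where "I = vector [
     vector [a\<^sup>2 * S, f, - (a * w), a * z],
     vector [f, 2 * \<kappa> * f * (x * y) / p', - (a * w), a * z],
     vector [- (a * w), - (a * w), si, 0],
     vector [a * z, a * z, 0, si]]"
  define L :: "real^4^4" where "L = vector [
     vector [1 / (\<kappa> * x), 0, 0, 0],
     vector [y / p', x / p', 0, 0],
     vector [- (\<omega> * w) / (\<kappa> * x), 0, 1, 0],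
     vector [\<omega> * z / (\<kappa> * x), 0, 0, 1]]"
  have main: "(L ** K ** transpose L) $ i $ j = I $ i $ j" for i j
  proof -
    have "\<forall>i j. (L ** K ** transpose L) $ i $ j = I $ i $ j"
      unfolding L_def K_def I_def using nz
      by (simp add: forall_4 matrix_matrix_mult_def transpose_def sum_4)
         (intro conjI; simp add: field_simps power2_eq_square; simp add: a algebra_simps)
    then show ?thesis by blast
  qed
  have k1: "kruskal_inverse a \<kappa> \<omega> r p' q X = (\<chi> i j. R * K $ i $ j)"
    unfolding kruskal_inverse_def K_def Let_def R_def S_def f_def si_def x_def y_def z_def w_def ..
  have k2: "ingoing_inverse m a r X = (\<chi> i j. R * I $ i $ j)"
    unfolding ingoing_inverse_def I_def M R_def S_def f_def[symmetric] si_def x_def y_def z_def w_def ..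
  have k3: "kruskal_jacobian \<kappa> \<omega> p' X = L"
    unfolding kruskal_jacobian_def L_def x_def y_def z_def w_def ..
  have k4: "(L ** (\<chi> i j. R * K $ i $ j) ** transpose L) $ i $ j = R * (L ** K ** transpose L) $ i $ j" for i j
    by (simp add: matrix_matrix_mult_def sum_distrib_left sum_distrib_right mult_ac)
  show ?thesis unfolding k1 k2 k3 by (simp add: vec_eq_iff k4 main)
qed

lemma det_kruskal_jacobian: "det (kruskal_jacobian \<kappa> \<omega> p' X) = (1 / (\<kappa> * X $ 1)) * (X $ 1 / p')"
  unfolding det_4 kruskal_jacobian_def by simp

text \<open>From G (L H L^T) = 1 the identity (L^T G L) H = 1 follows by multiplying with L^T on the
  left and cancelling it on the right; multiplicativity then gives the determinant.\<close>

lemma kruskal_metric_inverse: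
  assumes "X $ 1 \<noteq> 0" "\<kappa> \<noteq> 0" "p' \<noteq> 0" "rho_sq a r X \<noteq> 0"
    and "mu m a r * p' = 2 * \<kappa> * (r\<^sup>2 + a\<^sup>2) * (X $ 1 * X $ 2)"
    and "q * (X $ 1 * X $ 2) = a - \<omega> * (r\<^sup>2 + a\<^sup>2)"
  shows "transpose (kruskal_jacobian \<kappa> \<omega> p' X) ** ingoing_metric m a r X ** kruskal_jacobian \<kappa> \<omega> p' X
      ** kruskal_inverse a \<kappa> \<omega> r p' q X = mat 1" (is "?G ** ?H = _")
    and "det (kruskal_inverse a \<kappa> \<omega> r p' q X) = - (\<kappa> * p' / (rho_sq a r X * sphere_factor X))\<^sup>2"
proof -
  define L where "L = kruskal_jacobian \<kappa> \<omega> p' X"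
  define G where "G = ingoing_metric m a r X"
  define H where "H = kruskal_inverse a \<kappa> \<omega> r p' q X"
  have dL: "det L = 1 / (\<kappa> * p')" using assms by (simp add: L_def det_kruskal_jacobian)
  then have "det (transpose L) \<noteq> 0" using assms by (simp add: det_transpose)
  then obtain N where N: "transpose L ** N = mat 1" "N ** transpose L = mat 1"
    by (metis invertible_def invertible_det_nz)
  have GLH: "G ** (L ** H ** transpose L) = mat 1"
    unfolding G_def L_def H_def kruskal_inverse_transform[OF assms(1-3,5,6)]
    by (rule ingoing_metric_inverse[OF assms(4)])
  have "(transpose L ** G ** L ** H) ** transpose L = transpose L ** (G ** (L ** H ** transpose L))"
    by (simp add: matrix_mul_assoc)
  also have "\<dots> = transpose L" by (simp add: GLH)
  finally have "(transpose L ** G ** L ** H) ** transpose L ** N = transpose L ** N" by simp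
  then show 1: "?G ** ?H = mat 1"
    by (simp add: N matrix_mul_assoc[symmetric] L_def[symmetric] G_def[symmetric] H_def[symmetric])
  have "det (transpose L) * det G * det L * det H = 1"
    using arg_cong[OF 1, of det] by (simp add: det_mul L_def G_def H_def)
  then have "(1 / (\<kappa> * p'))\<^sup>2 * det G * det H = 1"
    unfolding det_transpose dL power2_eq_square by (simp only: mult_ac)
  then show "det ?H = - (\<kappa> * p' / (rho_sq a r X * sphere_factor X))\<^sup>2"
  proof -
    assume "(1 / (\<kappa> * p'))\<^sup>2 * det G * det H = 1"
    then have *: "(1 / (\<kappa> * p'))\<^sup>2 * (- (rho_sq a r X * sphere_factor X)\<^sup>2) * det H = 1"
      by (simp add: G_def det_ingoing_metric)
    have "h = - (u / w)\<^sup>2" if "(1 / u)\<^sup>2 * (- w\<^sup>2) * h = 1" "u \<noteq> 0" "w \<noteq> 0" for u w h :: real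
      using that by (simp add: field_simps)
    from this[OF *] show ?thesis
      using assms sphere_factor_pos[of X] by (simp add: H_def)
  qed
qed

text \<open>At x_1 = 0 the Jacobian breaks down and the determinant is computed from the entries:
  the first row and column vanish except for the pairing of x_1 with x_2. Nonsingularity here is
  what carries the metric over the past horizon and the bifurcate sphere.\<close>

lemma det_kruskal_inverse_past_horizon:
  assumes "X $ 1 = 0" "rho_sq a r X \<noteq> 0" "r\<^sup>2 + a\<^sup>2 \<noteq> 0" "a = \<omega> * (r\<^sup>2 + a\<^sup>2)"
  shows "det (kruskal_inverse a \<kappa> \<omega> r p' q X) = - (\<kappa> * p' / (rho_sq a r X * sphere_factor X))\<^sup>2"
proof -
  define S where "S = sin_sq X"
  define f where "f = r\<^sup>2 + a\<^sup>2"
  define s where "s = sphere_factor X"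
  define R where "R = rho_sq a r X"
  have s: "s \<noteq> 0" using sphere_factor_pos[of X] by (simp add: s_def)
  have S: "S = s * ((X $ 3)\<^sup>2 + (X $ 4)\<^sup>2)" by (simp add: S_def s_def sin_sq_def)
  have a: "a = \<omega> * f" using assms by (simp add: f_def)
  have f: "f \<noteq> 0" using assms by (simp add: f_def)
  \<comment> \<open>Since a = \<omega> f at r_+, \<rho>^2 is divisible by f, and the determinant of
    the angular block becomes a square that cancels against \<rho>^2.\<close>
  have "R = f - a * a * S" by (simp add: R_def rho_sq_def f_def S_def algebra_simps power2_eq_square)
  also have "\<dots> = f * (1 - a * \<omega> * S)" using a by (simp add: algebra_simps)
  finally have Rf: "R = f * (1 - a * \<omega> * S)" .
  have R: "R \<noteq> 0" using assms by (simp add: R_def)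
  have "det (kruskal_inverse a \<kappa> \<omega> r p' q X) = - (\<kappa> * f * p' / R)\<^sup>2 * ((1 / s * (1 / s + ((X $ 3)\<^sup>2 + (X $ 4)\<^sup>2) * (a\<^sup>2 * S * \<omega>\<^sup>2 - 2 * a * \<omega>))) / R\<^sup>2)"
    unfolding det_4 kruskal_inverse_def Let_def S_def[symmetric] f_def[symmetric] s_def[symmetric] R_def[symmetric]
    using R s by (simp add: assms(1)) (simp add: field_simps power2_eq_square)
  also have "1 / s * (1 / s + ((X $ 3)\<^sup>2 + (X $ 4)\<^sup>2) * (a\<^sup>2 * S * \<omega>\<^sup>2 - 2 * a * \<omega>)) = ((1 - a * \<omega> * S) / s)\<^sup>2"
    using s unfolding S by (simp add: field_simps power2_eq_square)
  also have "\<dots> = (R / f / s)\<^sup>2" using f by (simp add: Rf)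
  finally show ?thesis
    using R f s unfolding R_def[symmetric] s_def[symmetric] by (simp add: field_simps)
qed


section \<open>The Kerr metric in a chart\<close>

text \<open>Turns a formula for the inverse, continuous on \<open>W\<close> and verified at regular
  points only, into the inverse and the density of the metric that \<open>kerr_in_chart\<close>
  defines as a limit. The limit point hypothesis makes this limit unique.\<close>

lemma kerr_in_chart_eqI:
  fixes C :: "real^4 \<Rightarrow> real^4" and H :: "real^4 \<Rightarrow> real^4^4"
  assumes "open W" "X \<in> W" "X islimpt {Y. mu m a (C Y $ 2) \<noteq> 0 \<and> chart_z Y \<notin> \<real>\<^sub>\<le>\<^sub>0}"
    and H: "\<And>i j. continuous_on W (\<lambda>Y. H Y $ i $ j)" and d: "det (H X) \<noteq> 0"
    and inv: "\<And>Y. Y \<in> W \<Longrightarrow> mu m a (C Y $ 2) \<noteq> 0 \<Longrightarrow> chart_z Y \<notin> \<real>\<^sub>\<le>\<^sub>0 \<Longrightarrow>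
      (\<chi> i j. kerr_metric m a (C Y) (frechet_derivative C (at Y) (axis i 1)) (frechet_derivative C (at Y) (axis j 1))) ** H Y = mat 1"
  shows "matrix_inv (kerr_in_chart m a C X) = H X" "vol_density (kerr_in_chart m a C) X = sqrt \<bar>1 / det (H X)\<bar>"
proof -
  let ?D = "{Y. mu m a (C Y $ 2) \<noteq> 0 \<and> chart_z Y \<notin> \<real>\<^sub>\<le>\<^sub>0}"
  have "kerr_in_chart m a C X = matrix_inv (H X)"
    unfolding kerr_in_chart_def
  proof (rule tendsto_Lim)
    show "\<not> trivial_limit (at X within ?D)" using assms(3) by (simp add: trivial_limit_within)
    show "((\<lambda>Y. \<chi> i j. kerr_metric m a (C Y) (frechet_derivative C (at Y) (axis i 1)) (frechet_derivative C (at Y) (axis j 1)))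
       \<longlongrightarrow> matrix_inv (H X)) (at X within ?D)"
    proof (rule tendsto_inverse_matrix[where A = H, OF _ _ d])
      show "((\<lambda>Y. H Y $ i $ j) \<longlongrightarrow> H X $ i $ j) (at X within ?D)" for i j
      proof -
        have "isCont (\<lambda>Y. H Y $ i $ j) X"
          using H[of i j] assms(1,2) by (simp add: continuous_on_eq_continuous_at)
        from continuous_at_imp_continuous_at_within[OF this] show ?thesis
          by (simp add: continuous_within)
      qed
      show "\<forall>\<^sub>F Y in at X within ?D.
        (\<chi> i j. kerr_metric m a (C Y) (frechet_derivative C (at Y) (axis i 1)) (frechet_derivative C (at Y) (axis j 1))) ** H Y = mat 1"
        unfolding eventually_at_topological
        by (rule exI[of _ W]) (use assms(1,2) inv in simp)
    qed
  qed
  moreover obtain B where B: "H X ** B = mat 1" "B ** H X = mat 1"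
    using d by (metis invertible_def invertible_det_nz)
  moreover have "matrix_inv (H X) = B" by (rule matrix_inv_eqI[OF B(1)])
  ultimately have k: "kerr_in_chart m a C X = B" by simp
  show "matrix_inv (kerr_in_chart m a C X) = H X"
    unfolding k by (rule matrix_inv_eqI[OF B(2)])
  have "det (H X) * det B = 1" using B(1) by (metis det_I det_mul)
  then have "det B = 1 / det (H X)" using d by (simp add: field_simps)
  then show "vol_density (kerr_in_chart m a C) X = sqrt \<bar>1 / det (H X)\<bar>"
    by (simp add: vol_density_def k)
qed

lemma chart_z_linear: "bounded_linear chart_z"
proof -
  have "chart_z = (\<lambda>X. complex_of_real (X $ 3) + \<i> * complex_of_real (X $ 4))"
    by (auto simp: chart_z_def fun_eq_iff complex_eq_iff)
  then show ?thesis
    using bounded_linear_add[OF bounded_linear_compose[OF bounded_linear_of_real bounded_linear_vec_nth, of "3::4"]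
        bounded_linear_const_mult[OF bounded_linear_compose[OF bounded_linear_of_real bounded_linear_vec_nth, of "4::4"], of \<i>]]
    by simp
qed

lemma has_derivative_Arg_chart_z:
  assumes "chart_z Y \<notin> \<real>\<^sub>\<le>\<^sub>0"
  shows "((\<lambda>Y. Arg (chart_z Y)) has_derivative
    (\<lambda>v. (Y $ 3 * v $ 4 - Y $ 4 * v $ 3) / ((Y $ 3)\<^sup>2 + (Y $ 4)\<^sup>2))) (at Y)"
proof -
  have 1: "((\<lambda>Y. Ln (chart_z Y)) has_derivative (\<lambda>v. inverse (chart_z Y) * chart_z v)) (at Y)"
    using has_derivative_compose[OF bounded_linear_imp_has_derivative[OF chart_z_linear]
        has_field_derivative_Ln[OF assms, unfolded has_field_derivative_def]] .
  have 2: "Im (inverse (chart_z Y) * chart_z v) = (Y $ 3 * v $ 4 - Y $ 4 * v $ 3) / ((Y $ 3)\<^sup>2 + (Y $ 4)\<^sup>2)" for v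
    by (simp add: chart_z_def add_divide_distrib diff_divide_distrib)
  have "((\<lambda>Y. Im (Ln (chart_z Y))) has_derivative
    (\<lambda>v. (Y $ 3 * v $ 4 - Y $ 4 * v $ 3) / ((Y $ 3)\<^sup>2 + (Y $ 4)\<^sup>2))) (at Y)"
    using has_derivative_Im[OF 1] unfolding 2 .
  moreover have "open (chart_z -` (- {0}))"
    by (rule open_vimage) (auto intro: linear_continuous_on chart_z_linear)
  moreover have "Y \<in> chart_z -` (- {0})" using assms by auto
  ultimately show ?thesis
    by (rule has_derivative_transform_within_open) (auto simp: Arg_eq_Im_Ln)
qed

lemma has_derivative_sphere_theta:
  assumes "chart_z Y \<noteq> 0"
  shows "((\<lambda>Y. sphere_theta north (chart_z Y)) has_derivative
    (\<lambda>v. (if north then 2 else - 2) * ((Y $ 3 * v $ 3 + Y $ 4 * v $ 4) / (cmod (chart_z Y) * (1 + (Y $ 3)\<^sup>2 + (Y $ 4)\<^sup>2))))) (at Y)"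
proof -
  have n: "(cmod (chart_z Y))\<^sup>2 = (Y $ 3)\<^sup>2 + (Y $ 4)\<^sup>2" by (simp add: chart_z_def cmod_power2)
  have 1: "((\<lambda>Y. cmod (chart_z Y)) has_derivative (\<lambda>v. (Y $ 3 * v $ 3 + Y $ 4 * v $ 4) / cmod (chart_z Y))) (at Y)"
    by (rule has_derivative_eq_rhs[OF has_derivative_compose[OF bounded_linear_imp_has_derivative[OF chart_z_linear] has_derivative_norm[OF assms]]])
       (simp add: fun_eq_iff sgn_div_norm inner_complex_def chart_z_def divide_inverse algebra_simps)
  have 2: "((\<lambda>Y. arctan (cmod (chart_z Y))) has_derivative
     (\<lambda>v. (Y $ 3 * v $ 3 + Y $ 4 * v $ 4) / (cmod (chart_z Y) * (1 + (Y $ 3)\<^sup>2 + (Y $ 4)\<^sup>2)))) (at Y)"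
    using has_derivative_arctan[OF 1] by (simp add: n divide_inverse mult_ac add.assoc)
  have 3: "((\<lambda>Y. pi - 2 * arctan (cmod (chart_z Y))) has_derivative
     (\<lambda>v. - 2 * ((Y $ 3 * v $ 3 + Y $ 4 * v $ 4) / (cmod (chart_z Y) * (1 + (Y $ 3)\<^sup>2 + (Y $ 4)\<^sup>2))))) (at Y)"
    by (rule has_derivative_eq_rhs[OF has_derivative_diff[OF has_derivative_const[of pi] has_derivative_mult_right[OF 2, of 2]]])
       (rule ext, simp only: diff_0 mult_minus_left)
  show ?thesis
    using has_derivative_mult_right[OF 2, of 2] 3 unfolding sphere_theta_def[abs_def] by (cases north) simp_all
qed

lemma sin_sphere_theta: "(sin (sphere_theta north (chart_z Y)))\<^sup>2 = sin_sq Y"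
proof -
  define t where "t = cmod (chart_z Y)"
  have t: "t\<^sup>2 = (Y $ 3)\<^sup>2 + (Y $ 4)\<^sup>2" by (simp add: t_def chart_z_def cmod_power2)
  have "sin (sphere_theta north (chart_z Y)) = sin (2 * arctan t)"
    by (simp add: sphere_theta_def t_def)
  also have "\<dots> = 2 * (t / sqrt (1 + t\<^sup>2)) * (1 / sqrt (1 + t\<^sup>2))"
    by (simp only: sin_double sin_arctan cos_arctan)
  also have "\<dots> = 2 * t / (1 + t\<^sup>2)"
    by (simp add: add_nonneg_nonneg)
  finally show ?thesis
    by (simp add: sin_sq_def sphere_factor_def t[symmetric] power_divide power_mult_distrib add.assoc)
qed

lemma ingoing_form_matrix:
  "(transpose L ** ingoing_metric m a r X ** L) $ i $ j
   = ingoing_form m a r X (\<chi> k. L $ k $ i) (\<chi> k. L $ k $ j)"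
proof -
  define c where "c = 2 * m * r / rho_sq a r X - 1"
  show ?thesis
    unfolding ingoing_metric_def ingoing_form_def beta_def gammaf_def c_def[symmetric]
    by (simp add: matrix_matrix_mult_def transpose_def sum_4) (simp add: algebra_simps)
qed

text \<open>One computation for both kinds of charts; \<open>\<tau>\<close> is t_* as a function of
  the chart. In ingoing coordinates \<open>\<omega>\<close> is 0 and \<open>L\<close> the unit
  matrix, in Kruskal coordinates \<open>\<tau>\<close> is ln |x_1| / \<kappa> and \<open>L\<close>
  is \<open>kruskal_jacobian\<close>.\<close>

lemma kerr_pullback:
  fixes C :: "real^4 \<Rightarrow> real^4" and \<tau> r :: "real^4 \<Rightarrow> real"
  assumes W: "open W" "Y \<in> W"
    and C: "\<And>Y. Y \<in> W \<Longrightarrow> C Y = vector [\<tau> Y + \<Phi> (r Y), r Y, Arg (chart_z Y) + \<omega> * \<tau> Y + \<Psi> (r Y), sphere_theta north (chart_z Y)]"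
    and \<tau>: "(\<tau> has_derivative \<tau>') (at Y)" and r: "(r has_derivative r') (at Y)"
    and \<Phi>: "(\<Phi> has_real_derivative - ((r Y)\<^sup>2 + a\<^sup>2) / mu m a (r Y)) (at (r Y))"
    and \<Psi>: "(\<Psi> has_real_derivative - a / mu m a (r Y)) (at (r Y))"
    and z: "chart_z Y \<notin> \<real>\<^sub>\<le>\<^sub>0" and \<mu>: "mu m a (r Y) \<noteq> 0" and \<rho>: "rho_sq a (r Y) Y \<noteq> 0"
    and L: "\<And>j. L $ 1 $ j = \<tau>' (axis j 1)" "\<And>j. L $ 2 $ j = r' (axis j 1)"
      "\<And>j. L $ 3 $ j = axis j 1 $ 3 - \<omega> * Y $ 4 * \<tau>' (axis j 1)" "\<And>j. L $ 4 $ j = axis j 1 $ 4 + \<omega> * Y $ 3 * \<tau>' (axis j 1)"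
  shows "(\<chi> i j. kerr_metric m a (C Y) (frechet_derivative C (at Y) (axis i 1)) (frechet_derivative C (at Y) (axis j 1)))
    = transpose L ** ingoing_metric m a (r Y) Y ** L"
proof -
  define n where "n = (Y $ 3)\<^sup>2 + (Y $ 4)\<^sup>2"
  have z0: "chart_z Y \<noteq> 0" using z by auto
  then have n0: "n \<noteq> 0" by (auto simp: n_def chart_z_def complex_eq_iff sum_power2_eq_zero_iff)
  have nz: "cmod (chart_z Y) * cmod (chart_z Y) = n" unfolding n_def
    by (metis chart_z_def cmod_power2 complex.sel power2_eq_square)
  define A where "A v = (Y $ 3 * v $ 4 - Y $ 4 * v $ 3) / n" for v :: "real^4"
  define \<Theta> where "\<Theta> v = (if north then 2 else - 2) * ((Y $ 3 * v $ 3 + Y $ 4 * v $ 4) / (cmod (chart_z Y) * (1 + n)))" for v :: "real^4"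
  define D where "D v = (vector [\<tau>' v - ((r Y)\<^sup>2 + a\<^sup>2) / mu m a (r Y) * r' v, r' v,
      A v + \<omega> * \<tau>' v - a / mu m a (r Y) * r' v, \<Theta> v] :: real^4)" for v
  have vec: "(vector [b, c, d, e] :: real^4) = b *\<^sub>R axis 1 1 + c *\<^sub>R axis 2 1 + d *\<^sub>R axis 3 1 + e *\<^sub>R axis 4 1" for b c d e
    by (simp add: vec_eq_iff forall_4)
  have "((\<lambda>Y. vector [\<tau> Y + \<Phi> (r Y), r Y, Arg (chart_z Y) + \<omega> * \<tau> Y + \<Psi> (r Y), sphere_theta north (chart_z Y)] :: real^4) has_derivative D) (at Y)"
    unfolding vec
    by (rule has_derivative_eq_rhs[OF has_derivative_add[OF has_derivative_add[OF has_derivative_add[OF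
          has_derivative_scaleR_left[OF has_derivative_add[OF \<tau> has_derivative_compose[OF r \<Phi>[unfolded has_field_derivative_def]]]]
          has_derivative_scaleR_left[OF r]]
          has_derivative_scaleR_left[OF has_derivative_add[OF has_derivative_add[OF
            has_derivative_Arg_chart_z[OF z, folded n_def, folded A_def] has_derivative_mult_right[OF \<tau>, of \<omega>]]
            has_derivative_compose[OF r \<Psi>[unfolded has_field_derivative_def]]]]]
          has_derivative_scaleR_left[OF has_derivative_sphere_theta[OF z0, of north, unfolded add.assoc, folded n_def, folded \<Theta>_def]]]])
       (simp add: fun_eq_iff D_def vec divide_inverse algebra_simps)
  from has_derivative_transform_within_open[OF this W C[symmetric]]
  have fd: "frechet_derivative C (at Y) = D" by (rule frechet_derivative_eqI)
  have "kerr_metric m a (C Y) (D (axis i 1)) (D (axis j 1)) = ingoing_form m a (r Y) Y (\<chi> k. L $ k $ i) (\<chi> k. L $ k $ j)" for i j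
  proof (rule kerr_metric_ingoing_form)
    show "C Y $ 2 = r Y" "(sin (C Y $ 4))\<^sup>2 = sin_sq Y" using W C sin_sphere_theta by simp_all
    \<comment> \<open>The rotation part of \<open>L\<close> adds exactly
      \<open>\<omega> * \<tau>'\<close> to the differential of the angle and, by \<open>xi\<close>
      below, nothing to the radial direction of the chart.\<close>
    have eta: "(Y $ 3 * L $ 4 $ l - Y $ 4 * L $ 3 $ l) / n = A (axis l 1) + \<omega> * \<tau>' (axis l 1)" for l
    proof -
      have "Y $ 3 * L $ 4 $ l - Y $ 4 * L $ 3 $ l = (Y $ 3 * axis l 1 $ 4 - Y $ 4 * axis l 1 $ 3) + n * (\<omega> * \<tau>' (axis l 1))"
        by (simp add: L n_def power2_eq_square algebra_simps)
      then show ?thesis using n0 by (simp add: A_def add_divide_distrib)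
    qed
    show "D (axis i 1) $ 3 = (Y $ 3 * (\<chi> k. L $ k $ i) $ 4 - Y $ 4 * (\<chi> k. L $ k $ i) $ 3) / ((Y $ 3)\<^sup>2 + (Y $ 4)\<^sup>2) - a / mu m a (r Y) * (\<chi> k. L $ k $ i) $ 2"
      "D (axis j 1) $ 3 = (Y $ 3 * (\<chi> k. L $ k $ j) $ 4 - Y $ 4 * (\<chi> k. L $ k $ j) $ 3) / ((Y $ 3)\<^sup>2 + (Y $ 4)\<^sup>2) - a / mu m a (r Y) * (\<chi> k. L $ k $ j) $ 2"
      unfolding n_def[symmetric] by (simp_all add: eta L(2) D_def)
    have xi: "Y $ 3 * L $ 3 $ l + Y $ 4 * L $ 4 $ l = Y $ 3 * axis l 1 $ 3 + Y $ 4 * axis l 1 $ 4" for l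
      by (simp add: L algebra_simps)
    have "D (axis i 1) $ 4 * D (axis j 1) $ 4 = 4 * ((Y $ 3 * axis i 1 $ 3 + Y $ 4 * axis i 1 $ 4) * (Y $ 3 * axis j 1 $ 3 + Y $ 4 * axis j 1 $ 4))
      / ((cmod (chart_z Y) * cmod (chart_z Y)) * (1 + n)\<^sup>2)"
      unfolding D_def \<Theta>_def by (cases north; simp add: power2_eq_square mult_ac; simp add: algebra_simps)
    then show "D (axis i 1) $ 4 * D (axis j 1) $ 4 = sphere_factor Y * ((Y $ 3 * (\<chi> k. L $ k $ i) $ 3 + Y $ 4 * (\<chi> k. L $ k $ i) $ 4)
      * (Y $ 3 * (\<chi> k. L $ k $ j) $ 3 + Y $ 4 * (\<chi> k. L $ k $ j) $ 4)) / ((Y $ 3)\<^sup>2 + (Y $ 4)\<^sup>2)"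
      unfolding nz by (simp add: xi sphere_factor_def n_def add.assoc mult_ac)
  qed (use \<mu> \<rho> n0 in \<open>simp_all add: D_def L n_def\<close>)
  then show ?thesis
    by (simp add: vec_eq_iff fd ingoing_form_matrix)
qed

section \<open>The Kruskal coordinate \<open>r\<close>\<close>

locale kerr =
  fixes m a :: real and \<Phi>t \<Psi>t :: "real \<Rightarrow> real"
  assumes m: "m > 0" and a: "\<bar>a\<bar> < m" and regular: "regular_parts m a \<Phi>t \<Psi>t"
begin

abbreviation "rp \<equiv> r_plus m a"
abbreviation "rm \<equiv> r_minus m a"
abbreviation "\<kappa> \<equiv> surface_gravity m a"
abbreviation "kp \<equiv> kruskal_prod m a \<Phi>t"
abbreviation "kr \<equiv> kruskal_r m a \<Phi>t"

definition \<omega> where "\<omega> = a / (rp\<^sup>2 + a\<^sup>2)"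

text \<open>The derivative of \<open>kp\<close>: in \<mu> p' = 2\<kappa> (r^2 + a^2) p the common
  factor r - r_+ is cancelled, so that smoothness and positivity at r_+ can be seen.\<close>

definition kp' where "kp' r = 2 * \<kappa> * (r\<^sup>2 + a\<^sup>2) * exp (- 2 * \<kappa> * \<Phi>t r) / (r - rm)"

text \<open>The quotient of a - \<omega>(r^2 + a^2) by \<open>kp\<close>. The numerator equals
  -\<omega>(r - r_+)(r + r_+), and the zero at r_+ is cancelled.\<close>

definition qq where "qq r = - \<omega> * (r + rp) * exp (2 * \<kappa> * \<Phi>t r)"

lemma a2: "a\<^sup>2 < m\<^sup>2"
  using power_strict_mono[OF a abs_ge_zero, of 2] by simp

lemma rm_less_rp: "rm < rp"
  using a2 by (simp add: r_minus_def r_plus_def)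

lemma rm_nonneg: "0 \<le> rm"
  using real_sqrt_le_mono[of "m\<^sup>2 - a\<^sup>2" "m\<^sup>2"] m by (simp add: r_minus_def)

lemma mu_factor: "mu m a r = (r - rp) * (r - rm)"
proof -
  have "(sqrt (m\<^sup>2 - a\<^sup>2))\<^sup>2 = m\<^sup>2 - a\<^sup>2" using a2 by simp
  then show ?thesis
    unfolding mu_def r_plus_def r_minus_def by (simp add: power2_eq_square algebra_simps)
qed

lemma mu_deriv_rp: "mu_deriv m rp = rp - rm"
  by (simp add: mu_deriv_def r_plus_def r_minus_def)

lemma rp_pos: "rp > 0" using rm_less_rp rm_nonneg by simp

lemma f_pos: "r > 0 \<Longrightarrow> r\<^sup>2 + a\<^sup>2 > 0"
  by (intro add_pos_nonneg) auto

lemma kappa_eq: "2 * \<kappa> * (rp\<^sup>2 + a\<^sup>2) = rp - rm"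
proof -
  have "2 * (d / (2 * f)) * f = d" if "f > 0" for d f :: real using that by simp
  from this[OF f_pos[OF rp_pos]] show ?thesis
    unfolding surface_gravity_def mu_deriv_rp .
qed

lemma kappa_pos: "\<kappa> > 0"
  using f_pos[OF rp_pos] rm_less_rp by (simp add: surface_gravity_def mu_deriv_rp)

lemma a_eq: "a = \<omega> * (rp\<^sup>2 + a\<^sup>2)"
  using f_pos[OF rp_pos] by (simp add: \<omega>_def)

lemma Phi_of_eq: "Phi_of m a \<Phi>t r = - ln \<bar>r - rp\<bar> / (2 * \<kappa>) + \<Phi>t r"
proof -
  have "(rp\<^sup>2 + a\<^sup>2) / mu_deriv m rp = 1 / (2 * \<kappa>)"
    using kappa_eq kappa_pos rm_less_rp by (simp add: mu_deriv_rp field_simps)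
  then show ?thesis
    unfolding Phi_of_def by (metis (no_types, opaque_lifting) divide_inverse inverse_eq_divide minus_divide_left minus_mult_left mult.commute)
qed

lemma smooth_parts: "smooth_on {rm<..} \<Phi>t" "smooth_on {rm<..} \<Psi>t"
  using regular by (auto simp: regular_parts_def)

lemma DERIV_Phi_Psi:
  assumes "r > rm" "r \<noteq> rp"
  shows "(Phi_of m a \<Phi>t has_real_derivative - (r\<^sup>2 + a\<^sup>2) / mu m a r) (at r)"
    "(Psi_of m a \<Psi>t has_real_derivative - a / mu m a r) (at r)"
  using regular assms by (auto simp: regular_parts_def)

lemma smooth_on_DERIV:
  assumes "smooth_on S f" "x \<in> S"
  obtains D where "(f has_real_derivative D) (at x)"
  using smooth_on_differentiable[OF assms] that by (auto simp: real_differentiable_def)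

lemma DERIV_kp:
  assumes "r > rm"
  shows "(kp has_real_derivative kp' r) (at r)"
proof -
  obtain D where D: "(\<Phi>t has_real_derivative D) (at r)"
    by (rule smooth_on_DERIV[OF smooth_parts(1)]) (use assms in auto)
  define E where "E = exp (- 2 * \<kappa> * \<Phi>t r)"
  have "((\<lambda>r. exp (- 2 * \<kappa> * \<Phi>t r) * (r - rp)) has_real_derivative E * (1 - 2 * \<kappa> * D * (r - rp))) (at r)"
    unfolding E_def by (rule derivative_eq_intros D refl | simp add: algebra_simps)+
  \<comment> \<open>Away from r_+ the unknown derivative \<open>D\<close> of the regular part is
    read off from the prescribed derivative of \<Phi>; at r_+ it drops out, and the identity is the
    definition of \<kappa>.\<close>
  moreover have "1 - 2 * \<kappa> * D * (r - rp) = 2 * \<kappa> * (r\<^sup>2 + a\<^sup>2) / (r - rm)"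
  proof (cases "r = rp")
    case True
    then show ?thesis using kappa_eq rm_less_rp by simp
  next
    case False
    have "((\<lambda>r. - ln \<bar>r - rp\<bar> / (2 * \<kappa>) + \<Phi>t r) has_real_derivative - (1 / (r - rp)) / (2 * \<kappa>) + D) (at r)"
    proof -
      have "((\<lambda>r. ln \<bar>r - rp\<bar>) has_real_derivative 1 / (r - rp)) (at r)"
      proof (cases "r > rp")
        case True
        have "((\<lambda>r. ln (r - rp)) has_real_derivative 1 / (r - rp)) (at r)"
          using True by (auto intro!: derivative_eq_intros)
        then show ?thesis
          by (rule has_field_derivative_transform_within_open[of _ _ _ "{rp<..}"]) (use True in auto)
      next
        case False
        have "((\<lambda>r. ln (rp - r)) has_real_derivative 1 / (r - rp)) (at r)"
          using False \<open>r \<noteq> rp\<close> by (auto intro!: derivative_eq_intros simp: divide_simps)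
        then show ?thesis
          by (rule has_field_derivative_transform_within_open[of _ _ _ "{..<rp}"]) (use False \<open>r \<noteq> rp\<close> in auto)
      qed
      from DERIV_add[OF DERIV_cdivide[OF DERIV_minus[OF this], of "2 * \<kappa>"] D] show ?thesis .
    qed
    moreover have "Phi_of m a \<Phi>t = (\<lambda>r. - ln \<bar>r - rp\<bar> / (2 * \<kappa>) + \<Phi>t r)"
      using Phi_of_eq by blast
    ultimately have "- (1 / (r - rp)) / (2 * \<kappa>) + D = - (r\<^sup>2 + a\<^sup>2) / mu m a r"
      using DERIV_unique[OF _ DERIV_Phi_Psi(1)[OF assms False]] by metis
    moreover have "- (1 / (r - rp)) / (2 * \<kappa>) = - (1 / (2 * \<kappa> * (r - rp)))"
      by (simp add: mult.commute)
    moreover have "- (r\<^sup>2 + a\<^sup>2) / mu m a r = - ((r\<^sup>2 + a\<^sup>2) / ((r - rp) * (r - rm)))"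
      by (simp only: mu_factor minus_divide_left)
    ultimately have "D = 1 / (2 * \<kappa> * (r - rp)) - (r\<^sup>2 + a\<^sup>2) / ((r - rp) * (r - rm))"
      by linarith
    moreover have "2 * k * D * u = 1 - 2 * k * f / v"
      if "D = 1 / (2 * k * u) - f / (u * v)" "k \<noteq> 0" "u \<noteq> 0" "v \<noteq> 0" for k u v f :: real
      using that by (simp add: field_simps)
    ultimately have "2 * \<kappa> * D * (r - rp) = 1 - 2 * \<kappa> * (r\<^sup>2 + a\<^sup>2) / (r - rm)"
      using False assms kappa_pos by simp
    then show ?thesis by simp
  qed
  ultimately show ?thesis
    by (simp add: kruskal_prod_def[abs_def] kp'_def E_def mult_ac)
qed

lemma kp'_pos: "r > rm \<Longrightarrow> kp' r > 0"
  using rm_nonneg f_pos[of r] kappa_pos by (simp add: kp'_def)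

lemma kp_strict_mono: "rm < r \<Longrightarrow> r < s \<Longrightarrow> kp r < kp s"
proof (erule DERIV_pos_imp_increasing)
  fix x assume "rm < r" "r \<le> x"
  then have "rm < x" by simp
  from DERIV_kp[OF this] kp'_pos[OF this] show "\<exists>y. (kp has_real_derivative y) (at x) \<and> 0 < y" by blast
qed

lemma kp_less_iff: "rm < r \<Longrightarrow> rm < s \<Longrightarrow> kp r < kp s \<longleftrightarrow> r < s"
  using kp_strict_mono by (metis less_asym linorder_neqE_linordered_idom)

lemma kp_inj: "rm < r \<Longrightarrow> rm < s \<Longrightarrow> kp r = kp s \<Longrightarrow> r = s"
  using kp_strict_mono by (metis less_irrefl linorder_neqE_linordered_idom)

lemma kp_rp [simp]: "kp rp = 0"
  by (simp add: kruskal_prod_def)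

lemma mu_kp': "r > rm \<Longrightarrow> mu m a r * kp' r = 2 * \<kappa> * (r\<^sup>2 + a\<^sup>2) * kp r"
  by (simp add: mu_factor kp'_def kruskal_prod_def)

lemma qq_kp: "qq r * kp r = a - \<omega> * (r\<^sup>2 + a\<^sup>2)"
proof -
  have e: "exp (2 * \<kappa> * \<Phi>t r) * exp (- 2 * \<kappa> * \<Phi>t r) = 1" by (simp add: exp_add[symmetric])
  have "qq r * kp r = (exp (2 * \<kappa> * \<Phi>t r) * exp (- 2 * \<kappa> * \<Phi>t r)) * (- \<omega> * (r + rp) * (r - rp))"
    unfolding qq_def kruskal_prod_def by (simp only: mult_ac)
  also have "\<dots> = - \<omega> * (r + rp) * (r - rp)" unfolding e by simp
  finally have "qq r * kp r = - \<omega> * (r + rp) * (r - rp)" .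
  also have "\<dots> = \<omega> * (rp\<^sup>2 + a\<^sup>2) - \<omega> * (r\<^sup>2 + a\<^sup>2)"
    by (simp add: power2_eq_square algebra_simps)
  finally show ?thesis using a_eq by simp
qed

lemma isCont_kp: "r > rm \<Longrightarrow> isCont kp r"
  using DERIV_kp DERIV_isCont by blast

text \<open>Beyond \<open>r\<^sub>+\<close> one has \<open>p' \<ge> 2 \<kappa> p\<close>, so \<open>p\<close> is unbounded.\<close>

lemma kp_unbounded: "\<exists>r>s. kp r > y"
proof -
  \<comment> \<open>Beyond both \<open>s\<close> and r_+, so that \<open>kp\<close> is positive at
    \<open>s1\<close>; then \<open>c\<close> > 0 bounds \<open>kp'\<close> from below on all of [s1,
    \<infinity>), which gives linear growth.\<close>
  define s1 where "s1 = max (s + 1) (rp + 1)"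
  have s1: "s1 > rp" "s1 > s" "s1 > rm" using rm_less_rp by (auto simp: s1_def)
  define c where "c = 2 * \<kappa> * kp s1"
  have ps: "kp s1 > 0" using kp_strict_mono[OF rm_less_rp s1(1)] by simp
  then have c: "c > 0" using kappa_pos by (simp add: c_def)
  have "kp s1 + c * (r - s1) \<le> kp r" if "r \<ge> s1" for r
  proof -
    have "kp s1 - c * s1 \<le> kp r - c * r"
    proof (rule DERIV_nonneg_imp_nondecreasing[OF that])
      fix x assume x: "s1 \<le> x" "x \<le> r"
      have xr: "x > rp" "x > rm" "x > 0" using x s1 rp_pos by auto
      have "kp s1 \<le> kp x" using kp_strict_mono[OF s1(3), of x] x(1) by (cases "x = s1") auto
      moreover have "2 * \<kappa> * kp x \<le> kp' x"
      proof -
        have \<mu>: "mu m a x > 0" using xr by (simp add: mu_factor)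
        have "mu m a x \<le> x\<^sup>2 + a\<^sup>2" using m xr by (simp add: mu_def)
        moreover have "0 \<le> 2 * \<kappa> * kp x" using kappa_pos ps \<open>kp s1 \<le> kp x\<close> by simp
        ultimately have "mu m a x * (2 * \<kappa> * kp x) \<le> (x\<^sup>2 + a\<^sup>2) * (2 * \<kappa> * kp x)"
          by (rule mult_right_mono)
        also have "\<dots> = mu m a x * kp' x" using mu_kp'[OF xr(2)] by simp
        finally show ?thesis using \<mu> by simp
      qed
      ultimately have "c \<le> kp' x" using kappa_pos unfolding c_def
        by (meson less_eq_real_def mult_left_mono mult_nonneg_nonneg order_trans zero_le_numeral)
      moreover have "((\<lambda>x. kp x - c * x) has_real_derivative kp' x - c) (at x)"
        by (auto intro!: derivative_eq_intros DERIV_kp xr)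
      ultimately show "\<exists>y. ((\<lambda>x. kp x - c * x) has_real_derivative y) (at x) \<and> 0 \<le> y" by force
    qed
    then show ?thesis by (simp add: algebra_simps)
  qed
  from this[of "s1 + \<bar>y\<bar> / c + 1"] have "kp s1 + c * (\<bar>y\<bar> / c + 1) \<le> kp (s1 + \<bar>y\<bar> / c + 1)"
    using c by (simp add: add.assoc)
  moreover have "c * (\<bar>y\<bar> / c + 1) = \<bar>y\<bar> + c" using c by (simp add: field_simps)
  ultimately have "kp (s1 + \<bar>y\<bar> / c + 1) > y" using ps c by linarith
  moreover have "s1 + \<bar>y\<bar> / c + 1 > s" using s1(2) c by (smt (verit) divide_nonneg_pos)
  ultimately show ?thesis by blast
qed

lemma kp_surj:
  assumes "s > rm" "kp s < y"
  shows "\<exists>r>s. kp r = y"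
proof -
  obtain t where t: "t > s" "kp t > y" using kp_unbounded by blast
  have "\<exists>x. s \<le> x \<and> x \<le> t \<and> kp x = y"
    by (rule IVT) (use assms t isCont_kp in auto)
  then show ?thesis using assms(2) by (metis less_irrefl order_le_imp_less_or_eq)
qed

lemma kr_kp: "r > rm \<Longrightarrow> kr (kp r) = r"
  unfolding kruskal_r_def by (rule the_equality) (auto intro: kp_inj)

text \<open>That \<open>y\<close> exceeds the value of \<open>kp\<close> at some \<open>s\<close>
  above r_- is the way to say that \<open>y\<close> lies in the range of \<open>kp\<close>, whose
  lower end depends on the parameters.\<close>

lemma kr:
  assumes "s > rm" "kp s < y"
  shows "kr y > s" "kp (kr y) = y"
  using kp_surj[OF assms] kr_kp assms(1) by (metis less_trans)+

lemma DERIV_kr: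
  assumes "s > rm" "kp s < y"
  shows "(kr has_real_derivative inverse (kp' (kr y))) (at y)"
proof -
  have r: "kr y > rm" using kr[OF assms] assms by simp
  show ?thesis
    unfolding has_field_derivative_def
  proof (rule has_derivative_inverse_strong_x[of "{rm<..}" kr y kp])
    show "continuous_on {rm<..} kp"
      by (auto intro!: continuous_at_imp_continuous_on isCont_kp)
    show "(kp has_derivative (*) (kp' (kr y))) (at (kr y))"
      using DERIV_kp[OF r] by (simp add: has_field_derivative_def)
    show "(*) (kp' (kr y)) \<circ> (*) (inverse (kp' (kr y))) = id"
      using kp'_pos[OF r] by (auto simp: fun_eq_iff)
  qed (use r kr_kp kr(2)[OF assms] in auto)
qed

lemma smooth_on_kp': "smooth_on {rm<..} kp'"
  unfolding kp'_def
  by (intro smooth_on_divide smooth_on_mult smooth_on_add smooth_on_diff smooth_on_const smooth_on_exp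
      smooth_on_power smooth_parts smooth_on_linear[OF bounded_linear_ident] open_greaterThan) auto

lemma smooth_on_qq: "smooth_on {rm<..} qq"
  unfolding qq_def
  by (intro smooth_on_mult smooth_on_add smooth_on_const smooth_on_exp
      smooth_parts smooth_on_linear[OF bounded_linear_ident] open_greaterThan)

text \<open>Bootstrapping: the derivative of \<open>kr\<close> is the inverse of \<open>kp'\<close>
  composed with \<open>kr\<close>, so it has as many derivatives as \<open>kr\<close> is already
  known to have.\<close>

lemma smooth_on_kr:
  assumes "s > rm"
  shows "smooth_on {kp s<..} kr"
proof -
  have i: "smooth_on {rm<..} (\<lambda>r. inverse (kp' r))"
    by (rule smooth_on_inverse[OF _ smooth_on_kp']) (use kp'_pos in force)+
  have "Ck_on n {kp s<..} kr" for n
  proof (induction n)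
    case 0
    then show ?case
      using DERIV_kr[OF assms] by (auto intro!: continuous_at_imp_continuous_on DERIV_isCont)
  next
    case (Suc n)
    have "Ck_on n {kp s<..} (\<lambda>y. inverse (kp' (kr y)))"
      by (rule Ck_on_compose[OF _ _ _ Suc, of "{rm<..}"])
         (use i kr(1)[OF assms] assms in \<open>auto simp: smooth_on_def intro: less_trans\<close>)
    then show ?case
      by (intro Ck_on_real_derivative[of _ _ "\<lambda>y. inverse (kp' (kr y))"]) (use DERIV_kr[OF assms] in auto)
  qed
  then show ?thesis by (simp add: smooth_on_def)
qed

lemma kruskal_region_eq:
  assumes "\<delta> < rp - rm"
  shows "kruskal_region m a \<Phi>t \<delta> = {X. kp (rp - \<delta>) < X $ 1 * X $ 2}"
proof -
  have s: "rp - \<delta> > rm" using assms by simp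
  show ?thesis
    unfolding kruskal_region_def
  proof (intro Collect_cong iffI)
    show "kp (rp - \<delta>) < X $ 1 * X $ 2" if "\<exists>r>rp - \<delta>. kp r = X $ 1 * X $ 2" for X :: "real^4"
      using that kp_strict_mono[OF s] by metis
    show "\<exists>r>rp - \<delta>. kp r = X $ 1 * X $ 2" if "kp (rp - \<delta>) < X $ 1 * X $ 2" for X :: "real^4"
      by (rule kp_surj[OF s that])
  qed
qed

end

section \<open>The Kerr metric on r > r_+ - \<delta> in Kruskal and ingoing charts\<close>

locale kerr_region = kerr +
  fixes \<delta> :: real
  assumes \<delta>: "0 < \<delta>" "\<delta> < rp - rm"
begin

abbreviation "\<Omega> \<equiv> kruskal_region m a \<Phi>t \<delta>"

definition rX :: "real^4 \<Rightarrow> real" where "rX X = kr (X $ 1 * X $ 2)"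

lemma rd: "rp - \<delta> > rm" using \<delta> by simp

lemma Omega_eq: "\<Omega> = {X. kp (rp - \<delta>) < X $ 1 * X $ 2}"
  by (rule kruskal_region_eq[OF \<delta>(2)])

lemma open_Omega: "open \<Omega>"
  unfolding Omega_eq by (intro open_Collect_less continuous_intros)

lemma quadrant_Omega: "{X. X $ 1 \<ge> 0 \<and> X $ 2 \<ge> 0} \<subseteq> \<Omega>"
proof -
  have "kp (rp - \<delta>) < 0" using kp_strict_mono[OF rd, of rp] \<delta> by simp
  then show ?thesis
    unfolding Omega_eq by (auto intro: less_le_trans)
qed

lemma rX:
  assumes "X \<in> \<Omega>"
  shows "rX X > rp - \<delta>" "rX X > rm" "rX X > 0" "kp (rX X) = X $ 1 * X $ 2"
proof -
  have *: "kp (rp - \<delta>) < X $ 1 * X $ 2" using assms by (simp add: Omega_eq)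
  show 1: "rX X > rp - \<delta>" unfolding rX_def by (rule kr(1)[OF rd *])
  show 2: "rX X > rm" using 1 rd by simp
  show "rX X > 0" using 2 rm_nonneg by simp
  show "kp (rX X) = X $ 1 * X $ 2" unfolding rX_def by (rule kr(2)[OF rd *])
qed

lemma rX_eq_rp_iff: "X \<in> \<Omega> \<Longrightarrow> rX X = rp \<longleftrightarrow> X $ 1 * X $ 2 = 0"
  using rX[of X] kp_inj[OF _ rm_less_rp] by (metis kp_rp)

lemma mu_rX_iff: "X \<in> \<Omega> \<Longrightarrow> mu m a (rX X) = 0 \<longleftrightarrow> X $ 1 * X $ 2 = 0"
  using rX_eq_rp_iff[of X] rX(2)[of X] by (simp add: mu_factor)

lemma has_derivative_rX:
  assumes "X \<in> \<Omega>"
  shows "(rX has_derivative (\<lambda>h. (X $ 2 * h $ 1 + X $ 1 * h $ 2) / kp' (rX X))) (at X)"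
proof -
  have "((\<lambda>X. X $ 1 * X $ 2) has_derivative (\<lambda>h. X $ 1 * h $ 2 + h $ 1 * X $ 2)) (at X)"
    by (rule has_derivative_mult[OF bounded_linear_imp_has_derivative bounded_linear_imp_has_derivative]; rule bounded_linear_vec_nth)
  moreover have "(kr has_derivative (*) (inverse (kp' (rX X)))) (at (X $ 1 * X $ 2))"
    using DERIV_kr[OF rd, of "X $ 1 * X $ 2"] assms by (simp add: Omega_eq rX_def has_field_derivative_def)
  ultimately have "((\<lambda>X. kr (X $ 1 * X $ 2)) has_derivative (\<lambda>h. inverse (kp' (rX X)) * (X $ 1 * h $ 2 + h $ 1 * X $ 2))) (at X)"
    by (rule has_derivative_compose)
  then show ?thesis
    unfolding rX_def[abs_def] by (rule has_derivative_eq_rhs) (simp add: fun_eq_iff divide_inverse algebra_simps)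
qed

lemma smooth_on_rX: "smooth_on \<Omega> rX"
proof -
  have p: "smooth_on \<Omega> (\<lambda>X. X $ 1 * X $ 2)"
    by (intro smooth_on_mult smooth_on_vec_nth open_Omega)
  show ?thesis
    unfolding rX_def[abs_def]
    by (rule smooth_on_compose[OF open_Omega _ _ p smooth_on_kr[OF rd]]) (auto simp: Omega_eq)
qed

lemma smooth_on_compose_rX: "smooth_on {rm<..} g \<Longrightarrow> smooth_on \<Omega> (\<lambda>X. g (rX X))"
  by (rule smooth_on_compose[OF open_Omega _ _ smooth_on_rX, of "{rm<..}"]) (use rX in auto)

lemma smooth_on_sphere_factor: "open S \<Longrightarrow> smooth_on S sphere_factor"
  unfolding sphere_factor_def
  by (intro smooth_on_divide smooth_on_power smooth_on_add smooth_on_const smooth_on_vec_nth)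
     (auto simp: add_nonneg_eq_0_iff add_nonneg_nonneg)

lemma smooth_on_sin_sq: "open S \<Longrightarrow> smooth_on S sin_sq"
  unfolding sin_sq_def
  by (intro smooth_on_mult smooth_on_sphere_factor smooth_on_power smooth_on_add smooth_on_vec_nth)

definition HK :: "real^4 \<Rightarrow> real^4^4" where
  "HK X = kruskal_inverse a \<kappa> \<omega> (rX X) (kp' (rX X)) (qq (rX X)) X"

lemma smooth_on_rho_sq: "smooth_on \<Omega> (\<lambda>X. rho_sq a (rX X) X)"
  unfolding rho_sq_def
  by (intro smooth_on_add smooth_on_mult smooth_on_diff smooth_on_power smooth_on_rX smooth_on_const smooth_on_sin_sq open_Omega)

lemma smooth_on_HK: "smooth_on \<Omega> (\<lambda>X. HK X $ i $ j)"
proof -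
  note s = smooth_on_divide smooth_on_add smooth_on_mult smooth_on_diff smooth_on_minus smooth_on_power smooth_on_rX smooth_on_const
    smooth_on_sin_sq smooth_on_sphere_factor smooth_on_vec_nth open_Omega smooth_on_compose_rX[OF smooth_on_kp'] smooth_on_compose_rX[OF smooth_on_qq]
  have nz: "sphere_factor X \<noteq> 0" for X using sphere_factor_pos[of X] by simp
  have r: "smooth_on \<Omega> (\<lambda>X. 1 / rho_sq a (rX X) X)"
  proof (intro smooth_on_divide smooth_on_const smooth_on_rho_sq open_Omega)
    show "rho_sq a (rX X) X \<noteq> 0" if "X \<in> \<Omega>" for X
      using rho_sq_pos[OF rX(3)[OF that], of a X] by simp
  qed
  have "\<forall>i j. smooth_on \<Omega> (\<lambda>X. HK X $ i $ j)"
    unfolding HK_def kruskal_inverse_def Let_def forall_4 vec_lambda_beta vector_4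
    by (intro conjI smooth_on_mult[OF open_Omega r] s nz)
  then show ?thesis by blast
qed

lemma det_HK:
  assumes "X \<in> \<Omega>"
  shows "det (HK X) = - (\<kappa> * kp' (rX X) / (rho_sq a (rX X) X * sphere_factor X))\<^sup>2"
proof (cases "X $ 1 = 0")
  case True
  then have r: "rX X = rp" using rX_eq_rp_iff[OF assms] by simp
  show ?thesis
    unfolding HK_def r
    by (rule det_kruskal_inverse_past_horizon[OF True _ _ a_eq])
       (use rho_sq_pos[OF rp_pos, of a X] f_pos[OF rp_pos] in auto)
next
  case False
  show ?thesis
    unfolding HK_def
    by (rule kruskal_metric_inverse(2)[OF False, where m = m])
       (use kappa_pos kp'_pos[OF rX(2)[OF assms]] rho_sq_pos[OF rX(3)[OF assms], of a X] mu_kp'[OF rX(2)[OF assms]] rX(4)[OF assms] qq_kp[of "rX X"] in auto)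
qed

text \<open>Taking logarithms of |x_1 x_2| = |kp r| shows that half the sum of t_* and t_** is t_* +
  \<Phi>(r) in all four quadrants. This is the form of the chart that \<open>kerr_pullback\<close>
  expects.\<close>

lemma bl_of_kruskal_eq:
  assumes "Y \<in> \<Omega>" "Y $ 1 \<noteq> 0" "Y $ 2 \<noteq> 0"
  shows "(bl_of_kruskal m a \<Phi>t \<Psi>t \<circ> angular north) Y =
    vector [ln \<bar>Y $ 1\<bar> / \<kappa> + Phi_of m a \<Phi>t (rX Y), rX Y, Arg (chart_z Y) + \<omega> * (ln \<bar>Y $ 1\<bar> / \<kappa>) + Psi_of m a \<Psi>t (rX Y),
      sphere_theta north (chart_z Y)]"
proof -
  have "ln \<bar>Y $ 1\<bar> + ln \<bar>Y $ 2\<bar> = ln \<bar>kp (rX Y)\<bar>"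
    using assms rX(4)[OF assms(1)] by (simp add: abs_mult ln_mult)
  also have "\<bar>kp (rX Y)\<bar> = exp (- 2 * \<kappa> * \<Phi>t (rX Y)) * \<bar>rX Y - rp\<bar>"
    by (simp add: kruskal_prod_def abs_mult)
  also have "ln \<dots> = - 2 * \<kappa> * \<Phi>t (rX Y) + ln \<bar>rX Y - rp\<bar>"
    using rX_eq_rp_iff[OF assms(1)] assms by (subst ln_mult) auto
  also have "\<dots> = - 2 * \<kappa> * Phi_of m a \<Phi>t (rX Y)"
    using kappa_pos by (simp add: Phi_of_eq algebra_simps)
  finally have *: "ln \<bar>Y $ 1\<bar> + ln \<bar>Y $ 2\<bar> = - 2 * \<kappa> * Phi_of m a \<Phi>t (rX Y)" .
  have "(u / k + - v / k) / 2 = u / k + P" if "u + v = - 2 * k * P" "k > 0" for u v k P :: real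
  proof -
    have v: "v = - 2 * k * P - u" using that(1) by linarith
    show ?thesis unfolding v using that(2) by (simp add: field_simps)
  qed
  from this[OF * kappa_pos]
  have "(ln \<bar>Y $ 1\<bar> / \<kappa> + - ln \<bar>Y $ 2\<bar> / \<kappa>) / 2 = ln \<bar>Y $ 1\<bar> / \<kappa> + Phi_of m a \<Phi>t (rX Y)" .
  then show ?thesis
    unfolding comp_apply bl_of_kruskal_def angular_def Let_def vector_4 rX_def \<omega>_def by (simp only:)
qed

lemma bl_of_kruskal_r: "(bl_of_kruskal m a \<Phi>t \<Psi>t \<circ> angular north) Y $ 2 = rX Y"
  by (simp add: bl_of_kruskal_def angular_def Let_def rX_def)

text \<open>On the line through \<open>X\<close> in direction (1, 1, 0, 1) only finitely many points
  satisfy x_1 = 0, x_2 = 0, x_2 = \<open>c\<close> or x_4 = 0, and the last condition holds on the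
  branch cut. The constant \<open>c\<close> is r_+ in the ingoing chart, where x_2 is r, and 0 in
  the Kruskal chart.\<close>

lemma islimpt_regular_points:
  fixes X :: "real^4"
  assumes "open W" "X \<in> W" "\<And>Y. Y \<in> W \<Longrightarrow> Y $ 1 \<noteq> 0 \<Longrightarrow> Y $ 2 \<noteq> c \<Longrightarrow> Y $ 2 \<noteq> 0 \<Longrightarrow> mu m a (C Y $ 2) \<noteq> 0"
  shows "X islimpt {Y. mu m a (C Y $ 2) \<noteq> 0 \<and> chart_z Y \<notin> \<real>\<^sub>\<le>\<^sub>0}"
  unfolding islimpt_def
proof (intro allI impI)
  fix T assume T: "X \<in> T" "open T"
  define v :: "real^4" where "v = vector [1, 1, 0, 1]"
  define g where "g \<epsilon> = X + \<epsilon> *\<^sub>R v" for \<epsilon> :: real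
  have "open (g -` (T \<inter> W))"
    unfolding g_def by (rule open_vimage) (auto intro!: continuous_intros assms T)
  moreover have "0 \<in> g -` (T \<inter> W)" using T assms(2) by (simp add: g_def)
  ultimately obtain e where e: "e > 0" "ball 0 e \<subseteq> g -` (T \<inter> W)"
    by (meson open_contains_ball)
  have "infinite {0<..<e}" using e(1) by simp
  moreover have "finite {- X $ 1, - X $ 2, c - X $ 2, - X $ 4}" by simp
  ultimately obtain \<epsilon> where \<epsilon>: "\<epsilon> \<in> {0<..<e}" "\<epsilon> \<notin> {- X $ 1, - X $ 2, c - X $ 2, - X $ 4}"
    by (metis (no_types, lifting) finite_subset subsetI)
  have "\<epsilon> \<in> ball 0 e" using \<epsilon>(1) by (simp add: dist_real_def)
  then have gW: "g \<epsilon> \<in> T" "g \<epsilon> \<in> W" using e(2) by blast+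
  have c: "g \<epsilon> $ 1 = X $ 1 + \<epsilon>" "g \<epsilon> $ 2 = X $ 2 + \<epsilon>" "g \<epsilon> $ 4 = X $ 4 + \<epsilon>" by (simp_all add: g_def v_def)
  have "mu m a (C (g \<epsilon>) $ 2) \<noteq> 0"
    by (rule assms(3)[OF gW(2)]) (use \<epsilon>(2) c in auto)
  moreover have "chart_z (g \<epsilon>) \<notin> \<real>\<^sub>\<le>\<^sub>0"
    using \<epsilon>(2) c(3) by (auto simp: chart_z_def complex_nonpos_Reals_iff)
  moreover have "g \<epsilon> \<noteq> X" using \<epsilon>(1) c(1) by auto
  ultimately show "\<exists>y\<in>{Y. mu m a (C Y $ 2) \<noteq> 0 \<and> chart_z Y \<notin> \<real>\<^sub>\<le>\<^sub>0}. y \<in> T \<and> y \<noteq> X"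
    using gW by blast
qed

text \<open>\<open>kerr_pullback\<close> gives the metric only where x_1 and x_2 are nonzero and z
  is off the branch cut. As \<open>HK\<close> is continuous and nonsingular on all of
  \<open>\<Omega>\<close>, the formulas persist at the remaining points.\<close>

lemma kruskal_chart:
  fixes north :: bool
  assumes X: "X \<in> \<Omega>"
  defines "C \<equiv> bl_of_kruskal m a \<Phi>t \<Psi>t \<circ> angular north"
  shows "matrix_inv (kerr_in_chart m a C X) = HK X"
    and "vol_density (kerr_in_chart m a C) X = rho_sq a (rX X) X * sphere_factor X / (\<kappa> * kp' (rX X))"
proof -
  have dn: "det (HK X) \<noteq> 0"
    unfolding det_HK[OF X]
    using kappa_pos kp'_pos[OF rX(2)[OF X]] rho_sq_pos[OF rX(3)[OF X], of a X] sphere_factor_pos[of X] by simp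
  have lim: "X islimpt {Y. mu m a (C Y $ 2) \<noteq> 0 \<and> chart_z Y \<notin> \<real>\<^sub>\<le>\<^sub>0}"
    by (rule islimpt_regular_points[OF open_Omega X, of 0]) (auto simp: C_def bl_of_kruskal_r[unfolded comp_def] mu_rX_iff)
  have inv: "(\<chi> i j. kerr_metric m a (C Y) (frechet_derivative C (at Y) (axis i 1)) (frechet_derivative C (at Y) (axis j 1))) ** HK Y = mat 1"
    if Y: "Y \<in> \<Omega>" "mu m a (C Y $ 2) \<noteq> 0" "chart_z Y \<notin> \<real>\<^sub>\<le>\<^sub>0" for Y
  proof -
    have \<mu>: "mu m a (rX Y) \<noteq> 0" using Y(2) by (simp add: C_def bl_of_kruskal_r[unfolded comp_def])
    then have y: "Y $ 1 \<noteq> 0" "Y $ 2 \<noteq> 0" "rX Y \<noteq> rp" using mu_rX_iff[OF Y(1)] rX_eq_rp_iff[OF Y(1)] by auto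
    define W where "W = \<Omega> \<inter> {Y. Y $ 1 \<noteq> 0} \<inter> {Y. Y $ 2 \<noteq> 0}"
    have W: "open W" "Y \<in> W"
      unfolding W_def using y Y by (auto intro!: open_Int open_Omega open_Collect_neq continuous_intros)
    define L where "L = kruskal_jacobian \<kappa> \<omega> (kp' (rX Y)) Y"
    have "(\<chi> i j. kerr_metric m a (C Y) (frechet_derivative C (at Y) (axis i 1)) (frechet_derivative C (at Y) (axis j 1)))
      = transpose L ** ingoing_metric m a (rX Y) Y ** L"
    proof (rule kerr_pullback[OF W _ _ has_derivative_rX[OF Y(1)] DERIV_Phi_Psi[OF rX(2)[OF Y(1)] y(3)] Y(3) \<mu>])
      show "C Y = vector [(\<lambda>Y. ln \<bar>Y $ 1\<bar> / \<kappa>) Y + Phi_of m a \<Phi>t (rX Y), rX Y, Arg (chart_z Y) + \<omega> * (\<lambda>Y. ln \<bar>Y $ 1\<bar> / \<kappa>) Y + Psi_of m a \<Psi>t (rX Y),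
        sphere_theta north (chart_z Y)]" if "Y \<in> W" for Y
        unfolding C_def using that by (intro bl_of_kruskal_eq[THEN trans]) (auto simp: W_def)
      have "((\<lambda>Y. ln \<bar>Y $ 1\<bar>) has_derivative (\<lambda>v. v $ 1 / Y $ 1)) (at Y)"
      proof (cases "Y $ 1 > 0")
        case True
        have o: "open {Y::real^4. Y $ 1 > 0}" by (intro open_Collect_less continuous_intros)
        have "((\<lambda>Y. ln (Y $ 1)) has_derivative (\<lambda>v. v $ 1 / Y $ 1)) (at Y)"
          using has_derivative_ln[OF True bounded_linear_imp_has_derivative[OF bounded_linear_vec_nth]] by (simp add: divide_inverse)
        then show ?thesis
          by (rule has_derivative_transform_within_open[OF _ o]) (use True in auto)
      next
        case False
        then have neg: "0 < - Y $ 1" using y by simp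
        have o: "open {Y::real^4. Y $ 1 < 0}" by (intro open_Collect_less continuous_intros)
        have "((\<lambda>Y. ln (- Y $ 1)) has_derivative (\<lambda>v. v $ 1 / Y $ 1)) (at Y)"
          using has_derivative_ln[OF neg has_derivative_minus[OF bounded_linear_imp_has_derivative[OF bounded_linear_vec_nth]]] by (simp add: divide_inverse)
        then show ?thesis
          by (rule has_derivative_transform_within_open[OF _ o]) (use neg in auto)
      qed
      from bounded_linear.has_derivative[OF bounded_linear_divide this, of \<kappa>]
      show "((\<lambda>Y. ln \<bar>Y $ 1\<bar> / \<kappa>) has_derivative (\<lambda>v. v $ 1 / Y $ 1 / \<kappa>)) (at Y)" .
      show "rho_sq a (rX Y) Y \<noteq> 0" using rho_sq_pos[OF rX(3)[OF Y(1)]] by (metis less_irrefl)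
      have "\<forall>j. L $ 1 $ j = axis j 1 $ 1 / Y $ 1 / \<kappa> \<and> L $ 2 $ j = (Y $ 2 * axis j 1 $ 1 + Y $ 1 * axis j 1 $ 2) / kp' (rX Y) \<and>
         L $ 3 $ j = axis j 1 $ 3 - \<omega> * Y $ 4 * (axis j 1 $ 1 / Y $ 1 / \<kappa>) \<and> L $ 4 $ j = axis j 1 $ 4 + \<omega> * Y $ 3 * (axis j 1 $ 1 / Y $ 1 / \<kappa>)"
        unfolding L_def kruskal_jacobian_def by (simp add: forall_4 mult.commute)
      then show "L $ 1 $ j = axis j 1 $ 1 / Y $ 1 / \<kappa>" "L $ 2 $ j = (Y $ 2 * axis j 1 $ 1 + Y $ 1 * axis j 1 $ 2) / kp' (rX Y)"
         "L $ 3 $ j = axis j 1 $ 3 - \<omega> * Y $ 4 * (axis j 1 $ 1 / Y $ 1 / \<kappa>)" "L $ 4 $ j = axis j 1 $ 4 + \<omega> * Y $ 3 * (axis j 1 $ 1 / Y $ 1 / \<kappa>)" for j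
        by blast+
    qed
    then show ?thesis
      unfolding HK_def L_def
      using kruskal_metric_inverse(1)[OF y(1), of \<kappa> "kp' (rX Y)" a "rX Y" m "qq (rX Y)" \<omega>] kappa_pos kp'_pos[OF rX(2)[OF Y(1)]]
        rho_sq_pos[OF rX(3)[OF Y(1)], of a Y] mu_kp'[OF rX(2)[OF Y(1)]] rX(4)[OF Y(1)] qq_kp[of "rX Y"]
      by simp
  qed
  show "matrix_inv (kerr_in_chart m a C X) = HK X"
    by (rule kerr_in_chart_eqI(1)[OF open_Omega X lim smooth_on_continuous[OF smooth_on_HK] dn inv]; assumption)
  have "\<bar>1 / - (u / w)\<^sup>2\<bar> = (w / u)\<^sup>2" for u w :: real by (simp add: power_divide)
  then have s: "sqrt \<bar>1 / - (u / w)\<^sup>2\<bar> = \<bar>w / u\<bar>" for u w :: real by simp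
  have "vol_density (kerr_in_chart m a C) X = sqrt \<bar>1 / det (HK X)\<bar>"
    by (rule kerr_in_chart_eqI(2)[OF open_Omega X lim smooth_on_continuous[OF smooth_on_HK] dn inv]; assumption)
  then show "vol_density (kerr_in_chart m a C) X = rho_sq a (rX X) X * sphere_factor X / (\<kappa> * kp' (rX X))"
    unfolding det_HK[OF X] s
    using kappa_pos kp'_pos[OF rX(2)[OF X]] rho_sq_pos[OF rX(3)[OF X], of a X] sphere_factor_pos[of X]
    by (simp add: abs_mult)
qed

lemma det_ingoing_inverse:
  assumes "rho_sq a r X \<noteq> 0"
  shows "det (ingoing_inverse m a r X) = - 1 / (rho_sq a r X * sphere_factor X)\<^sup>2"
proof -
  have "det (ingoing_metric m a r X) * det (ingoing_inverse m a r X) = 1"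
    using arg_cong[OF ingoing_metric_inverse[OF assms], of det] by (simp add: det_mul)
  then show ?thesis
    using assms sphere_factor_pos[of X] by (simp add: det_ingoing_metric field_simps)
qed

lemma ingoing_chart:
  fixes north :: bool
  assumes X: "X $ 2 > rm"
  defines "C \<equiv> bl_of_ingoing m a \<Phi>t \<Psi>t \<circ> angular north"
  shows "matrix_inv (kerr_in_chart m a C X) = ingoing_inverse m a (X $ 2) X"
    and "vol_density (kerr_in_chart m a C) X = rho_sq a (X $ 2) X * sphere_factor X"
proof -
  define W where "W = {X::real^4. X $ 2 > rm}"
  have W: "open W" "X \<in> W" unfolding W_def using X by (auto intro!: open_Collect_less continuous_intros)
  have \<rho>: "rho_sq a (Y $ 2) Y > 0" if "Y \<in> W" for Y
    using that rm_nonneg by (intro rho_sq_pos) (auto simp: W_def)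
  have dn: "det (ingoing_inverse m a (X $ 2) X) \<noteq> 0"
    using \<rho>[OF W(2)] sphere_factor_pos[of X] by (subst det_ingoing_inverse) auto
  have C2: "C Y $ 2 = Y $ 2" for Y by (simp add: C_def bl_of_ingoing_def angular_def)
  have \<mu>: "mu m a (Y $ 2) = 0 \<longleftrightarrow> Y $ 2 = rp" if "Y \<in> W" for Y
    using that by (auto simp: W_def mu_factor)
  have lim: "X islimpt {Y. mu m a (C Y $ 2) \<noteq> 0 \<and> chart_z Y \<notin> \<real>\<^sub>\<le>\<^sub>0}"
    by (rule islimpt_regular_points[OF W, of rp]) (auto simp: C2 \<mu>)
  have c: "continuous_on W (\<lambda>Y. ingoing_inverse m a (Y $ 2) Y $ i $ j)" for i j
  proof -
    have r: "continuous_on W (\<lambda>Y. 1 / rho_sq a (Y $ 2) Y)"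
      unfolding rho_sq_def
      by (intro continuous_intros smooth_on_continuous[OF smooth_on_sin_sq[OF W(1)]])
         (use \<rho> in \<open>force simp: rho_sq_def\<close>)
    have nz: "sphere_factor X \<noteq> 0" for X using sphere_factor_pos[of X] by simp
    have "\<forall>i j. continuous_on W (\<lambda>Y. ingoing_inverse m a (Y $ 2) Y $ i $ j)"
      unfolding ingoing_inverse_def forall_4 vec_lambda_beta vector_4 mu_def
      by (intro conjI continuous_on_mult[OF r] continuous_intros smooth_on_continuous[OF smooth_on_sin_sq[OF W(1)]]
          smooth_on_continuous[OF smooth_on_sphere_factor[OF W(1)]] ballI nz)
    then show ?thesis by blast
  qed
  have inv: "(\<chi> i j. kerr_metric m a (C Y) (frechet_derivative C (at Y) (axis i 1)) (frechet_derivative C (at Y) (axis j 1)))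
      ** ingoing_inverse m a (Y $ 2) Y = mat 1"
    if Y: "Y \<in> W" "mu m a (C Y $ 2) \<noteq> 0" "chart_z Y \<notin> \<real>\<^sub>\<le>\<^sub>0" for Y
  proof -
    have y: "mu m a (Y $ 2) \<noteq> 0" "Y $ 2 \<noteq> rp" "Y $ 2 > rm" using Y \<mu> by (auto simp: C2 W_def)
    have "(\<chi> i j. kerr_metric m a (C Y) (frechet_derivative C (at Y) (axis i 1)) (frechet_derivative C (at Y) (axis j 1)))
      = transpose (mat 1) ** ingoing_metric m a (Y $ 2) Y ** mat 1"
    proof (rule kerr_pullback[OF W(1) Y(1) _ bounded_linear_imp_has_derivative[OF bounded_linear_vec_nth]
          bounded_linear_imp_has_derivative[OF bounded_linear_vec_nth] DERIV_Phi_Psi[OF y(3,2)] Y(3) y(1), where \<omega> = 0])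
      show "C Y = vector [Y $ 1 + Phi_of m a \<Phi>t (Y $ 2), Y $ 2, Arg (chart_z Y) + 0 * Y $ 1 + Psi_of m a \<Psi>t (Y $ 2), sphere_theta north (chart_z Y)]"
        if "Y \<in> W" for Y by (simp add: C_def bl_of_ingoing_def angular_def)
      show "rho_sq a (Y $ 2) Y \<noteq> 0" using \<rho>[OF Y(1)] by simp
    qed (auto simp: mat_def axis_def)
    then show ?thesis
      using ingoing_metric_inverse[of a "Y $ 2" Y m] \<rho>[OF Y(1)] by (simp add: transpose_mat)
  qed
  show "matrix_inv (kerr_in_chart m a C X) = ingoing_inverse m a (X $ 2) X"
    by (rule kerr_in_chart_eqI(1)[of W X m a C "\<lambda>X. ingoing_inverse m a (X $ 2) X", OF W lim c dn inv]; assumption)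
  have "\<bar>1 / (- 1 / w\<^sup>2)\<bar> = w\<^sup>2" for w :: real by (simp add: power_divide)
  then have s: "sqrt \<bar>1 / (- 1 / w\<^sup>2)\<bar> = \<bar>w\<bar>" for w :: real by simp
  have "vol_density (kerr_in_chart m a C) X = sqrt \<bar>1 / det (ingoing_inverse m a (X $ 2) X)\<bar>"
    by (rule kerr_in_chart_eqI(2)[of W X m a C "\<lambda>X. ingoing_inverse m a (X $ 2) X", OF W lim c dn inv]; assumption)
  then show "vol_density (kerr_in_chart m a C) X = rho_sq a (X $ 2) X * sphere_factor X"
    unfolding det_ingoing_inverse[OF less_imp_neq[OF \<rho>[OF W(2)], symmetric]] s
    using \<rho>[OF W(2)] sphere_factor_pos[of X] by (simp add: abs_mult)
qed

end

section \<open>Functions of \<open>r\<close> and a complex coordinate on the sphere\<close>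

definition D_r :: "(real \<times> complex \<Rightarrow> complex) \<Rightarrow> real \<times> complex \<Rightarrow> complex" where
  "D_r g p = frechet_derivative g (at p) (1, 0)"

definition D_x :: "(real \<times> complex \<Rightarrow> complex) \<Rightarrow> real \<times> complex \<Rightarrow> complex" where
  "D_x g p = frechet_derivative g (at p) (0, 1)"

definition D_y :: "(real \<times> complex \<Rightarrow> complex) \<Rightarrow> real \<times> complex \<Rightarrow> complex" where
  "D_y g p = frechet_derivative g (at p) (0, \<i>)"

lemma smooth_on_D:
  assumes "smooth_on S g"
  shows "smooth_on S (D_r g)" "smooth_on S (D_x g)" "smooth_on S (D_y g)"
  unfolding D_r_def[abs_def] D_x_def[abs_def] D_y_def[abs_def]
  by (rule smooth_on_frechet_derivative[OF assms])+

lemma frechet_derivative_D: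
  assumes "smooth_on S g" "p \<in> S"
  shows "frechet_derivative g (at p) (s, v) = s *\<^sub>R D_r g p + Re v *\<^sub>R D_x g p + Im v *\<^sub>R D_y g p"
proof -
  interpret bounded_linear "frechet_derivative g (at p)"
    by (rule has_derivative_bounded_linear[OF smooth_on_has_derivative[OF assms]])
  have "(s, v) = s *\<^sub>R (1, 0) + Re v *\<^sub>R (0, 1) + Im v *\<^sub>R (0, \<i>)"
    by (simp add: complex_eq_iff)
  then have "frechet_derivative g (at p) (s, v) = frechet_derivative g (at p) (s *\<^sub>R (1, 0) + Re v *\<^sub>R (0, 1) + Im v *\<^sub>R (0, \<i>))"
    by (rule arg_cong)
  then show ?thesis by (simp only: add scale D_r_def D_x_def D_y_def)
qed

lemma chart_z_sel: "Re (chart_z X) = X $ 3" "Im (chart_z X) = X $ 4"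
  by (simp_all add: chart_z_def)

lemma has_derivative_sphere_function:
  fixes X :: "real^4"
  assumes "smooth_on S g" "(\<rho> X, chart_z X) \<in> S" "(\<rho> has_derivative \<rho>') (at X)"
  shows "((\<lambda>X. g (\<rho> X, chart_z X)) has_derivative
    (\<lambda>h. of_real (\<rho>' h) * D_r g (\<rho> X, chart_z X) + of_real (h $ 3) * D_x g (\<rho> X, chart_z X)
      + of_real (h $ 4) * D_y g (\<rho> X, chart_z X))) (at X)"
proof -
  have "((\<lambda>X. (\<rho> X, chart_z X)) has_derivative (\<lambda>h. (\<rho>' h, chart_z h))) (at X)"
    by (rule has_derivative_Pair[OF assms(3) bounded_linear_imp_has_derivative[OF chart_z_linear]])
  from has_derivative_compose[OF this smooth_on_has_derivative[OF assms(1,2)]]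
  show ?thesis
    by (rule has_derivative_eq_rhs)
       (simp add: fun_eq_iff frechet_derivative_D[OF assms(1,2)] chart_z_sel scaleR_conv_of_real)
qed

text \<open>Dependence on the angle through e^{-ik\<phi>}, expressed by rotations of z so as to
  include the pole z = 0, where the angle is undefined.\<close>

definition equivariant :: "int \<Rightarrow> real \<Rightarrow> (real \<times> complex \<Rightarrow> complex) \<Rightarrow> bool" where
  "equivariant k r0 g \<longleftrightarrow> (\<forall>r>r0. \<forall>z \<beta>.
     g (r, exp (\<i> * of_real \<beta>) * z) = exp (- \<i> * of_int k * of_real \<beta>) * g (r, z))"

text \<open>The derivative of the equivariance at \<beta> = 0. In the equations below it takes the
  place of differentiation in \<phi>, on the axis as well.\<close>

lemma equivariant_rotation:
  assumes "equivariant k r0 g" "smooth_on ({r0<..} \<times> UNIV) g" "r > r0"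
  shows "of_real (Re z) * D_y g (r, z) - of_real (Im z) * D_x g (r, z) = - \<i> * of_int k * g (r, z)"
proof -
  have p: "(r, z) \<in> {r0<..} \<times> UNIV" using assms(3) by simp
  have "((\<lambda>\<beta>. exp (\<i> * of_real \<beta>) * z) has_derivative (\<lambda>h. of_real h * (\<i> * z))) (at 0)"
    by (rule has_derivative_eq_rhs[OF has_derivative_mult_left[OF has_derivative_compose[OF
          has_derivative_mult_right[OF has_derivative_of_real[OF has_derivative_ident]] DERIV_exp[unfolded has_field_derivative_def]]]])
       (simp add: fun_eq_iff)
  then have c: "((\<lambda>\<beta>. (r, exp (\<i> * of_real \<beta>) * z)) has_derivative (\<lambda>h. (0, of_real h * (\<i> * z)))) (at 0)"
    by (rule has_derivative_Pair[OF has_derivative_const])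
  have g: "(g has_derivative frechet_derivative g (at (r, z))) (at (r, exp (\<i> * of_real 0) * z))"
    using smooth_on_has_derivative[OF assms(2) p] by simp
  have 1: "((\<lambda>\<beta>. g (r, exp (\<i> * of_real \<beta>) * z)) has_derivative
     (\<lambda>h. frechet_derivative g (at (r, z)) (0, of_real h * (\<i> * z)))) (at 0)"
    by (rule has_derivative_compose[OF c g])
  have 2: "((\<lambda>\<beta>. exp (- \<i> * of_int k * of_real \<beta>) * g (r, z)) has_derivative
     (\<lambda>h. of_real h * (- \<i> * of_int k * g (r, z)))) (at 0)"
    by (rule has_derivative_eq_rhs[OF has_derivative_mult_left[OF has_derivative_compose[OF
          has_derivative_mult_right[OF has_derivative_of_real[OF has_derivative_ident]] DERIV_exp[unfolded has_field_derivative_def]]]])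
       (simp add: fun_eq_iff)
  have "(\<lambda>\<beta>. g (r, exp (\<i> * of_real \<beta>) * z)) = (\<lambda>\<beta>. exp (- \<i> * of_int k * of_real \<beta>) * g (r, z))"
    using assms(1,3) unfolding equivariant_def by blast
  from has_derivative_unique[OF 1[unfolded this] 2]
  have "frechet_derivative g (at (r, z)) (0, of_real 1 * (\<i> * z)) = of_real 1 * (- \<i> * of_int k * g (r, z))"
    by metis
  then show ?thesis
    by (simp add: frechet_derivative_D[OF assms(2) p] scaleR_conv_of_real)
qed

text \<open>Rotations leave r alone, so the equivariance can be differentiated in r.\<close>

lemma equivariant_D_r:
  assumes "equivariant k r0 g" "smooth_on ({r0<..} \<times> UNIV) g"
  shows "equivariant k r0 (D_r g)"
  unfolding equivariant_def
proof (intro allI impI)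
  fix r z \<beta> assume r: "r0 < r"
  define e where "e = exp (\<i> * complex_of_real \<beta>)"
  define c where "c = exp (- \<i> * of_int k * complex_of_real \<beta>)"
  have d: "((\<lambda>r. g (r, \<zeta>)) has_derivative (\<lambda>h. of_real h * D_r g (r, \<zeta>))) (at r)" for \<zeta>
  proof -
    have "((\<lambda>r. (r, \<zeta>)) has_derivative (\<lambda>h. (h, 0))) (at r)"
      by (rule has_derivative_Pair[OF has_derivative_ident has_derivative_const])
    from has_derivative_compose[OF this smooth_on_has_derivative[OF assms(2)]] r
    show ?thesis
      by (simp add: frechet_derivative_D[OF assms(2)] scaleR_conv_of_real)
  qed
  have "((\<lambda>r. g (r, e * z)) has_derivative (\<lambda>h. c * (of_real h * D_r g (r, z)))) (at r)"
    by (rule has_derivative_transform_within_open[OF has_derivative_mult_right[OF d] open_greaterThan])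
       (use r assms(1) in \<open>auto simp: equivariant_def e_def c_def\<close>)
  from has_derivative_unique[OF d this] have "of_real 1 * D_r g (r, e * z) = c * (of_real 1 * D_r g (r, z))"
    by metis
  then show "D_r g (r, exp (\<i> * of_real \<beta>) * z) = exp (- \<i> * of_int k * of_real \<beta>) * D_r g (r, z)"
    by (simp add: e_def c_def)
qed

text \<open>\<open>Arg\<close> is additive only modulo 2\<pi>; the jumps disappear in the
  exponential because \<open>k\<close> is an integer.\<close>

lemma exp_Arg_rotation:
  assumes "z \<noteq> 0"
  shows "exp (- \<i> * of_int k * of_real (Arg (exp (\<i> * of_real \<beta>) * z)))
    = exp (- \<i> * of_int k * of_real \<beta>) * exp (- \<i> * of_int k * of_real (Arg z))"
proof -
  let ?z = "exp (\<i> * of_real \<beta>) * z"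
  have "of_real (norm z) * exp (\<i> * of_real (Arg ?z)) = ?z"
    using Arg_eq[of ?z] assms by (simp add: norm_mult)
  also have "\<dots> = of_real (norm z) * (exp (\<i> * of_real \<beta>) * exp (\<i> * of_real (Arg z)))"
    using Arg_eq[OF assms] by (metis mult.left_commute)
  finally have "exp (\<i> * of_real (Arg ?z)) = exp (\<i> * of_real \<beta> + \<i> * of_real (Arg z))"
    using assms by (simp add: exp_add)
  then obtain n :: int where n: "\<i> * of_real (Arg ?z) = \<i> * of_real \<beta> + \<i> * of_real (Arg z) + of_int (2 * n) * pi * \<i>"
    unfolding exp_eq by blast
  have "- \<i> * of_int k * of_real (Arg ?z) = - of_int k * (\<i> * of_real (Arg ?z))" by simp
  also have "\<dots> = (- \<i> * of_int k * of_real \<beta> + - \<i> * of_int k * of_real (Arg z)) + of_int (2 * (- k * n)) * pi * \<i>"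
    unfolding n by (simp add: algebra_simps)
  finally have "exp (- \<i> * of_int k * of_real (Arg ?z)) = exp (- \<i> * of_int k * of_real \<beta> + - \<i> * of_int k * of_real (Arg z))"
    unfolding exp_eq by blast
  then show ?thesis by (simp only: exp_add)
qed

definition sphere_mode :: "int \<Rightarrow> (real \<Rightarrow> real \<Rightarrow> complex) \<Rightarrow> bool \<Rightarrow> real \<times> complex \<Rightarrow> complex" where
  "sphere_mode k f north = (\<lambda>(r, z). exp (- \<i> * of_int k * complex_of_real (Arg z)) * f r (sphere_theta north z))"

lemma equivariant_sphere_mode:
  assumes "smooth_on_shells r0 k f"
  shows "equivariant k r0 (sphere_mode k f north)"
  unfolding equivariant_def
proof (intro allI impI)
  fix r z \<beta> assume r: "r0 < r"
  define e where "e = exp (\<i> * complex_of_real \<beta>)"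
  define c where "c = exp (- \<i> * of_int k * complex_of_real \<beta>)"
  define d where "d z = sphere_mode k f north (r, e * z) - c * sphere_mode k f north (r, z)" for z
  have d0: "d z = 0" if "z \<noteq> 0" for z
  proof -
    have "sphere_theta north (e * z) = sphere_theta north z"
      by (simp add: sphere_theta_def norm_mult e_def)
    then show ?thesis
      using exp_Arg_rotation[OF that, of k \<beta>] by (simp add: d_def sphere_mode_def e_def c_def)
  qed
  have sm: "smooth_on ({r0<..} \<times> UNIV) (sphere_mode k f north)"
    using assms by (simp add: smooth_on_shells_def sphere_mode_def)
  \<comment> \<open>At the pole the value of \<open>Arg\<close> is a mere convention; the identity
    is carried there from z \<noteq> 0 by continuity of the mode.\<close>
  have "continuous_on UNIV d"
    unfolding d_def
    by (intro continuous_intros continuous_on_compose2[OF smooth_on_continuous[OF sm]]) (use r in auto)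
  then have "(d \<longlongrightarrow> d 0) (at 0)" by (simp add: continuous_on_eq_continuous_at isCont_def)
  moreover have "(d \<longlongrightarrow> 0) (at 0)"
    by (rule tendsto_eventually) (auto simp: eventually_at_filter d0)
  ultimately have "d 0 = 0" by (rule tendsto_unique[rotated]) simp
  then have "d z = 0" using d0 by (cases "z = 0") auto
  then show "sphere_mode k f north (r, exp (\<i> * of_real \<beta>) * z) = exp (- \<i> * of_int k * of_real \<beta>) * sphere_mode k f north (r, z)"
    by (simp add: d_def e_def c_def)
qed

lemma has_derivative_sphere_factor:
  "((\<lambda>X. complex_of_real (sphere_factor X)) has_derivative (\<lambda>h. of_real (- 16 / (1 + (X $ 3)\<^sup>2 + (X $ 4)\<^sup>2) ^ 3 * (X $ 3 * h $ 3 + X $ 4 * h $ 4)))) (at X)"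
proof -
  have nz: "1 + (X $ 3)\<^sup>2 + (X $ 4)\<^sup>2 \<noteq> 0" by (smt (verit) zero_le_power2)
  have "((\<lambda>X. 1 + X $ 3 * X $ 3 + X $ 4 * X $ 4) has_derivative (\<lambda>h. 2 * (X $ 3 * h $ 3 + X $ 4 * h $ 4))) (at X)"
    by (rule has_derivative_eq_rhs[OF has_derivative_add[OF has_derivative_add[OF has_derivative_const
          has_derivative_mult[OF bounded_linear_imp_has_derivative[OF bounded_linear_vec_nth] bounded_linear_imp_has_derivative[OF bounded_linear_vec_nth]]]
          has_derivative_mult[OF bounded_linear_imp_has_derivative[OF bounded_linear_vec_nth] bounded_linear_imp_has_derivative[OF bounded_linear_vec_nth]]]])
       (simp add: fun_eq_iff)
  then have q: "((\<lambda>X. 1 + (X $ 3)\<^sup>2 + (X $ 4)\<^sup>2) has_derivative (\<lambda>h. 2 * (X $ 3 * h $ 3 + X $ 4 * h $ 4))) (at X)"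
    by (simp add: power2_eq_square)
  have "((\<lambda>u. 4 / u\<^sup>2) has_real_derivative - 8 / u ^ 3) (at u)" if "u \<noteq> 0" for u :: real
    using that by (auto intro!: derivative_eq_intros simp: field_simps eval_nat_numeral)
  from has_derivative_compose[OF q this[OF nz, unfolded has_field_derivative_def]]
  have "(sphere_factor has_derivative (\<lambda>h. - 16 / (1 + (X $ 3)\<^sup>2 + (X $ 4)\<^sup>2) ^ 3 * (X $ 3 * h $ 3 + X $ 4 * h $ 4))) (at X)"
    unfolding sphere_factor_def[abs_def] by (rule has_derivative_eq_rhs) (simp add: fun_eq_iff)
  then show ?thesis by (rule has_derivative_of_real)
qed

lemma has_derivative_sin_sq:
  "((\<lambda>X. complex_of_real (sin_sq X)) has_derivative (\<lambda>h. of_real ((2 * sphere_factor X - 16 / (1 + (X $ 3)\<^sup>2 + (X $ 4)\<^sup>2) ^ 3 * ((X $ 3)\<^sup>2 + (X $ 4)\<^sup>2)) * (X $ 3 * h $ 3 + X $ 4 * h $ 4)))) (at X)"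
proof -
  have "((\<lambda>X. X $ 3 * X $ 3 + X $ 4 * X $ 4) has_derivative (\<lambda>h. 2 * (X $ 3 * h $ 3 + X $ 4 * h $ 4))) (at X)"
    by (rule has_derivative_eq_rhs[OF has_derivative_add[OF
          has_derivative_mult[OF bounded_linear_imp_has_derivative[OF bounded_linear_vec_nth] bounded_linear_imp_has_derivative[OF bounded_linear_vec_nth]]
          has_derivative_mult[OF bounded_linear_imp_has_derivative[OF bounded_linear_vec_nth] bounded_linear_imp_has_derivative[OF bounded_linear_vec_nth]]]])
       (simp add: fun_eq_iff)
  then have "((\<lambda>X. complex_of_real ((X $ 3)\<^sup>2 + (X $ 4)\<^sup>2)) has_derivative (\<lambda>h. of_real (2 * (X $ 3 * h $ 3 + X $ 4 * h $ 4)))) (at X)"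
    by (intro has_derivative_of_real) (simp add: power2_eq_square)
  from has_derivative_mult[OF has_derivative_sphere_factor this] show ?thesis
    unfolding sin_sq_def[abs_def] of_real_mult
    by (rule has_derivative_eq_rhs) (simp add: fun_eq_iff algebra_simps)
qed

lemma has_derivative_coordinate:
  "((\<lambda>X::real^'n. complex_of_real (X $ i)) has_derivative (\<lambda>h. of_real (h $ i))) (at X)"
  by (rule has_derivative_of_real[OF bounded_linear_imp_has_derivative[OF bounded_linear_vec_nth]])

lemma has_derivative_real_function:
  assumes "(g has_real_derivative g') (at (\<rho> X))" "(\<rho> has_derivative \<rho>') (at X)"
  shows "((\<lambda>X. complex_of_real (g (\<rho> X))) has_derivative (\<lambda>h. of_real (g' * \<rho>' h))) (at X)"
  using has_derivative_of_real[OF has_derivative_compose[OF assms(2) assms(1)[unfolded has_field_derivative_def]]] .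

section \<open>Identities for the flux of a mode in Kruskal coordinates\<close>

text \<open>Here \<open>G\<close>, \<open>ki\<close>, \<open>xi\<close>, \<open>si\<close> are the
  inverses of \<open>pd\<close> = p', \<kappa>, \<open>x\<close> = x_1 and \<open>s\<close>, given
  by polynomial relations so that Groebner bases apply; \<open>P\<close> is x_1^\<alpha>,
  \<open>W\<close> the mode with its derivatives, \<open>j\<close> the imaginary unit. In this first
  component the terms with \<open>y\<close> cancel, and x_1 G P times the t_*-component of the
  ingoing flux remains.\<close>

lemma kruskal_flux_1:
  fixes x :: complex
  assumes "pd * G = 1" "\<kappa> * ki = 1" "x * xi = 1" "\<kappa> * \<alpha> = - j * (\<sigma> + k * \<omega>)" "X3 * Wy - X4 * Wx = - j * k * W"
  shows "s * G * ki * (a^2 * S * \<kappa>^2 * x^2) * (P * (\<alpha> * W * xi + y * G * Wr)) + s * G * ki * (\<kappa> * f * pd - a^2 * S * \<kappa>^2 * x * y) * (P * (x * G * Wr))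
    + s * G * ki * (- (X4 * \<kappa> * x * (a - a^2*S*\<omega>))) * (P * Wx) + s * G * ki * (X3 * \<kappa> * x * (a - a^2*S*\<omega>)) * (P * Wy)
    = P * x * G * s * (f * Wr + (- j * \<sigma> * a^2 * S - j * k * a) * W)"
  using assms by algebra

lemma kruskal_flux_2:
  fixes x :: complex
  assumes "pd * G = 1" "\<kappa> * ki = 1" "x * xi = 1" "\<kappa> * \<alpha> = - j * (\<sigma> + k * \<omega>)" "X3 * Wy - X4 * Wx = - j * k * W"
  shows "s * G * ki * (\<kappa> * f * pd - a^2 * S * \<kappa>^2 * x * y) * (P * (\<alpha> * W * xi + y * G * Wr)) + s * G * ki * (a^2 * S * \<kappa>^2 * y^2) * (P * (x * G * Wr))
    + s * G * ki * (- (X4 * (y * q * pd - \<kappa> * y * (a - a^2*S*\<omega>)))) * (P * Wx) + s * G * ki * (X3 * (y * q * pd - \<kappa> * y * (a - a^2*S*\<omega>))) * (P * Wy)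
    = P * s * (f * \<alpha> * W * xi + y * f * G * Wr - j * k * ki * y * q * W - y * G * (- j * \<sigma> * a^2 * S - j * k * a) * W)"
  using assms by algebra

lemma kruskal_flux_3:
  fixes x :: complex
  assumes "pd * G = 1" "\<kappa> * ki = 1" "x * xi = 1" "\<kappa> * \<alpha> = - j * (\<sigma> + k * \<omega>)" "X3 * Wy - X4 * Wx = - j * k * W" "s * si = 1"
  shows "s * G * ki * (- (X4 * \<kappa> * x * (a - a^2*S*\<omega>))) * (P * (\<alpha> * W * xi + y * G * Wr)) + s * G * ki * (- (X4 * (y * q * pd - \<kappa> * y * (a - a^2*S*\<omega>)))) * (P * (x * G * Wr))
    + s * G * ki * (si + X4^2 * (a^2*S*\<omega>^2 - 2*a*\<omega>)) * (P * Wx) + s * G * ki * (- (X3 * X4 * (a^2*S*\<omega>^2 - 2*a*\<omega>))) * (P * Wy)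
    = P * (G * ki * Wx - X4 * (s * G * ki * (x * y * q * Wr + (- j * \<sigma> * (a - a^2*S*\<omega>) + j * k * a * \<omega>) * W)))"
  using assms by algebra

lemma kruskal_flux_4:
  fixes x :: complex
  assumes "pd * G = 1" "\<kappa> * ki = 1" "x * xi = 1" "\<kappa> * \<alpha> = - j * (\<sigma> + k * \<omega>)" "X3 * Wy - X4 * Wx = - j * k * W" "s * si = 1"
  shows "s * G * ki * (X3 * \<kappa> * x * (a - a^2*S*\<omega>)) * (P * (\<alpha> * W * xi + y * G * Wr)) + s * G * ki * (X3 * (y * q * pd - \<kappa> * y * (a - a^2*S*\<omega>))) * (P * (x * G * Wr))
    + s * G * ki * (- (X3 * X4 * (a^2*S*\<omega>^2 - 2*a*\<omega>))) * (P * Wx) + s * G * ki * (si + X3^2 * (a^2*S*\<omega>^2 - 2*a*\<omega>)) * (P * Wy)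
    = P * (G * ki * Wy + X3 * (s * G * ki * (x * y * q * Wr + (- j * \<sigma> * (a - a^2*S*\<omega>) + j * k * a * \<omega>) * W)))"
  using assms by algebra

text \<open>The four groups are the derivatives of the four fluxes by the chain rule, divided by
  \<open>P\<close>; since r depends on x_1 x_2, its derivatives are \<open>y * G\<close> and
  \<open>x * G\<close>. \<open>I\<close> is the mode equation in ingoing coordinates,
  \<open>mu2\<close> and \<open>q2\<close> are the r-derivatives of \<open>mu1\<close> and
  \<open>q1\<close>, and \<open>s34\<close>, \<open>S34\<close> express that the sphere factor and
  sin^2 \<theta> are radial in z.\<close>

lemma kruskal_divergence:
  fixes x :: complex
  assumes "pd * G = 1" "\<kappa> * ki = 1" "x * xi = 1" "\<kappa> * \<alpha> = - j * (\<sigma> + k * \<omega>)"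
    and mu1: "mm * pd = 2 * \<kappa> * f * (x * y)" and mu2: "mm' * pd + mm * pd2 = 2 * \<kappa> * (2 * r * (x * y) + f * pd)"
    and q1: "q * (x * y) = a - \<omega> * f" and q2: "q' * (x * y) + q * pd = - 2 * \<omega> * r"
    and rot1: "X3 * Wy - X4 * Wx = - j * k * W" and rot2: "X3 * Wry - X4 * Wrx = - j * k * Wr"
    and s34: "s3 * X4 = s4 * X3" and S34: "S3 * X4 = S4 * X3"
    and I: "s * (- j * \<sigma> * ((- j * \<sigma> * a^2 * S - j * k * a) * W + f * Wr) + mm' * Wr + mm * Wrr + (- 2 * j * \<sigma> * r) * W
        + (- j * \<sigma> * f - j * k * a) * Wr + a * (- j * k) * (Wr - j * \<sigma> * W)) + Wxx + Wyy = 0"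
  defines "M \<equiv> - j * \<sigma> * a^2 * S - j * k * a" and "bb \<equiv> - j * \<sigma> * (a - a^2*S*\<omega>) + j * k * a * \<omega>"
  shows "((\<alpha> + 1) * G * s * (f * Wr + M * W) + x * (- G * G * pd2 * (y * G)) * s * (f * Wr + M * W) + x * G * s * (y * G) * (2 * r * Wr + f * Wrr + M * Wr))
   + s * ((2 * r * (x * G)) * \<alpha> * W * xi + f * \<alpha> * (x * G) * Wr * xi + f * G * Wr + y * (2 * r * (x * G)) * G * Wr + y * f * (- G * G * pd2 * (x * G)) * Wr + y * f * G * (x * G) * Wrr
       - j * k * ki * (q * W + y * (q' * (x * G)) * W + y * q * (x * G) * Wr) - (G * M * W + y * (- G * G * pd2 * (x * G)) * M * W + y * G * M * (x * G) * Wr))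
   + (G * ki * Wxx - X4 * (s3 * G * ki * (x * y * q * Wr + bb * W) + s * G * ki * (x * y * q * Wrx + bb * Wx + (j * \<sigma> * a^2 * \<omega> * S3) * W)))
   + (G * ki * Wyy + X3 * (s4 * G * ki * (x * y * q * Wr + bb * W) + s * G * ki * (x * y * q * Wry + bb * Wy + (j * \<sigma> * a^2 * \<omega> * S4) * W))) = 0"
proof -
  \<comment> \<open>\<open>l\<close> is p/p' and \<open>e\<close> is p''/p'; in these quantities
    \<mu> and \<mu>' become polynomial.\<close>
  define l where "l = x * y * G"
  define e where "e = pd2 * G"
  have mm: "mm = 2 * \<kappa> * f * l" using assms(1) mu1 unfolding l_def by algebra
  have mm': "mm' = 2 * \<kappa> * (2 * r * l + f) - mm * e" using assms(1) mu2 unfolding l_def e_def by algebra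
  have q2': "(q' * (x * y) + q * pd) * G = - 2 * \<omega> * r * G" using q2 by simp
  have ka: "\<alpha> = - j * (\<sigma> + k * \<omega>) * ki" using assms(2,4) by algebra
  \<comment> \<open>Solving the mode equation for one second derivative turns it into a substitution
    for the final cancellation.\<close>
  have Wxx: "Wxx = - Wyy - s * (- j * \<sigma> * (M * W + f * Wr) + mm' * Wr + mm * Wrr + (- 2 * j * \<sigma> * r) * W
        + (- j * \<sigma> * f - j * k * a) * Wr + a * (- j * k) * (Wr - j * \<sigma> * W))" using I unfolding M_def by algebra
  have t12: "((\<alpha> + 1) * G * s * (f * Wr + M * W) + x * (- G * G * pd2 * (y * G)) * s * (f * Wr + M * W) + x * G * s * (y * G) * (2 * r * Wr + f * Wrr + M * Wr))
   + s * ((2 * r * (x * G)) * \<alpha> * W * xi + f * \<alpha> * (x * G) * Wr * xi + f * G * Wr + y * (2 * r * (x * G)) * G * Wr + y * f * (- G * G * pd2 * (x * G)) * Wr + y * f * G * (x * G) * Wrr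
       - j * k * ki * (q * W + y * (q' * (x * G)) * W + y * q * (x * G) * Wr) - (G * M * W + y * (- G * G * pd2 * (x * G)) * M * W + y * G * M * (x * G) * Wr))
   = G * ki * s * (- j * (\<sigma> + k * \<omega>) * (M * W + 2 * f * Wr + 2 * r * W) + \<kappa> * (2 * f * Wr + 2 * l * (2 * r * Wr + f * Wrr) - 2 * l * e * f * Wr) + 2 * j * k * \<omega> * r * W - j * k * (a - \<omega> * f) * Wr)"
    using assms(1-4) q1 q2 unfolding l_def e_def by algebra
  have t34: "(G * ki * Wxx - X4 * (s3 * G * ki * (x * y * q * Wr + bb * W) + s * G * ki * (x * y * q * Wrx + bb * Wx + (j * \<sigma> * a^2 * \<omega> * S3) * W)))
   + (G * ki * Wyy + X3 * (s4 * G * ki * (x * y * q * Wr + bb * W) + s * G * ki * (x * y * q * Wry + bb * Wy + (j * \<sigma> * a^2 * \<omega> * S4) * W)))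
   = G * ki * (Wxx + Wyy - s * j * k * ((a - \<omega> * f) * Wr + bb * W))"
    using q1 rot1 rot2 s34 S34 by algebra
  have "G * ki * s * (- j * (\<sigma> + k * \<omega>) * (M * W + 2 * f * Wr + 2 * r * W) + \<kappa> * (2 * f * Wr + 2 * l * (2 * r * Wr + f * Wrr) - 2 * l * e * f * Wr) + 2 * j * k * \<omega> * r * W - j * k * (a - \<omega> * f) * Wr)
     + G * ki * (Wxx + Wyy - s * j * k * ((a - \<omega> * f) * Wr + bb * W)) = 0"
    unfolding Wxx mm' mm M_def bb_def by algebra
  with t12 t34 show ?thesis by algebra
qed


section \<open>The mode equation\<close>

locale kerr_mode = kerr_region +
  fixes \<sigma> :: real and k :: int and us :: "real \<Rightarrow> real \<Rightarrow> complex" and north :: bool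
  assumes shells: "smooth_on_shells (rp - \<delta>) k us"
    and wave: "\<And>X. X $ 2 > rp - \<delta> \<Longrightarrow>
      wave_op (kerr_in_chart m a (bl_of_ingoing m a \<Phi>t \<Psi>t \<circ> angular north)) (mode_fun \<sigma> k us \<circ> angular north) X = 0"
begin

abbreviation "w \<equiv> sphere_mode k us north"
abbreviation "shell \<equiv> {rp - \<delta><..} \<times> (UNIV :: complex set)"

lemma smooth_w: "smooth_on shell w"
  using shells by (simp add: smooth_on_shells_def sphere_mode_def)

lemma rotation_w:
  assumes "r > rp - \<delta>"
  shows "of_real (X $ 3) * D_y w (r, chart_z X) - of_real (X $ 4) * D_x w (r, chart_z X) = - \<i> * of_int k * w (r, chart_z X)"
    and "of_real (X $ 3) * D_y (D_r w) (r, chart_z X) - of_real (X $ 4) * D_x (D_r w) (r, chart_z X) = - \<i> * of_int k * D_r w (r, chart_z X)"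
  using equivariant_rotation[OF equivariant_sphere_mode[OF shells] smooth_w assms, of "chart_z X"]
    equivariant_rotation[OF equivariant_D_r[OF equivariant_sphere_mode[OF shells] smooth_w] smooth_on_D(1)[OF smooth_w] assms, of "chart_z X"]
  by (simp_all add: chart_z_sel)

definition Et :: "real^4 \<Rightarrow> complex" where
  "Et X = exp (- \<i> * of_real \<sigma> * of_real (X $ 1))"

lemma has_derivative_Et: "(Et has_derivative (\<lambda>h. Et X * (- \<i> * of_real \<sigma> * of_real (h $ 1)))) (at X)"
  unfolding Et_def[abs_def]
  by (rule has_derivative_compose[OF has_derivative_mult_right[OF has_derivative_coordinate] DERIV_exp[unfolded has_field_derivative_def]])

lemma mode_fun_angular: "(mode_fun \<sigma> k us \<circ> angular north) X = Et X * w (X $ 2, chart_z X)"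
  by (simp add: mode_fun_def angular_def sphere_mode_def Et_def exp_diff exp_minus divide_inverse mult_ac)

lemma has_derivative_X2: "((\<lambda>X::real^4. X $ 2) has_derivative (\<lambda>h. h $ 2)) (at X)"
  by (rule bounded_linear_imp_has_derivative[OF bounded_linear_vec_nth])

lemma ingoing_coefficient:
  assumes "X $ 2 > rm"
  shows "vol_density (kerr_in_chart m a (bl_of_ingoing m a \<Phi>t \<Psi>t \<circ> angular north)) X *
      matrix_inv (kerr_in_chart m a (bl_of_ingoing m a \<Phi>t \<Psi>t \<circ> angular north) X) $ i $ j
    = sphere_factor X * (vector [
     vector [a\<^sup>2 * sin_sq X, (X $ 2)\<^sup>2 + a\<^sup>2, - (a * X $ 4), a * X $ 3],
     vector [(X $ 2)\<^sup>2 + a\<^sup>2, mu m a (X $ 2), - (a * X $ 4), a * X $ 3],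
     vector [- (a * X $ 4), - (a * X $ 4), 1 / sphere_factor X, 0],
     vector [a * X $ 3, a * X $ 3, 0, 1 / sphere_factor X]] :: real^4^4) $ i $ j"
  unfolding ingoing_chart[OF assms] ingoing_inverse_def vec_lambda_beta
  using rho_sq_pos[of "X $ 2" a X] assms rm_nonneg by simp

text \<open>This is \<open>\<Box>u = 0\<close> for \<open>u = e\<^sup>-\<^sup>i\<^sup>\<sigma>\<^sup>t w(r,z)\<close>, divided by \<open>e\<^sup>-\<^sup>i\<^sup>\<sigma>\<^sup>t\<close>.\<close>

lemma mode_equation:
  fixes X :: "real^4"
  assumes r: "r > rp - \<delta>"
  defines "p \<equiv> (r, chart_z X)"
  shows "of_real (sphere_factor X) * (- \<i> * of_real \<sigma> * ((- \<i> * of_real \<sigma> * of_real a ^ 2 * of_real (sin_sq X) - \<i> * of_int k * of_real a) * w p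
        + of_real (r\<^sup>2 + a\<^sup>2) * D_r w p) + of_real (2 * r - 2 * m) * D_r w p + of_real (mu m a r) * D_r (D_r w) p
        + (- 2 * \<i> * of_real \<sigma> * of_real r) * w p
        + (- \<i> * of_real \<sigma> * of_real (r\<^sup>2 + a\<^sup>2) - \<i> * of_int k * of_real a) * D_r w p
        + of_real a * (- \<i> * of_int k) * (D_r w p - \<i> * of_real \<sigma> * w p)) + D_x (D_x w) p + D_y (D_y w) p = 0"
proof -
  \<comment> \<open>A point over the same z with t_* = 0, where the time factor \<open>Et\<close>
    equals 1.\<close>
  define Y :: "real^4" where "Y = vector [0, r, X $ 3, X $ 4]"
  have Y: "Y $ 2 = r" "Y $ 3 = X $ 3" "Y $ 4 = X $ 4" "chart_z Y = chart_z X" "sphere_factor Y = sphere_factor X" "sin_sq Y = sin_sq X" "Et Y = 1"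
    by (simp_all add: Y_def chart_z_def sphere_factor_def sin_sq_def Et_def)
  define V where "V = {X::real^4. X $ 2 > rp - \<delta>}"
  have V: "open V" "Y \<in> V" unfolding V_def using r by (auto simp: Y intro!: open_Collect_less continuous_intros)
  have dW: "((\<lambda>X. g (X $ 2, chart_z X)) has_derivative
    (\<lambda>h. of_real (h $ 2) * D_r g (Z $ 2, chart_z Z) + of_real (h $ 3) * D_x g (Z $ 2, chart_z Z)
      + of_real (h $ 4) * D_y g (Z $ 2, chart_z Z))) (at Z)" if "smooth_on shell g" "Z \<in> V" for g Z
    by (rule has_derivative_sphere_function[OF that(1) _ has_derivative_X2]) (use that(2) in \<open>auto simp: V_def\<close>)
  define u where "u X = Et X * w (X $ 2, chart_z X)" for X
  have u: "mode_fun \<sigma> k us \<circ> angular north = u" using mode_fun_angular by (auto simp: u_def)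
  have pu: "partial 1 u Z = Et Z * (- \<i> * of_real \<sigma>) * w (Z $ 2, chart_z Z)" "partial 2 u Z = Et Z * D_r w (Z $ 2, chart_z Z)"
    "partial 3 u Z = Et Z * D_x w (Z $ 2, chart_z Z)" "partial 4 u Z = Et Z * D_y w (Z $ 2, chart_z Z)" if "Z \<in> V" for Z
    unfolding u_def by (rule partial_eqI[OF has_derivative_mult[OF has_derivative_Et dW[OF smooth_w that]]], simp)+
  \<comment> \<open>The fluxes in ingoing coordinates; in the first two the angular derivatives have
    been replaced by -ik through \<open>rotation_w\<close>.\<close>
  define J1 where "J1 X = Et X * (of_real (sphere_factor X) * ((- \<i> * of_real \<sigma> * of_real a ^ 2 * of_real (sin_sq X) - \<i> * of_int k * of_real a) * w (X $ 2, chart_z X)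
     + of_real ((X $ 2)\<^sup>2 + a\<^sup>2) * D_r w (X $ 2, chart_z X)))" for X
  define J2 where "J2 X = Et X * (of_real (sphere_factor X) * (of_real (mu m a (X $ 2)) * D_r w (X $ 2, chart_z X)
     + (- \<i> * of_real \<sigma> * of_real ((X $ 2)\<^sup>2 + a\<^sup>2) - \<i> * of_int k * of_real a) * w (X $ 2, chart_z X)))" for X
  define J3 where "J3 X = Et X * (D_x w (X $ 2, chart_z X) - of_real (sphere_factor X) * of_real (X $ 4) * of_real a
     * (D_r w (X $ 2, chart_z X) - \<i> * of_real \<sigma> * w (X $ 2, chart_z X)))" for X
  define J4 where "J4 X = Et X * (D_y w (X $ 2, chart_z X) + of_real (sphere_factor X) * of_real (X $ 3) * of_real a
     * (D_r w (X $ 2, chart_z X) - \<i> * of_real \<sigma> * w (X $ 2, chart_z X)))" for X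
  define A where "A i j X = complex_of_real (vol_density (kerr_in_chart m a (bl_of_ingoing m a \<Phi>t \<Psi>t \<circ> angular north)) X *
      matrix_inv (kerr_in_chart m a (bl_of_ingoing m a \<Phi>t \<Psi>t \<circ> angular north) X) $ i $ j)" for i j X
  have flux: "(\<Sum>j\<in>UNIV. A 1 j Z * partial j u Z) = J1 Z" "(\<Sum>j\<in>UNIV. A 2 j Z * partial j u Z) = J2 Z"
    "(\<Sum>j\<in>UNIV. A 3 j Z * partial j u Z) = J3 Z" "(\<Sum>j\<in>UNIV. A 4 j Z * partial j u Z) = J4 Z" if Z: "Z \<in> V" for Z
  proof -
    have Zr: "Z $ 2 > rp - \<delta>" "Z $ 2 > rm" using Z rd by (auto simp: V_def)
    define s where "s = complex_of_real (sphere_factor Z)"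
    define si where "si = complex_of_real (1 / sphere_factor Z)"
    have s: "s * si = 1" using sphere_factor_pos[of Z] by (simp add: s_def si_def)
    note rot = rotation_w(1)[OF Zr(1), of Z]
    note simps = sum_4 A_def ingoing_coefficient[OF Zr(2)] vector_4 pu[OF Z] of_real_mult of_real_minus of_real_power of_real_0 s_def[symmetric] si_def[symmetric]
    show "(\<Sum>j\<in>UNIV. A 1 j Z * partial j u Z) = J1 Z" "(\<Sum>j\<in>UNIV. A 2 j Z * partial j u Z) = J2 Z"
      unfolding J1_def J2_def simps using rot by algebra+
    show "(\<Sum>j\<in>UNIV. A 3 j Z * partial j u Z) = J3 Z" "(\<Sum>j\<in>UNIV. A 4 j Z * partial j u Z) = J4 Z"
      unfolding J3_def J4_def simps using s by algebra+
  qed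
  have "wave_op (kerr_in_chart m a (bl_of_ingoing m a \<Phi>t \<Psi>t \<circ> angular north)) u Y = 0"
    using wave[of Y] r unfolding u by (simp add: Y)
  moreover have "vol_density (kerr_in_chart m a (bl_of_ingoing m a \<Phi>t \<Psi>t \<circ> angular north)) Y \<noteq> 0"
    using ingoing_chart(2)[of Y] rho_sq_pos[of r a Y] sphere_factor_pos[of Y] r rd rm_nonneg by (simp add: Y)
  ultimately have "(\<Sum>i\<in>UNIV. partial i (\<lambda>X. \<Sum>j\<in>UNIV. A i j X * partial j u X) Y) = 0"
    by (simp add: wave_op_def A_def)
  then have sum0: "partial 1 J1 Y + partial 2 J2 Y + partial 3 J3 Y + partial 4 J4 Y = 0"
  proof -
    have "partial 1 (\<lambda>X. \<Sum>j\<in>UNIV. A 1 j X * partial j u X) Y = partial 1 J1 Y" by (rule partial_cong[OF V flux(1)])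
    moreover have "partial 2 (\<lambda>X. \<Sum>j\<in>UNIV. A 2 j X * partial j u X) Y = partial 2 J2 Y" by (rule partial_cong[OF V flux(2)])
    moreover have "partial 3 (\<lambda>X. \<Sum>j\<in>UNIV. A 3 j X * partial j u X) Y = partial 3 J3 Y" by (rule partial_cong[OF V flux(3)])
    moreover have "partial 4 (\<lambda>X. \<Sum>j\<in>UNIV. A 4 j X * partial j u X) Y = partial 4 J4 Y" by (rule partial_cong[OF V flux(4)])
    moreover assume "(\<Sum>i\<in>UNIV. partial i (\<lambda>X. \<Sum>j\<in>UNIV. A i j X * partial j u X) Y) = 0"
    ultimately show ?thesis
      unfolding sum_4[of "\<lambda>i. partial i (\<lambda>X. \<Sum>j\<in>UNIV. A i j X * partial j u X) Y"] by simp
  qed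
  have df: "((\<lambda>X. complex_of_real ((X $ 2)\<^sup>2 + a\<^sup>2)) has_derivative (\<lambda>h. of_real (2 * (Y $ 2) * (h $ 2)))) (at Y)"
    by (rule has_derivative_real_function[OF _ has_derivative_X2]) (auto intro!: derivative_eq_intros)
  have dmu: "((\<lambda>X. complex_of_real (mu m a (X $ 2))) has_derivative (\<lambda>h. of_real ((2 * (Y $ 2) - 2 * m) * (h $ 2)))) (at Y)"
    by (rule has_derivative_real_function[OF _ has_derivative_X2]) (auto simp: mu_def[abs_def] intro!: derivative_eq_intros)
  note dWs = dW[OF smooth_w V(2)] dW[OF smooth_on_D(1)[OF smooth_w] V(2)] dW[OF smooth_on_D(2)[OF smooth_w] V(2)] dW[OF smooth_on_D(3)[OF smooth_w] V(2)]
  define s' where "s' = complex_of_real (- 16 / (1 + (X $ 3)\<^sup>2 + (X $ 4)\<^sup>2) ^ 3)"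
  have p1: "partial 1 J1 Y = - \<i> * of_real \<sigma> * (of_real (sphere_factor X) * ((- \<i> * of_real \<sigma> * of_real a ^ 2 * of_real (sin_sq X) - \<i> * of_int k * of_real a) * w p
     + of_real (r\<^sup>2 + a\<^sup>2) * D_r w p))"
    unfolding J1_def
    by (rule partial_eqI, (rule has_derivative_const has_derivative_Et dWs has_derivative_sphere_factor has_derivative_sin_sq df | rule has_derivative_mult has_derivative_add has_derivative_diff)+)
       (simp add: Y p_def)
  have p2: "partial 2 J2 Y = of_real (sphere_factor X) * (of_real (2 * r - 2 * m) * D_r w p + of_real (mu m a r) * D_r (D_r w) p
     + (- \<i> * of_real \<sigma> * of_real (2 * r)) * w p + (- \<i> * of_real \<sigma> * of_real (r\<^sup>2 + a\<^sup>2) - \<i> * of_int k * of_real a) * D_r w p)"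
    unfolding J2_def
    by (rule partial_eqI, (rule has_derivative_const has_derivative_Et dWs has_derivative_sphere_factor has_derivative_sin_sq df dmu | rule has_derivative_mult has_derivative_add has_derivative_diff)+)
       (simp add: Y p_def algebra_simps)
  have p3: "partial 3 J3 Y = D_x (D_x w) p - s' * of_real (X $ 3) * of_real (X $ 4) * of_real a * (D_r w p - \<i> * of_real \<sigma> * w p)
     - of_real (sphere_factor X) * of_real (X $ 4) * of_real a * (D_x (D_r w) p - \<i> * of_real \<sigma> * D_x w p)"
    unfolding J3_def
    by (rule partial_eqI, (rule has_derivative_const has_derivative_Et dWs has_derivative_sphere_factor has_derivative_coordinate | rule has_derivative_mult has_derivative_add has_derivative_diff)+)
       (simp add: Y p_def s'_def algebra_simps)
  have p4: "partial 4 J4 Y = D_y (D_y w) p + s' * of_real (X $ 4) * of_real (X $ 3) * of_real a * (D_r w p - \<i> * of_real \<sigma> * w p)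
     + of_real (sphere_factor X) * of_real (X $ 3) * of_real a * (D_y (D_r w) p - \<i> * of_real \<sigma> * D_y w p)"
    unfolding J4_def
    by (rule partial_eqI, (rule has_derivative_const has_derivative_Et dWs has_derivative_sphere_factor has_derivative_coordinate | rule has_derivative_mult has_derivative_add has_derivative_diff)+)
       (simp add: Y p_def s'_def algebra_simps)
  \<comment> \<open>The derivatives of the sphere factor cancel between the third and the fourth
    component, and the remaining angular terms of first order combine to the rotation field.\<close>
  note rot = rotation_w[OF r, of X, folded p_def]
  show ?thesis
    using sum0 rot unfolding p1 p2 p3 p4 of_real_mult of_real_numeral by algebra
qed

end

section \<open>Differentiated relations for p and q, and the exponent at the horizon\<close>

context kerr
begin

definition kp2 where "kp2 r = deriv kp' r"

definition qq2 where "qq2 r = deriv qq r"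

lemma DERIV_kp':
  assumes "r > rm"
  shows "(kp' has_real_derivative kp2 r) (at r)"
  unfolding kp2_def
  by (rule smooth_on_DERIV[OF smooth_on_kp', of r]) (use assms in \<open>auto simp: DERIV_imp_deriv\<close>)

lemma DERIV_qq:
  assumes "r > rm"
  shows "(qq has_real_derivative qq2 r) (at r)"
  unfolding qq2_def
  by (rule smooth_on_DERIV[OF smooth_on_qq, of r]) (use assms in \<open>auto simp: DERIV_imp_deriv\<close>)

lemma mu_kp'_deriv:
  assumes r: "r > rm"
  shows "(2 * r - 2 * m) * kp' r + mu m a r * kp2 r = 2 * \<kappa> * (2 * r * kp r + (r\<^sup>2 + a\<^sup>2) * kp' r)"
proof -
  have "((\<lambda>r. mu m a r * kp' r) has_real_derivative (2 * r - 2 * m) * kp' r + mu m a r * kp2 r) (at r)"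
    by (rule DERIV_cong[OF DERIV_mult[OF _ DERIV_kp'[OF r]]])
       (auto simp: mu_def[abs_def] intro!: derivative_eq_intros)
  then have "((\<lambda>r. 2 * \<kappa> * (r\<^sup>2 + a\<^sup>2) * kp r) has_real_derivative (2 * r - 2 * m) * kp' r + mu m a r * kp2 r) (at r)"
    by (rule has_field_derivative_transform_within_open[of _ _ _ "{rm<..}"]) (use r mu_kp' in auto)
  moreover have "((\<lambda>r. 2 * \<kappa> * (r\<^sup>2 + a\<^sup>2) * kp r) has_real_derivative 2 * \<kappa> * (2 * r * kp r + (r\<^sup>2 + a\<^sup>2) * kp' r)) (at r)"
    by (rule derivative_eq_intros DERIV_kp[OF r] refl | simp add: algebra_simps)+
  ultimately show ?thesis by (rule DERIV_unique)
qed

lemma qq_kp_deriv: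
  assumes r: "r > rm"
  shows "qq2 r * kp r + qq r * kp' r = - 2 * \<omega> * r"
proof -
  have "((\<lambda>r. qq r * kp r) has_real_derivative qq2 r * kp r + qq r * kp' r) (at r)"
    by (rule DERIV_cong[OF DERIV_mult[OF DERIV_qq[OF r] DERIV_kp[OF r]]]) simp
  then have "((\<lambda>r. a - \<omega> * (r\<^sup>2 + a\<^sup>2)) has_real_derivative qq2 r * kp r + qq r * kp' r) (at r)"
    unfolding qq_kp .
  moreover have "((\<lambda>r. a - \<omega> * (r\<^sup>2 + a\<^sup>2)) has_real_derivative - 2 * \<omega> * r) (at r)"
    by (auto intro!: derivative_eq_intros)
  ultimately show ?thesis by (rule DERIV_unique)
qed

text \<open>Hence x_1^\<alpha> is e^{-i(\<sigma> + k\<omega>) t_*}: besides the time factor it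
  carries the phase due to \<phi>_* = \<phi>_*' + \<omega> t_*. That \<alpha> is imaginary keeps the
  extension by 0 bounded.\<close>

lemma horizon_exponent:
  "of_real \<kappa> * horizon_exponent m a \<sigma> k = - \<i> * (of_real \<sigma> + of_int k * of_real \<omega>)"
  "Re (horizon_exponent m a \<sigma> k) = 0"
proof -
  have e: "(rp\<^sup>2 + a\<^sup>2) / mu_deriv m rp = 1 / (2 * \<kappa>)"
    using kappa_eq kappa_pos rm_less_rp by (simp add: mu_deriv_rp field_simps)
  have "\<kappa> * (2 * (sigma' m a \<sigma> k * (1 / (2 * \<kappa>)))) = \<sigma> + of_int k * \<omega>"
    using kappa_pos by (simp add: sigma'_def \<omega>_def)
  then have "complex_of_real (\<kappa> * (2 * (sigma' m a \<sigma> k * (1 / (2 * \<kappa>))))) = of_real (\<sigma> + of_int k * \<omega>)"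
    by (rule arg_cong)
  then show "of_real \<kappa> * horizon_exponent m a \<sigma> k = - \<i> * (of_real \<sigma> + of_int k * of_real \<omega>)"
    unfolding horizon_exponent_def e using kappa_pos by (simp add: mult_ac)
  show "Re (horizon_exponent m a \<sigma> k) = 0" by (simp add: horizon_exponent_def)
qed

end

section \<open>The extended mode in a Kruskal chart and its fluxes\<close>

context kerr_mode
begin

abbreviation "\<alpha> \<equiv> horizon_exponent m a \<sigma> k"

definition v :: "real^4 \<Rightarrow> complex" where "v X = w (rX X, chart_z X)"

definition U :: "real^4 \<Rightarrow> complex" where "U X = plus_power \<alpha> (X $ 1) * v X"

lemma kruskal_mode_angular: "kruskal_mode m a \<Phi>t \<sigma> k us \<circ> angular north = U"
  by (simp add: fun_eq_iff kruskal_mode_def angular_def U_def v_def sphere_mode_def rX_def mult.assoc)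

lemma smooth_on_sphere_function:
  assumes "smooth_on shell g"
  shows "smooth_on \<Omega> (\<lambda>X. g (rX X, chart_z X))"
proof (rule smooth_on_compose[OF open_Omega _ _ _ assms])
  show "open shell" by (intro open_Times) auto
  show "(rX X, chart_z X) \<in> shell" if "X \<in> \<Omega>" for X using rX(1)[OF that] by simp
  show "smooth_on \<Omega> (\<lambda>X. (rX X, chart_z X))"
    by (intro smooth_on_Pair smooth_on_rX smooth_on_linear chart_z_linear open_Omega)
qed

lemma smooth_v: "smooth_on \<Omega> v"
  unfolding v_def[abs_def] by (rule smooth_on_sphere_function[OF smooth_w])

definition A :: "4 \<Rightarrow> 4 \<Rightarrow> real^4 \<Rightarrow> complex" where
  "A i j X = complex_of_real (vol_density (kerr_in_chart m a (bl_of_kruskal m a \<Phi>t \<Psi>t \<circ> angular north)) X *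
      matrix_inv (kerr_in_chart m a (bl_of_kruskal m a \<Phi>t \<Psi>t \<circ> angular north) X) $ i $ j)"

lemma kruskal_coefficient:
  assumes "X \<in> \<Omega>"
  shows "A i j X = of_real (sphere_factor X * inverse (kp' (rX X)) * inverse \<kappa> * (rho_sq a (rX X) X * HK X $ i $ j))"
  unfolding A_def kruskal_chart[OF assms] by (simp add: divide_inverse mult_ac)

lemma smooth_A: "smooth_on \<Omega> (A i j)"
proof (rule smooth_on_cong[OF open_Omega])
  have "smooth_on \<Omega> (\<lambda>X. inverse (kp' (rX X)))"
    by (rule smooth_on_inverse[OF open_Omega smooth_on_compose_rX[OF smooth_on_kp']]) (metis kp'_pos rX(2) less_irrefl)
  then show "smooth_on \<Omega> (\<lambda>X. complex_of_real (sphere_factor X * inverse (kp' (rX X)) * inverse \<kappa> * (rho_sq a (rX X) X * HK X $ i $ j)))"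
    by (intro smooth_on_of_real smooth_on_mult smooth_on_sphere_factor smooth_on_const smooth_on_rho_sq smooth_on_HK open_Omega)
qed (simp add: kruskal_coefficient)

text \<open>The abbreviations reproduce the variables of the flux identities, so that those apply
  after unfolding; the \<rho>^2 of the density cancels the denominator of the inverse
  metric.\<close>

lemma A_entries:
  assumes X: "X \<in> \<Omega>"
  defines "G \<equiv> complex_of_real (inverse (kp' (rX X)))" and "S \<equiv> complex_of_real (sin_sq X)"
    and "f \<equiv> complex_of_real ((rX X)\<^sup>2 + a\<^sup>2)" and "s \<equiv> complex_of_real (sphere_factor X)" and "si \<equiv> complex_of_real (1 / sphere_factor X)"
    and "ki \<equiv> complex_of_real (inverse \<kappa>)" and "x \<equiv> complex_of_real (X $ 1)" and "y \<equiv> complex_of_real (X $ 2)"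
    and "z3 \<equiv> complex_of_real (X $ 3)" and "z4 \<equiv> complex_of_real (X $ 4)" and "q \<equiv> complex_of_real (qq (rX X))" and "pd \<equiv> complex_of_real (kp' (rX X))"
    and "b \<equiv> of_real a - (of_real a)^2 * complex_of_real (sin_sq X) * of_real \<omega>"
    and "d \<equiv> (of_real a)^2 * complex_of_real (sin_sq X) * (of_real \<omega>)^2 - 2 * of_real a * of_real \<omega>"
    and "K \<equiv> complex_of_real \<kappa>"
  shows "A 1 1 X = s * G * ki * ((of_real a)^2 * S * K^2 * x^2)" "A 1 2 X = s * G * ki * (K * f * pd - (of_real a)^2 * S * K^2 * x * y)"
    "A 1 3 X = s * G * ki * (- (z4 * K * x * b))" "A 1 4 X = s * G * ki * (z3 * K * x * b)"
    "A 2 1 X = s * G * ki * (K * f * pd - (of_real a)^2 * S * K^2 * x * y)" "A 2 2 X = s * G * ki * ((of_real a)^2 * S * K^2 * y^2)"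
    "A 2 3 X = s * G * ki * (- (z4 * (y * q * pd - K * y * b)))" "A 2 4 X = s * G * ki * (z3 * (y * q * pd - K * y * b))"
    "A 3 1 X = s * G * ki * (- (z4 * K * x * b))" "A 3 2 X = s * G * ki * (- (z4 * (y * q * pd - K * y * b)))"
    "A 3 3 X = s * G * ki * (si + z4^2 * d)" "A 3 4 X = s * G * ki * (- (z3 * z4 * d))"
    "A 4 1 X = s * G * ki * (z3 * K * x * b)" "A 4 2 X = s * G * ki * (z3 * (y * q * pd - K * y * b))"
    "A 4 3 X = s * G * ki * (- (z3 * z4 * d))" "A 4 4 X = s * G * ki * (si + z3^2 * d)"
proof -
  have \<rho>: "rho_sq a (rX X) X * (1 / rho_sq a (rX X) X * c) = c" for c
    using rho_sq_pos[OF rX(3)[OF X], of a X] by simp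
  note simps = kruskal_coefficient[OF X] HK_def kruskal_inverse_def Let_def vec_lambda_beta vector_4 \<rho>
    of_real_mult of_real_add of_real_diff of_real_minus of_real_power of_real_numeral
    G_def S_def f_def s_def si_def ki_def x_def y_def z3_def z4_def q_def pd_def b_def d_def K_def
  show "A 1 1 X = s * G * ki * ((of_real a)^2 * S * K^2 * x^2)" "A 1 2 X = s * G * ki * (K * f * pd - (of_real a)^2 * S * K^2 * x * y)"
    "A 1 3 X = s * G * ki * (- (z4 * K * x * b))" "A 1 4 X = s * G * ki * (z3 * K * x * b)"
    "A 2 1 X = s * G * ki * (K * f * pd - (of_real a)^2 * S * K^2 * x * y)" "A 2 2 X = s * G * ki * ((of_real a)^2 * S * K^2 * y^2)"
    "A 2 3 X = s * G * ki * (- (z4 * (y * q * pd - K * y * b)))" "A 2 4 X = s * G * ki * (z3 * (y * q * pd - K * y * b))"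
    "A 3 1 X = s * G * ki * (- (z4 * K * x * b))" "A 3 2 X = s * G * ki * (- (z4 * (y * q * pd - K * y * b)))"
    "A 3 3 X = s * G * ki * (si + z4^2 * d)" "A 3 4 X = s * G * ki * (- (z3 * z4 * d))"
    "A 4 1 X = s * G * ki * (z3 * K * x * b)" "A 4 2 X = s * G * ki * (z3 * (y * q * pd - K * y * b))"
    "A 4 3 X = s * G * ki * (- (z3 * z4 * d))" "A 4 4 X = s * G * ki * (si + z3^2 * d)"
    unfolding simps by (rule refl)+
qed

lemma A_sym: "X \<in> \<Omega> \<Longrightarrow> A i j X = A j i X"
proof -
  assume X: "X \<in> \<Omega>"
  have "\<forall>i j. A i j X = A j i X"
    unfolding forall_4 by (simp only: A_entries[OF X] simp_thms)
  then show ?thesis by blast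
qed

lemma has_derivative_sphere_function_rX:
  assumes "smooth_on shell g" "X \<in> \<Omega>"
  shows "((\<lambda>X. g (rX X, chart_z X)) has_derivative
    (\<lambda>h. of_real ((X $ 2 * h $ 1 + X $ 1 * h $ 2) / kp' (rX X)) * D_r g (rX X, chart_z X) + of_real (h $ 3) * D_x g (rX X, chart_z X)
      + of_real (h $ 4) * D_y g (rX X, chart_z X))) (at X)"
  by (rule has_derivative_sphere_function[OF assms(1) _ has_derivative_rX[OF assms(2)]]) (use rX(1)[OF assms(2)] in simp)

lemma partial_U:
  assumes X: "X \<in> half \<Omega> 1"
  defines "p \<equiv> (rX X, chart_z X)" and "P \<equiv> plus_power \<alpha> (X $ 1)"
    and "G \<equiv> complex_of_real (inverse (kp' (rX X)))"
  shows "partial 1 U X = P * (\<alpha> * w p * of_real (inverse (X $ 1)) + of_real (X $ 2) * G * D_r w p)"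
    "partial 2 U X = P * (of_real (X $ 1) * G * D_r w p)"
    "partial 3 U X = P * D_x w p" "partial 4 U X = P * D_y w p"
proof -
  have x: "X $ 1 > 0" "X \<in> \<Omega>" using X by auto
  show "partial 1 U X = P * (\<alpha> * w p * of_real (inverse (X $ 1)) + of_real (X $ 2) * G * D_r w p)"
    "partial 2 U X = P * (of_real (X $ 1) * G * D_r w p)"
    "partial 3 U X = P * D_x w p" "partial 4 U X = P * D_y w p"
    unfolding U_def[abs_def] v_def
    by (rule partial_eqI[OF has_derivative_mult[OF has_derivative_plus_power[OF x(1)] has_derivative_sphere_function_rX[OF smooth_w x(2)]]],
        simp add: P_def p_def G_def divide_inverse algebra_simps)+
qed

definition mc :: "real^4 \<Rightarrow> complex" where
  "mc X = - \<i> * of_real \<sigma> * (of_real a)^2 * of_real (sin_sq X) - \<i> * of_int k * of_real a"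

definition bc :: "real^4 \<Rightarrow> complex" where
  "bc X = - \<i> * of_real \<sigma> * (of_real a - (of_real a)^2 * of_real (sin_sq X) * of_real \<omega>) + \<i> * of_int k * of_real a * of_real \<omega>"

definition Gc :: "real^4 \<Rightarrow> complex" where "Gc X = of_real (inverse (kp' (rX X)))"

definition fc :: "real^4 \<Rightarrow> complex" where "fc X = of_real ((rX X)\<^sup>2 + a\<^sup>2)"

definition qc :: "real^4 \<Rightarrow> complex" where "qc X = of_real (qq (rX X))"

definition sc :: "real^4 \<Rightarrow> complex" where "sc X = of_real (sphere_factor X)"

definition w0 where "w0 X = w (rX X, chart_z X)"
definition wr where "wr X = D_r w (rX X, chart_z X)"
definition wx where "wx X = D_x w (rX X, chart_z X)"
definition wy where "wy X = D_y w (rX X, chart_z X)"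

abbreviation "ki \<equiv> complex_of_real (inverse \<kappa>)"
abbreviation "cc i \<equiv> (\<lambda>X::real^4. complex_of_real (X $ i))"

text \<open>The right-hand sides of the four flux identities. \<open>J1\<close> has the factor x_1
  that is needed at the past horizon; \<open>J2\<close> contains the inverse of x_1 and is
  considered for x_1 > 0 only.\<close>

definition J1 where "J1 X = plus_power \<alpha> (X $ 1) * cc 1 X * Gc X * sc X * (fc X * wr X + mc X * w0 X)"

definition J2 where "J2 X = plus_power \<alpha> (X $ 1) * sc X * (fc X * \<alpha> * w0 X * inverse (cc 1 X) + cc 2 X * fc X * Gc X * wr X
   - \<i> * of_int k * ki * cc 2 X * qc X * w0 X - cc 2 X * Gc X * mc X * w0 X)"

definition J3 where "J3 X = plus_power \<alpha> (X $ 1) * (Gc X * ki * wx X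
   - cc 4 X * (sc X * Gc X * ki * (cc 1 X * cc 2 X * qc X * wr X + bc X * w0 X)))"

definition J4 where "J4 X = plus_power \<alpha> (X $ 1) * (Gc X * ki * wy X
   + cc 3 X * (sc X * Gc X * ki * (cc 1 X * cc 2 X * qc X * wr X + bc X * w0 X)))"

lemma flux:
  assumes X: "X \<in> half \<Omega> 1"
  shows "(\<Sum>j\<in>UNIV. A 1 j X * partial j U X) = J1 X" "(\<Sum>j\<in>UNIV. A 2 j X * partial j U X) = J2 X"
    "(\<Sum>j\<in>UNIV. A 3 j X * partial j U X) = J3 X" "(\<Sum>j\<in>UNIV. A 4 j X * partial j U X) = J4 X"
proof -
  have x: "X $ 1 > 0" "X \<in> \<Omega>" using X by auto
  have h: "complex_of_real (kp' (rX X)) * complex_of_real (inverse (kp' (rX X))) = 1"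
    using kp'_pos[OF rX(2)[OF x(2)]] by (metis less_irrefl of_real_1 of_real_mult right_inverse)
  have hk: "complex_of_real \<kappa> * complex_of_real (inverse \<kappa>) = 1"
    using kappa_pos by (metis less_irrefl of_real_1 of_real_mult right_inverse)
  have hx: "complex_of_real (X $ 1) * complex_of_real (inverse (X $ 1)) = 1"
    using x(1) by (metis less_irrefl of_real_1 of_real_mult right_inverse)
  have hs: "complex_of_real (sphere_factor X) * complex_of_real (1 / sphere_factor X) = 1"
    using sphere_factor_pos[of X] by simp
  note rot = rotation_w(1)[OF rX(1)[OF x(2)], of X]
  note d = sum_4 A_entries[OF x(2)] partial_U[OF X] J1_def J2_def J3_def J4_def Gc_def fc_def qc_def sc_def mc_def bc_def w0_def wr_def wx_def wy_def
    of_real_inverse[symmetric]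
  show "(\<Sum>j\<in>UNIV. A 1 j X * partial j U X) = J1 X"
    unfolding d by (rule kruskal_flux_1[OF h hk hx horizon_exponent(1) rot])
  show "(\<Sum>j\<in>UNIV. A 2 j X * partial j U X) = J2 X"
    unfolding d by (rule kruskal_flux_2[OF h hk hx horizon_exponent(1) rot])
  show "(\<Sum>j\<in>UNIV. A 3 j X * partial j U X) = J3 X"
    unfolding d by (rule kruskal_flux_3[OF h hk hx horizon_exponent(1) rot hs])
  show "(\<Sum>j\<in>UNIV. A 4 j X * partial j U X) = J4 X"
    unfolding d by (rule kruskal_flux_4[OF h hk hx horizon_exponent(1) rot hs])
qed

end

section \<open>The equation for x_1 > 0 and the passage across the past horizon\<close>

context kerr_mode
begin

text \<open>The derivatives of the four fluxes are brought to the very form of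
  \<open>kruskal_divergence\<close>, whose hypothesis \<open>I\<close> is the mode equation at the
  same r and z.\<close>

lemma kruskal_equation:
  assumes X: "X \<in> half \<Omega> 1"
  shows "(\<Sum>i\<in>UNIV. partial i (\<lambda>Y. \<Sum>j\<in>UNIV. A i j Y * partial j U Y) X) = 0"
proof -
  have x: "X $ 1 > 0" "X \<in> \<Omega>" using X by auto
  note r = rX[OF x(2)]
  define P where "P = plus_power \<alpha> (X $ 1)"
  define p where "p = (rX X, chart_z X)"
  define pd where "pd = complex_of_real (kp' (rX X))"
  define pd2 where "pd2 = complex_of_real (kp2 (rX X))"
  define q2 where "q2 = complex_of_real (qq2 (rX X))"
  define xi where "xi = complex_of_real (inverse (X $ 1))"
  define G where "G = Gc X"
  \<comment> \<open>The sphere factor and sin^2 \<theta> depend on |z| only; \<open>s'\<close> and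
    \<open>S'\<close> times the coordinates of z are their gradients, which the rotation field
    annihilates.\<close>
  define s' where "s' = complex_of_real (- 16 / (1 + (X $ 3)\<^sup>2 + (X $ 4)\<^sup>2) ^ 3)"
  define S' where "S' = complex_of_real (2 * sphere_factor X - 16 / (1 + (X $ 3)\<^sup>2 + (X $ 4)\<^sup>2) ^ 3 * ((X $ 3)\<^sup>2 + (X $ 4)\<^sup>2))"
  define S where "S = complex_of_real (sin_sq X)"
  have h: "pd * G = 1"
    using kp'_pos[OF r(2)] unfolding pd_def G_def Gc_def by (metis less_irrefl of_real_1 of_real_mult right_inverse)
  have hk: "complex_of_real \<kappa> * ki = 1"
    using kappa_pos by (metis less_irrefl of_real_1 of_real_mult right_inverse)
  have hx: "cc 1 X * xi = 1"
    using x(1) unfolding xi_def by (metis less_irrefl of_real_1 of_real_mult right_inverse)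
  have xi': "inverse (cc 1 X) = xi" by (simp add: xi_def)
  have mu1: "complex_of_real (mu m a (rX X)) * pd = 2 * of_real \<kappa> * fc X * (cc 1 X * cc 2 X)"
    using arg_cong[OF mu_kp'[OF r(2)], of complex_of_real] unfolding r(4) by (simp add: pd_def fc_def)
  have mu2: "complex_of_real (2 * rX X - 2 * m) * pd + complex_of_real (mu m a (rX X)) * pd2
      = 2 * of_real \<kappa> * (2 * of_real (rX X) * (cc 1 X * cc 2 X) + fc X * pd)"
    using arg_cong[OF mu_kp'_deriv[OF r(2)], of complex_of_real] unfolding r(4) by (simp add: pd_def pd2_def fc_def)
  have q1: "qc X * (cc 1 X * cc 2 X) = of_real a - of_real \<omega> * fc X"
    using arg_cong[OF qq_kp[of "rX X"], of complex_of_real] unfolding r(4) by (simp add: qc_def fc_def)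
  have q2: "q2 * (cc 1 X * cc 2 X) + qc X * pd = - 2 * of_real \<omega> * of_real (rX X)"
    using arg_cong[OF qq_kp_deriv[OF r(2)], of complex_of_real] unfolding r(4) by (simp add: qc_def q2_def pd_def)
  have s34: "(s' * cc 3 X) * cc 4 X = (s' * cc 4 X) * cc 3 X" "(S' * cc 3 X) * cc 4 X = (S' * cc 4 X) * cc 3 X" by simp_all
  note rot = rotation_w[OF r(1), of X, folded p_def]
  note I = mode_equation[OF r(1), of X, folded p_def, folded fc_def S_def sc_def]
  note K = kruskal_divergence[OF h hk hx horizon_exponent(1) mu1 mu2 q1 q2 rot s34 I]
  have dP: "((\<lambda>X. plus_power \<alpha> (X $ 1)) has_derivative (\<lambda>h. P * (\<alpha> * (xi * of_real (h $ 1))))) (at X)"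
    unfolding P_def xi_def
    by (rule has_derivative_eq_rhs[OF has_derivative_plus_power[OF x(1)]]) (simp add: fun_eq_iff divide_inverse mult_ac)
  have dxi: "((\<lambda>X. inverse (cc 1 X)) has_derivative (\<lambda>h. - (xi * of_real (h $ 1) * xi))) (at X)"
    by (rule has_derivative_eq_rhs[OF Deriv.has_derivative_inverse[OF _ has_derivative_coordinate]]) (use x(1) in \<open>auto simp: xi_def\<close>)
  have dg: "((\<lambda>X. complex_of_real (g (rX X))) has_derivative (\<lambda>h. of_real g' * ((cc 2 X * of_real (h $ 1) + cc 1 X * of_real (h $ 2)) * G))) (at X)"
    if "(g has_real_derivative g') (at (rX X))" for g g'
    by (rule has_derivative_eq_rhs[OF has_derivative_real_function[OF that has_derivative_rX[OF x(2)]]])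
       (simp add: fun_eq_iff G_def Gc_def divide_inverse)
  have dG: "(Gc has_derivative (\<lambda>h. (- G * G * pd2) * ((cc 2 X * of_real (h $ 1) + cc 1 X * of_real (h $ 2)) * G))) (at X)"
    unfolding Gc_def[abs_def]
    by (rule has_derivative_eq_rhs[OF dg[OF DERIV_inverse_fun[OF DERIV_kp'[OF r(2)]]]])
       (use kp'_pos[OF r(2)] in \<open>auto simp: fun_eq_iff G_def Gc_def pd2_def power2_eq_square\<close>)
  have df: "(fc has_derivative (\<lambda>h. (2 * of_real (rX X)) * ((cc 2 X * of_real (h $ 1) + cc 1 X * of_real (h $ 2)) * G))) (at X)"
    unfolding fc_def[abs_def]
    by (rule has_derivative_eq_rhs[OF dg[of "\<lambda>r. r\<^sup>2 + a\<^sup>2" "2 * rX X"]]) (auto intro!: derivative_eq_intros)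
  have dq: "(qc has_derivative (\<lambda>h. q2 * ((cc 2 X * of_real (h $ 1) + cc 1 X * of_real (h $ 2)) * G))) (at X)"
    unfolding qc_def[abs_def] q2_def by (rule dg[OF DERIV_qq[OF r(2)]])
  have ds: "(sc has_derivative (\<lambda>h. (s' * cc 3 X) * of_real (h $ 3) + (s' * cc 4 X) * of_real (h $ 4))) (at X)"
    unfolding sc_def[abs_def] s'_def
    by (rule has_derivative_eq_rhs[OF has_derivative_sphere_factor]) (rule ext, simp only: of_real_mult of_real_add, algebra)
  have dS: "((\<lambda>X. complex_of_real (sin_sq X)) has_derivative (\<lambda>h. (S' * cc 3 X) * of_real (h $ 3) + (S' * cc 4 X) * of_real (h $ 4))) (at X)"
    unfolding S'_def
    by (rule has_derivative_eq_rhs[OF has_derivative_sin_sq]) (rule ext, simp only: of_real_mult of_real_add, algebra)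
  have dm: "(mc has_derivative (\<lambda>h. - \<i> * of_real \<sigma> * (of_real a)^2 * ((S' * cc 3 X) * of_real (h $ 3) + (S' * cc 4 X) * of_real (h $ 4)))) (at X)"
    unfolding mc_def[abs_def]
    by (rule has_derivative_eq_rhs[OF has_derivative_diff[OF has_derivative_mult_right[OF dS] has_derivative_const]]) simp
  have db: "(bc has_derivative (\<lambda>h. \<i> * of_real \<sigma> * (of_real a)^2 * of_real \<omega> * ((S' * cc 3 X) * of_real (h $ 3) + (S' * cc 4 X) * of_real (h $ 4)))) (at X)"
    unfolding bc_def[abs_def]
    by (rule has_derivative_eq_rhs[OF has_derivative_add[OF has_derivative_mult_right[OF has_derivative_diff[OF has_derivative_const
            has_derivative_mult_left[OF has_derivative_mult_right[OF dS]]]] has_derivative_const]])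
       (simp add: fun_eq_iff algebra_simps)
  have dW: "((\<lambda>X. g (rX X, chart_z X)) has_derivative
    (\<lambda>h. ((cc 2 X * of_real (h $ 1) + cc 1 X * of_real (h $ 2)) * G) * D_r g p + of_real (h $ 3) * D_x g p
      + of_real (h $ 4) * D_y g p)) (at X)" if "smooth_on shell g" for g
    unfolding p_def
    by (rule has_derivative_eq_rhs[OF has_derivative_sphere_function_rX[OF that x(2)]])
       (simp add: fun_eq_iff G_def Gc_def divide_inverse)
  note dWs = dW[OF smooth_w, folded w0_def[abs_def]] dW[OF smooth_on_D(1)[OF smooth_w], folded wr_def[abs_def]]
    dW[OF smooth_on_D(2)[OF smooth_w], folded wx_def[abs_def]] dW[OF smooth_on_D(3)[OF smooth_w], folded wy_def[abs_def]]
  note dall = dP dxi dG df dq ds dm db dWs has_derivative_const has_derivative_coordinate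
  note vals = axis_4 of_real_0 of_real_1 P_def[symmetric] G_def[symmetric] xi'
  have pw: "w0 X = w p" "wr X = D_r w p" "wx X = D_x w p" "wy X = D_y w p"
    by (simp_all add: w0_def wr_def wx_def wy_def p_def)
  have mX: "mc X = - \<i> * of_real \<sigma> * (of_real a)^2 * S - \<i> * of_int k * of_real a" by (simp add: mc_def S_def)
  have bX: "bc X = - \<i> * of_real \<sigma> * (of_real a - (of_real a)^2 * S * of_real \<omega>) + \<i> * of_int k * of_real a * of_real \<omega>"
    by (simp add: bc_def S_def)
  have p1: "partial 1 J1 X = P * ((\<alpha> + 1) * G * sc X * (fc X * wr X + mc X * w0 X) + cc 1 X * (- G * G * pd2 * (cc 2 X * G)) * sc X * (fc X * wr X + mc X * w0 X)
      + cc 1 X * G * sc X * (cc 2 X * G) * (2 * of_real (rX X) * wr X + fc X * D_r (D_r w) p + mc X * wr X))"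
    unfolding J1_def[abs_def]
    apply (rule partial_eqI, (rule dall | rule has_derivative_mult has_derivative_add has_derivative_diff)+)
    unfolding vals pw using hx by algebra
  have p2: "partial 2 J2 X = P * (sc X * ((2 * of_real (rX X) * (cc 1 X * G)) * \<alpha> * w0 X * xi + fc X * \<alpha> * (cc 1 X * G) * wr X * xi
      + fc X * G * wr X + cc 2 X * (2 * of_real (rX X) * (cc 1 X * G)) * G * wr X + cc 2 X * fc X * (- G * G * pd2 * (cc 1 X * G)) * wr X
      + cc 2 X * fc X * G * (cc 1 X * G) * D_r (D_r w) p
      - \<i> * of_int k * ki * (qc X * w0 X + cc 2 X * (q2 * (cc 1 X * G)) * w0 X + cc 2 X * qc X * (cc 1 X * G) * wr X)
      - (G * mc X * w0 X + cc 2 X * (- G * G * pd2 * (cc 1 X * G)) * mc X * w0 X + cc 2 X * G * mc X * (cc 1 X * G) * wr X)))"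
    unfolding J2_def[abs_def]
    apply (rule partial_eqI, (rule dall | rule has_derivative_mult has_derivative_add has_derivative_diff)+)
    unfolding vals pw by algebra
  have p3: "partial 3 J3 X = P * (G * ki * D_x (D_x w) p - cc 4 X * ((s' * cc 3 X) * G * ki * (cc 1 X * cc 2 X * qc X * wr X + bc X * w0 X)
      + sc X * G * ki * (cc 1 X * cc 2 X * qc X * D_x (D_r w) p + bc X * wx X + \<i> * of_real \<sigma> * (of_real a)^2 * of_real \<omega> * (S' * cc 3 X) * w0 X)))"
    unfolding J3_def[abs_def]
    apply (rule partial_eqI, (rule dall | rule has_derivative_mult has_derivative_add has_derivative_diff)+)
    unfolding vals pw by algebra
  have p4: "partial 4 J4 X = P * (G * ki * D_y (D_y w) p + cc 3 X * ((s' * cc 4 X) * G * ki * (cc 1 X * cc 2 X * qc X * wr X + bc X * w0 X)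
      + sc X * G * ki * (cc 1 X * cc 2 X * qc X * D_y (D_r w) p + bc X * wy X + \<i> * of_real \<sigma> * (of_real a)^2 * of_real \<omega> * (S' * cc 4 X) * w0 X)))"
    unfolding J4_def[abs_def]
    apply (rule partial_eqI, (rule dall | rule has_derivative_mult has_derivative_add has_derivative_diff)+)
    unfolding vals pw by algebra
  have "partial 1 J1 X + partial 2 J2 X + partial 3 J3 X + partial 4 J4 X = 0"
    unfolding p1 p2 p3 p4 pw mX bX using K by algebra
  moreover have "partial 1 (\<lambda>Y. \<Sum>j\<in>UNIV. A 1 j Y * partial j U Y) X = partial 1 J1 X"
    by (rule partial_cong[OF open_half[OF open_Omega] X flux(1)])
  moreover have "partial 2 (\<lambda>Y. \<Sum>j\<in>UNIV. A 2 j Y * partial j U Y) X = partial 2 J2 X"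
    by (rule partial_cong[OF open_half[OF open_Omega] X flux(2)])
  moreover have "partial 3 (\<lambda>Y. \<Sum>j\<in>UNIV. A 3 j Y * partial j U Y) X = partial 3 J3 X"
    by (rule partial_cong[OF open_half[OF open_Omega] X flux(3)])
  moreover have "partial 4 (\<lambda>Y. \<Sum>j\<in>UNIV. A 4 j Y * partial j U Y) X = partial 4 J4 X"
    by (rule partial_cong[OF open_half[OF open_Omega] X flux(4)])
  ultimately show ?thesis
    unfolding sum_4[of "\<lambda>i. partial i (\<lambda>Y. \<Sum>j\<in>UNIV. A i j Y * partial j U Y) X"] by simp
qed

lemma Re_alpha: "Re \<alpha> = 0" by (rule horizon_exponent(2))

lemma smooth_U: "smooth_on (half \<Omega> 1) U"
  unfolding U_def[abs_def]
  by (rule smooth_on_half_power_symbol[OF open_Omega Re_alpha symbol_smooth[OF smooth_v]])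

lemma loc_bounded_U: "loc_bounded \<Omega> 1 U"
  unfolding U_def[abs_def]
  by (rule loc_bounded_power_symbol[OF open_Omega Re_alpha symbol_smooth[OF smooth_v]])

lemma U_eq_0: "X $ 1 \<le> 0 \<Longrightarrow> U X = 0"
  by (simp add: U_def plus_power_eq_0)

lemma smooth_Gc: "smooth_on \<Omega> Gc"
  unfolding Gc_def[abs_def]
  by (intro smooth_on_of_real open_Omega smooth_on_inverse[OF open_Omega smooth_on_compose_rX[OF smooth_on_kp']])
     (metis kp'_pos rX(2) less_irrefl)

lemma smooth_sc: "smooth_on \<Omega> sc"
  unfolding sc_def[abs_def] by (intro smooth_on_of_real smooth_on_sphere_factor open_Omega)

text \<open>These are the boundary hypotheses of \<open>divergence_form_weak_solution\<close>:
  \<open>A 1 1\<close> has the factor x_1^2 and the flux \<open>J1\<close> the factor x_1, while the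
  divergence of the first column vanishes at x_1 = 0, so that \<open>loc_bounded_quotient\<close>
  applies.\<close>

lemma flux_bounds:
  shows "loc_bounded \<Omega> 1 (\<lambda>X. A 1 1 X * U X / of_real (X $ 1) ^ 2)"
    and "loc_bounded \<Omega> 1 (\<lambda>X. (\<Sum>j\<in>UNIV. A 1 j X * partial j U X) / of_real (X $ 1))"
    and "loc_bounded \<Omega> 1 (\<lambda>X. U X * (\<Sum>i\<in>UNIV. partial i (A i 1) X) / of_real (X $ 1))"
proof -
  define g where "g X = sc X * Gc X * ki * ((of_real a)^2 * of_real (sin_sq X) * (of_real \<kappa>)^2)" for X
  have g: "smooth_on \<Omega> g"
    unfolding g_def
    by (intro smooth_on_mult smooth_on_const smooth_on_of_real smooth_on_sin_sq smooth_sc smooth_Gc open_Omega)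
  have A11: "A 1 1 X = of_real (X $ 1) * (of_real (X $ 1) * g X)" if "X \<in> \<Omega>" for X
    unfolding A_entries[OF that] g_def sc_def Gc_def by (simp add: power2_eq_square)
  have "norm (A 1 1 X * U X / of_real (X $ 1) ^ 2) \<le> norm (g X * U X)" if "X \<in> half \<Omega> 1" for X
    using that by (simp add: A11 power2_eq_square)
  then show "loc_bounded \<Omega> 1 (\<lambda>X. A 1 1 X * U X / of_real (X $ 1) ^ 2)"
    by (rule loc_bounded_mono[OF loc_bounded_mult[OF loc_bounded_continuous[OF open_Omega smooth_on_continuous[OF g]] loc_bounded_U]])
  define N where "N X = Gc X * sc X * (fc X * wr X + mc X * w0 X)" for X
  have N: "smooth_on \<Omega> N"
    unfolding N_def fc_def mc_def wr_def w0_def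
    by (intro smooth_on_mult smooth_on_add smooth_on_diff smooth_on_of_real smooth_on_power smooth_on_rX smooth_on_const
        smooth_on_sin_sq smooth_sc smooth_Gc open_Omega smooth_on_sphere_function smooth_w smooth_on_D(1))
  have "norm ((\<Sum>j\<in>UNIV. A 1 j X * partial j U X) / of_real (X $ 1)) \<le> norm (plus_power \<alpha> (X $ 1) * N X)" if "X \<in> half \<Omega> 1" for X
    unfolding flux(1)[OF that] using that by (simp add: J1_def N_def mult.assoc)
  then show "loc_bounded \<Omega> 1 (\<lambda>X. (\<Sum>j\<in>UNIV. A 1 j X * partial j U X) / of_real (X $ 1))"
    by (rule loc_bounded_mono[OF loc_bounded_power_symbol[OF open_Omega Re_alpha symbol_smooth[OF N]]])
  define H where "H X = (\<Sum>i\<in>UNIV. partial i (A i 1) X)" for X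
  have H: "smooth_on \<Omega> H"
    unfolding H_def by (intro smooth_on_sum smooth_on_partial smooth_A open_Omega)
  have H0: "H X = 0" if X: "X \<in> \<Omega>" "X $ 1 = 0" for X
  proof -
    have "partial 1 (A 1 1) X = partial 1 (\<lambda>X. of_real (X $ 1) * (of_real (X $ 1) * g X)) X"
      by (rule partial_cong[OF open_Omega X(1) A11])
    also have "\<dots> = 0"
      using X(2) smooth_on_differentiable[OF g X(1)]
      by (subst partial_mult[OF differentiableI[OF has_derivative_coordinate] differentiable_mult[OF differentiableI[OF has_derivative_coordinate]]])
         (auto simp: partial_mult[OF differentiableI[OF has_derivative_coordinate]])
    finally have 1: "partial 1 (A 1 1) X = 0" .
    have s: "smooth_on \<Omega> (\<lambda>X. complex_of_real (sphere_factor X) * of_real (rp\<^sup>2 + a\<^sup>2))"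
      by (intro smooth_on_mult smooth_on_const smooth_on_of_real smooth_on_sphere_factor open_Omega)
    \<comment> \<open>On x_1 = 0 the radius is r_+, and \<open>A 2 1\<close> equals the sphere
      factor times r_+^2 + a^2. The difference \<open>D\<close> vanishes on this hyperplane, hence
      so does its derivative in the tangent direction 2, and the subtracted function does not depend
      on x_2.\<close>
    define D where "D X = A 2 1 X - complex_of_real (sphere_factor X) * of_real (rp\<^sup>2 + a\<^sup>2)" for X
    have D: "smooth_on \<Omega> D" unfolding D_def by (rule smooth_on_diff[OF open_Omega smooth_A s])
    have D0: "D Y = 0" if Y: "Y \<in> \<Omega>" "Y $ 1 = 0" for Y
    proof -
      have "rX Y = rp" using rX_eq_rp_iff[OF Y(1)] Y(2) by simp
      then show ?thesis
        unfolding D_def A_entries[OF Y(1)] using Y(2) kappa_pos kp'_pos[OF rX(2)[OF Y(1)]] by (simp add: field_simps)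
    qed
    have "partial 2 D X = 0"
      by (rule partial_eq_0_tangential[OF open_Omega D D0 X]) simp_all
    moreover have "partial 2 (\<lambda>X. complex_of_real (sphere_factor X) * of_real (rp\<^sup>2 + a\<^sup>2)) X = 0"
      by (rule partial_eqI[OF has_derivative_mult_left[OF has_derivative_sphere_factor]]) simp
    moreover have "A 2 1 = (\<lambda>X. D X + complex_of_real (sphere_factor X) * of_real (rp\<^sup>2 + a\<^sup>2))"
      by (simp add: D_def)
    ultimately have 2: "partial 2 (A 2 1) X = 0"
      using partial_add[OF smooth_on_differentiable[OF D X(1)] smooth_on_differentiable[OF s X(1)], of 2] by simp
    have "A 3 1 Y = 0" "A 4 1 Y = 0" if "Y \<in> \<Omega>" "Y $ 1 = 0" for Y
      unfolding A_entries[OF that(1)] using that(2) by simp_all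
    then have "partial 3 (A 3 1) X = 0" "partial 4 (A 4 1) X = 0"
      by (intro partial_eq_0_tangential[OF open_Omega smooth_A _ X]; simp)+
    then show ?thesis by (simp add: H_def sum_4 1 2)
  qed
  have "loc_bounded \<Omega> 1 (\<lambda>X. H X / of_real (X $ 1))"
    by (rule loc_bounded_quotient[OF open_Omega H]) (rule H0)
  from loc_bounded_mult[OF loc_bounded_U this]
  show "loc_bounded \<Omega> 1 (\<lambda>X. U X * (\<Sum>i\<in>UNIV. partial i (A i 1) X) / of_real (X $ 1))"
    by (simp add: H_def)
qed

lemma wave_equation_U:
  "distr_zero_on \<Omega> (distr_wave_op (kerr_in_chart m a (bl_of_kruskal m a \<Phi>t \<Psi>t \<circ> angular north)) (distr_of U))"
  unfolding distr_zero_on_def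
proof (intro allI impI)
  fix \<psi> assume \<psi>: "test_function \<Omega> \<psi>"
  define g where "g = kerr_in_chart m a (bl_of_kruskal m a \<Phi>t \<Psi>t \<circ> angular north)"
  \<comment> \<open>The outer factor, the inverse of the density, is moved into the test function;
    what remains is the divergence form, with a positive sign because two derivatives are
    transposed.\<close>
  define \<psi>' where "\<psi>' x = complex_of_real (1 / vol_density g x) * \<psi> x" for x
  have "smooth_on \<Omega> (\<lambda>X. \<kappa> * kp' (rX X) / (rho_sq a (rX X) X * sphere_factor X))"
  proof (intro smooth_on_divide smooth_on_mult smooth_on_const smooth_on_compose_rX[OF smooth_on_kp'] smooth_on_rho_sq smooth_on_sphere_factor open_Omega)
    show "rho_sq a (rX X) X * sphere_factor X \<noteq> 0" if "X \<in> \<Omega>" for X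
      using rho_sq_pos[OF rX(3)[OF that], of a X] sphere_factor_pos[of X] by simp
  qed
  then have "smooth_on \<Omega> (\<lambda>X. 1 / vol_density g X)"
    by (rule smooth_on_cong[OF open_Omega, rotated]) (simp add: g_def kruskal_chart(2))
  then have \<psi>': "test_function \<Omega> \<psi>'"
    unfolding \<psi>'_def by (intro test_function_mult[OF open_Omega smooth_on_of_real[OF open_Omega] \<psi>])
  have "distr_wave_op g (distr_of U) \<psi> = (\<Sum>i\<in>UNIV. \<Sum>j\<in>UNIV. \<integral>x. U x * partial j (\<lambda>x. A i j x * partial i \<psi>' x) x \<partial>lborel)"
    unfolding distr_wave_op_def distr_mult_def distr_sum_def distr_partial_def distr_of_def A_def g_def[symmetric] \<psi>'_def
    by (simp only: sum_negf minus_minus)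
  also have "\<dots> = 0"
    by (rule divergence_form_weak_solution[OF open_Omega smooth_U _ loc_bounded_U smooth_A A_sym kruskal_equation flux_bounds \<psi>'])
       (simp add: U_eq_0)
  finally show "distr_wave_op g (distr_of U) \<psi> = 0" .
qed

section \<open>Conormality, local integrability, support and agreement with the mode\<close>

lemma conormal_U: "conormal_rel (- 4) \<Omega> 1 (distr_of U)"
  using conormal_plus_power[OF open_Omega Re_alpha smooth_v, of 1] by (simp add: U_def[abs_def])

lemma locally_integrable_U: "locally_integrable_on \<Omega> U"
  unfolding locally_integrable_on_def
proof (intro allI impI, elim conjE)
  fix K assume K: "compact K" "K \<subseteq> \<Omega>"
  obtain C where C: "\<And>y. y \<in> K \<Longrightarrow> y $ 1 > 0 \<Longrightarrow> norm (U y) \<le> C" "0 \<le> C"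
    using loc_bounded_compact[OF loc_bounded_U K] by metis
  have eq: "(\<lambda>x. indicator K x *\<^sub>R U x) = (\<lambda>x. indicator K x *\<^sub>R (indicator (half \<Omega> 1) x *\<^sub>R U x))"
  proof
    show "indicator K x *\<^sub>R U x = indicator K x *\<^sub>R (indicator (half \<Omega> 1) x *\<^sub>R U x)" for x
      using K(2) U_eq_0[of x] by (cases "x \<in> K"; cases "x $ 1 > 0") auto
  qed
  have mK: "K \<in> sets borel" using K(1) by (simp add: borel_compact)
  have m1: "(\<lambda>x. indicator (half \<Omega> 1) x *\<^sub>R U x) \<in> borel_measurable borel"
    by (rule borel_measurable_continuous_on_indicator[OF _ smooth_on_continuous[OF smooth_U]])
       (use open_half[OF open_Omega] in auto)
  show "set_integrable lborel K U"
    unfolding set_integrable_def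
  proof (rule Bochner_Integration.integrable_bound[of _ "\<lambda>x. indicator K x * C"])
    show "integrable lborel (\<lambda>x. indicator K x * C)"
      using K(1) by (intro integrable_mult_left integrable_real_indicator) (use emeasure_compact_finite[OF K(1)] K(1) in \<open>auto simp: borel_compact less_top\<close>)
    show "(\<lambda>x. indicator K x *\<^sub>R U x) \<in> borel_measurable lborel"
      unfolding eq using mK m1 by measurable
    have "norm (indicator K x *\<^sub>R U x) \<le> norm (indicator K x * C)" for x
      using C(1)[of x] C(2) U_eq_0[of x] by (cases "x \<in> K"; cases "x $ 1 > 0") auto
    then show "AE x in lborel. norm (indicator K x *\<^sub>R U x) \<le> norm (indicator K x * C)" by simp
  qed
qed

lemma support_U: "distr_support \<Omega> (distr_of U) \<subseteq> {X. X $ 1 \<ge> 0}"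
proof
  fix X assume X: "X \<in> distr_support \<Omega> (distr_of U)"
  show "X \<in> {X. X $ 1 \<ge> 0}"
  proof (rule ccontr)
    assume "X \<notin> {X. X $ 1 \<ge> 0}"
    define W where "W = \<Omega> \<inter> {X. X $ 1 < 0}"
    have W: "open W" "X \<in> W" "W \<subseteq> \<Omega>"
      unfolding W_def using X \<open>X \<notin> {X. X $ 1 \<ge> 0}\<close>
      by (auto simp: distr_support_def intro!: open_Int open_Omega open_Collect_less continuous_intros)
    have "distr_zero_on W (distr_of U)"
      unfolding distr_zero_on_def distr_of_def
    proof (intro allI impI)
      fix \<psi> assume \<psi>: "test_function W \<psi>"
      have z: "(\<lambda>x. U x * \<psi> x) = (\<lambda>_. 0)"
      proof
        fix x
        show "U x * \<psi> x = 0"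
      proof (cases "x $ 1 < 0")
        case False
        then have "x \<notin> tsupport \<psi>" using test_functionD(3)[OF \<psi>] by (auto simp: W_def)
        then show ?thesis by (metis test_functionD(4)[OF \<psi>] mult_zero_right)
      qed (simp add: U_eq_0)
      qed
      show "(\<integral>x. U x * \<psi> x \<partial>lborel) = 0" unfolding z by simp
    qed
    with W X show False by (auto simp: distr_support_def)
  qed
qed

text \<open>The phases add up: x_1^\<alpha> contributes (\<sigma> + k\<omega>) t_*, the definition
  of \<open>us\<close> adds \<sigma> \<Phi> + k \<Psi>, and the Boyer-Lindquist coordinates are t =
  t_* + \<Phi>(r) and \<phi> = \<phi>_*' + \<omega> t_* + \<Psi>(r).\<close>

lemma U_exterior:
  assumes u0: "\<And>r \<theta>. r > rp \<Longrightarrow> 0 \<le> \<theta> \<Longrightarrow> \<theta> \<le> pi \<Longrightarrow>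
      us r \<theta> = exp (- \<i> * complex_of_real \<sigma> * complex_of_real (Phi_of m a \<Phi>t r)
                     - \<i> * of_int k * complex_of_real (Psi_of m a \<Psi>t r)) * u0 r \<theta>"
    and X: "X $ 1 > 0" "X $ 2 > 0"
  shows "U X = mode_fun \<sigma> k u0 ((bl_of_kruskal m a \<Phi>t \<Psi>t \<circ> angular north) X)"
proof -
  have XO: "X \<in> \<Omega>" using quadrant_Omega X by auto
  have "kp rp < kp (rX X)" using rX(4)[OF XO] X by simp
  then have r: "rX X > rp" using kp_less_iff[OF rm_less_rp rX(2)[OF XO]] by simp
  define \<theta> where "\<theta> = sphere_theta north (chart_z X)"
  \<comment> \<open>\<open>us\<close> is tied to \<open>u0\<close> only for 0 \<le> \<theta> \<le>
    \<pi>, which contains all values of \<open>sphere_theta\<close>.\<close>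
  have \<theta>: "0 \<le> \<theta>" "\<theta> \<le> pi"
  proof -
    have "0 \<le> arctan (cmod (chart_z X))" by simp
    moreover have "arctan (cmod (chart_z X)) < pi / 2" by (rule arctan_ubound)
    ultimately show "0 \<le> \<theta>" "\<theta> \<le> pi" unfolding \<theta>_def sphere_theta_def by (auto split: if_splits)
  qed
  define t where "t = ln (X $ 1)"
  have "\<alpha> * of_real t = - \<i> * (of_real \<sigma> + of_int k * of_real \<omega>) * of_real (t / \<kappa>)"
  proof -
    have "of_real (t / \<kappa>) * (of_real \<kappa> * \<alpha>) = \<alpha> * of_real t" using kappa_pos by simp
    then show ?thesis unfolding horizon_exponent(1) by (simp add: mult_ac)
  qed
  then have P: "plus_power \<alpha> (X $ 1) = exp (- \<i> * (of_real \<sigma> + of_int k * of_real \<omega>) * of_real (t / \<kappa>))"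
    using plus_power_eq[OF X(1), of \<alpha>] by (simp add: t_def)
  have "U X = exp (- \<i> * (of_real \<sigma> + of_int k * of_real \<omega>) * of_real (t / \<kappa>))
     * (exp (- \<i> * of_int k * complex_of_real (Arg (chart_z X)))
     * (exp (- \<i> * complex_of_real \<sigma> * complex_of_real (Phi_of m a \<Phi>t (rX X))
         - \<i> * of_int k * complex_of_real (Psi_of m a \<Psi>t (rX X))) * u0 (rX X) \<theta>))"
    unfolding U_def P v_def sphere_mode_def using u0[OF r \<theta>] by (simp add: \<theta>_def)
  also have "\<dots> = exp (- \<i> * complex_of_real \<sigma> * complex_of_real (t / \<kappa> + Phi_of m a \<Phi>t (rX X))
          - \<i> * of_int k * complex_of_real (Arg (chart_z X) + \<omega> * (t / \<kappa>) + Psi_of m a \<Psi>t (rX X))) * u0 (rX X) \<theta>"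
  proof -
    have "- \<i> * (of_real \<sigma> + of_int k * of_real \<omega>) * of_real (t / \<kappa>) + (- \<i> * of_int k * complex_of_real (Arg (chart_z X))
      + (- \<i> * complex_of_real \<sigma> * complex_of_real (Phi_of m a \<Phi>t (rX X)) - \<i> * of_int k * complex_of_real (Psi_of m a \<Psi>t (rX X))))
      = - \<i> * complex_of_real \<sigma> * complex_of_real (t / \<kappa> + Phi_of m a \<Phi>t (rX X))
          - \<i> * of_int k * complex_of_real (Arg (chart_z X) + \<omega> * (t / \<kappa>) + Psi_of m a \<Psi>t (rX X))"
      by (simp only: of_real_add of_real_mult) algebra
    then show ?thesis unfolding mult.assoc[symmetric] exp_add[symmetric] by (simp only:)
  qed
  also have "\<dots> = mode_fun \<sigma> k u0 ((bl_of_kruskal m a \<Phi>t \<Psi>t \<circ> angular north) X)"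
    using bl_of_kruskal_eq[OF XO, of north] X by (simp add: mode_fun_def t_def \<theta>_def)
  finally show ?thesis .
qed

end

theorem mainTheorem3:
  fixes m a \<sigma> \<delta> :: real and k :: int
    and \<Phi>t \<Psi>t :: "real \<Rightarrow> real"
    and u0 us :: "real \<Rightarrow> real \<Rightarrow> complex"
  assumes "m > 0" and "\<bar>a\<bar> < m" and "\<sigma> \<noteq> 0"
    and "regular_parts m a \<Phi>t \<Psi>t"
    and "mode_solution m a \<sigma> k u0"
    and "0 < \<delta>" and "\<delta> < r_plus m a - r_minus m a"
    and "future_horizon_extension m a \<Phi>t \<Psi>t \<sigma> k \<delta> u0 us"
  shows "let \<Omega> = kruskal_region m a \<Phi>t \<delta>;
             BL = (\<lambda>north. bl_of_kruskal m a \<Phi>t \<Psi>t \<circ> angular north);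
             ut = (\<lambda>north. kruskal_mode m a \<Phi>t \<sigma> k us \<circ> angular north)
         in open \<Omega> \<and> {X. X $ 1 \<ge> 0 \<and> X $ 2 \<ge> 0} \<subseteq> \<Omega> \<and>
            (\<forall>north. locally_integrable_on \<Omega> (ut north)) \<and>
            (\<forall>north X. X $ 1 > 0 \<and> X $ 2 > 0 \<longrightarrow>
               ut north X = mode_fun \<sigma> k u0 (BL north X)) \<and>
            (\<forall>north. distr_support \<Omega> (distr_of (ut north)) \<subseteq> {X. X $ 1 \<ge> 0}) \<and>
            (\<exists>s. \<forall>north. conormal_rel s \<Omega> 1 (distr_of (ut north))) \<and>
            (\<forall>north. distr_zero_on \<Omega>
               (distr_wave_op (kerr_in_chart m a (BL north)) (distr_of (ut north))))"
proof -
  interpret kerr_region m a \<Phi>t \<Psi>t \<delta>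
    by unfold_locales (use assms in auto)
  \<comment> \<open>The locale fixes one chart of the sphere, so its facts are taken for each value
    of \<open>north\<close> separately.\<close>
  have M: "kerr_mode m a \<Phi>t \<Psi>t \<delta> \<sigma> k us north" for north
    by unfold_locales (use assms(8) in \<open>auto simp: future_horizon_extension_def\<close>)
  have u0: "us r \<theta> = exp (- \<i> * complex_of_real \<sigma> * complex_of_real (Phi_of m a \<Phi>t r)
                     - \<i> * of_int k * complex_of_real (Psi_of m a \<Psi>t r)) * u0 r \<theta>"
    if "r > r_plus m a" "0 \<le> \<theta>" "\<theta> \<le> pi" for r \<theta>
    using assms(8) that by (simp add: future_horizon_extension_def)
  show ?thesis
    unfolding Let_def kerr_mode.kruskal_mode_angular[OF M]
    using open_Omega quadrant_Omega kerr_mode.locally_integrable_U[OF M] kerr_mode.U_exterior[OF M u0]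
      kerr_mode.support_U[OF M] kerr_mode.conormal_U[OF M] kerr_mode.wave_equation_U[OF M]
    by blast
qed

end
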